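(* Let $B$ be a PSIT, $H\in\mathfrak M^B$ and $A\in\mathfrak V^B$. Suppose $H$ is integrable on $B$ w.r.t. $A$. Then $H_\bullet A\in\mathfrak V^B$, and the following statements hold. (1) If $(T_n,H^{(n)})$ for $H\in\mathfrak M^B$ and $(T_n,A^{(n)})$ for $A\in\mathfrak V^B$ are FCSs such that for each $n\in\mathbb N^+$, $H^{(n)}$ is integrable w.r.t. $A^{(n)}$, then $(T_n,H^{(n)}.A^{(n)})$ is an FCS for $H_\bullet A\in\mathfrak V^B$, and $$H_\bullet A=\Big((H_0A_0)I_{[\![0]\!]}+\sum_{n=1}^{+\infty}(H^{(n)}.A^{(n)})I_{]\!]T_{n-1},T_n]\!]}\Big)\mathfrak I_B,\qquad T_0=0.$$ Furthermore, if $(S_n,\widetilde H^{(n)})$ for $H\in\mathfrak M^B$ and $(\widetilde S_n,\widetilde A^{(n)})$ for $A\in\mathfrak V^B$ are FCSs such that for each $n\in\mathbb N^+$, $\widetilde H^{(n)}$ is integrable w.r.t. $\widetilde A^{(n)}$, then $H_\bullet A=\widetilde X$, where $$\widetilde X=\Big((H_0A_0)I_{[\![0]\!]}+\sum_{n=1}^{+\infty}(\widetilde H^{(n)}.\widetilde A^{(n)})I_{]\!]\widetilde T_{n-1},\widetilde T_n]\!]}\Big)\mathfrak I_B,\qquad \widetilde T_0=0,\quad \widetilde T_n=S_n\wedge\widetilde S_n,\ n\in\mathbb N^+.$$ (2) If $(\tau_n)$ is an FS for $B$, then $(\tau_n,H^{\tau_n}.A^{\tau_n})$ is an FCS for $H_\bullet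 A\in\mathfrak V^B$, and $$H_\bullet A=\Big((H_0A_0)I_{[\![0]\!]}+\sum_{n=1}^{+\infty}(H^{\tau_n}.A^{\tau_n})I_{]\!]\tau_{n-1},\tau_n]\!]}\Big)\mathfrak I_B,\qquad \tau_0=0.$$ Furthermore, if $(\widetilde\tau_n)$ is also an FS for $B$, then $H_\bullet A=\widetilde X$, where $$\widetilde X=\Big((H_0A_0)I_{[\![0]\!]}+\sum_{n=1}^{+\infty}(H^{\widetilde\tau_n}.A^{\widetilde\tau_n})I_{]\!]\widetilde\tau_{n-1},\widetilde\tau_n]\!]}\Big)\mathfrak I_B,\qquad \widetilde\tau_0=0.$$
   Context: Fix a probability space $(\Omega,\mathcal F,\mathbb P)$ with a filtration $\mathbb F=(\mathcal F_t)_{t\ge0}$ satisfying the usual conditions; $\mathbb R^+=[0,+\infty[$, $\mathbb N^+=\{1,2,\dots\}$. A process is a family of real random variables indexed by $\mathbb R^+$; indistinguishable processes are regarded as the same ($X=Y$ means indistinguishability). For stopping times $S,T$, $[\![S,T]\!]=\{(\omega,t)\in\Omega\times\mathbb R^+:S(\omega)\le t\le T(\omega)\}$; $[\![S,T[\![$, $]\!]S,T]\!]$, $]\!]S,T[\![$ are defined analogously with strict inequality at open ends; $[\![T]\!]=[\![T,T]\!]$. $T_n\uparrow T$ means that $(T_n)$ is an increasing sequence of stopping times with limit $T$. Juxtaposition of sets means intersection. If $X$ is a real function on $\widetilde C\subseteq\Omega\times\mathbb R^+$, then $XI_C$ is the function on $\Omega\times\mathbb R^+$ equal to $X$ on $C\cap\widetilde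 C$ and $0$ elsewhere. A set $B\subseteq\Omega\times\mathbb R^+$ is a predictable set of interval type (PSIT) if it is predictable and there is a non-negative (possibly infinite) random variable $T$ such that each section $B_\omega=\{t:(\omega,t)\in B\}$ is nonempty and equals $[0,T(\omega)[$ or $[0,T(\omega)]$. The debut of $B^c$ is $\omega\mapsto\inf\{t:(\omega,t)\notin B\}$. A fundamental sequence (FS) for $B$ is an increasing sequence $(\tau_n)$ of stopping times with $B=\bigcup_n[\![0,\tau_n]\!]$ (one always exists). A process on $B$ is a real function $X$ on $B$ such that $XI_B$ is a process; processes $X,Y$ on $B$ are identified ($X=Y$) if $XI_B=YI_B$. For $X$ defined on a set containing $B$, $X\mathfrak I_B$ is its restriction to $B$. A stopping time $\tau$ is a stopping time on $B$ if $[\![0,\tau]\!]\subseteq B$; then for a process $X$ on $B$, $X^\tau:=XI_{[\![0,\tau]\!]}+X_\tau I_{]\!]\tau,+\infty[\![}$ (a process on $\Omega\times\mathbb R^+$). Let $T$ be the debut of $B^c$. A coupled sequence (CS) for a process $X$ on $B$ is a sequence $(T_n,X^{(n)})_{n\in\mathbb N^+}$ with $T_n$ stopping times, $T_n\uparrow T$, $\bigcup_n[\![0,T_n]\!]\supseteq B$, $X^{(n)}$ processes, and $XI_{B[\![0,T_n]\!]}=X^{(n)}I_{B[\![0,T_n]\!]}$ for each $n$. For a class $\mathcal D$ of processes, $\mathcal D^B$ is the set of processes $X$ on $B$ having a CS with all $X^{(n)}\in\mathcal D$; such a CS is called a fundamental coupled sequence (FCS) for $X\in\mathcal D^B$. $\mathfrak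 M$ is the class of all measurable processes and $\mathfrak V$ the class of all (not necessarily adapted) processes with finite variation (c\`adl\`ag paths, of finite variation on bounded intervals). Pathwise integrals over $[0,t]$ include the mass at $0$: $\int_{[0,t]}H_s\,dA_s=H_0A_0+\int_{]0,t]}H_s\,dA_s$, and $\int_{[0,t]}|dA_s|$ is the variation process of $A$ (including $|A_0|$). For $H\in\mathfrak M$, $A\in\mathfrak V$, $H$ is integrable w.r.t. $A$ if $\int_{[0,t]}|H_s(\omega)||dA_s(\omega)|<+\infty$ for all $(\omega,t)\in\Omega\times\mathbb R^+$, and then $(H.A)_t(\omega)=\int_{[0,t]}H_s(\omega)\,dA_s(\omega)$. For $H\in\mathfrak M^B$, $A\in\mathfrak V^B$, $H$ is integrable on $B$ w.r.t. $A$ if $\int_{[0,t]}|H_s(\omega)||dA_s(\omega)|<+\infty$ for all $(\omega,t)\in B$, and then $H_\bullet A$ is the process on $B$ given by $(H_\bullet A)(\omega,t)=\int_{[0,t]}H_s(\omega)\,dA_s(\omega)$, $(\omega,t)\in B$. *)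

theory Defs
  imports "HOL-Probability.Probability"
begin

text \<open>
  Time runs through the nonnegative reals.  A process is a total function on \<^typ>\<open>'a \<times> real\<close> whose
  values at negative times (and outside the sample space) are never looked at.  Random times take
  values in \<^typ>\<open>ennreal\<close>.  Sequences indexed by the positive integers are functions on \<^typ>\<open>nat\<close>
  whose value at \<open>0\<close> is never looked at.
\<close>

section \<open>Filtered probability spaces and stochastic intervals\<close>

text \<open>
  The library notions \<^const>\<open>filtration\<close> and \<^const>\<open>stopping_time\<close> need one index type for the
  filtration and for the values of stopping times, so the filtration is continued to \<open>\<infinity>\<close> by the
  full sigma-algebra.  This puts no condition on a stopping time at \<open>\<infinity>\<close>, and makes the filtration
  axioms include that every \<open>F t\<close> is a sub-sigma-algebra of \<open>P\<close>.
\<close>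

definition extended_filtration :: "'a measure \<Rightarrow> (real \<Rightarrow> 'a measure) \<Rightarrow> ennreal \<Rightarrow> 'a measure" where
  "extended_filtration P F s = (if s = \<top> then P else F (enn2real s))"

locale usual_filtered_prob_space =
  prob_space P + complete_measure P + filtration "space P" "extended_filtration P F"
  for P :: "'a measure" and F :: "real \<Rightarrow> 'a measure" +
  assumes right_continuous: "\<And>t. 0 \<le> t \<Longrightarrow> sets (F t) = (\<Inter>s\<in>{t<..}. sets (F s))"
    and null_sets_F0: "null_sets P \<subseteq> sets (F 0)"

definition stopping :: "'a measure \<Rightarrow> (real \<Rightarrow> 'a measure) \<Rightarrow> ('a \<Rightarrow> ennreal) \<Rightarrow> bool" where
  "stopping P F T \<longleftrightarrow> stopping_time (extended_filtration P F) T"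

definition sint_cc :: "'a measure \<Rightarrow> ('a \<Rightarrow> ennreal) \<Rightarrow> ('a \<Rightarrow> ennreal) \<Rightarrow> ('a \<times> real) set" where
  "sint_cc P S T = {(\<omega>, t). \<omega> \<in> space P \<and> 0 \<le> t \<and> S \<omega> \<le> ennreal t \<and> ennreal t \<le> T \<omega>}"

definition sint_oc :: "'a measure \<Rightarrow> ('a \<Rightarrow> ennreal) \<Rightarrow> ('a \<Rightarrow> ennreal) \<Rightarrow> ('a \<times> real) set" where
  "sint_oc P S T = {(\<omega>, t). \<omega> \<in> space P \<and> 0 \<le> t \<and> S \<omega> < ennreal t \<and> ennreal t \<le> T \<omega>}"

definition sint_oo :: "'a measure \<Rightarrow> ('a \<Rightarrow> ennreal) \<Rightarrow> ('a \<Rightarrow> ennreal) \<Rightarrow> ('a \<times> real) set" where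
  "sint_oo P S T = {(\<omega>, t). \<omega> \<in> space P \<and> 0 \<le> t \<and> S \<omega> < ennreal t \<and> ennreal t < T \<omega>}"

definition predictable_sigma :: "'a measure \<Rightarrow> (real \<Rightarrow> 'a measure) \<Rightarrow> ('a \<times> real) measure" where
  "predictable_sigma P F = sigma (space P \<times> {0..})
     ({C \<times> {0} |C. C \<in> sets (F 0)} \<union> {C \<times> {s<..t} |C s t. 0 \<le> s \<and> s < t \<and> C \<in> sets (F s)})"


section \<open>Predictable sets of interval type\<close>

definition psit :: "'a measure \<Rightarrow> (real \<Rightarrow> 'a measure) \<Rightarrow> ('a \<times> real) set \<Rightarrow> bool" where
  "psit P F B \<longleftrightarrow> B \<in> sets (predictable_sigma P F) \<and>
     (\<exists>T :: 'a \<Rightarrow> ennreal. T \<in> borel_measurable P \<and>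
       (\<forall>\<omega>\<in>space P. {t. (\<omega>, t) \<in> B} \<noteq> {} \<and>
          ({t. (\<omega>, t) \<in> B} = {t. 0 \<le> t \<and> ennreal t < T \<omega>} \<or>
           {t. (\<omega>, t) \<in> B} = {t. 0 \<le> t \<and> ennreal t \<le> T \<omega>})))"

definition debut_compl :: "('a \<times> real) set \<Rightarrow> 'a \<Rightarrow> ennreal" where
  "debut_compl B \<omega> = Inf (ennreal ` {t. 0 \<le> t \<and> (\<omega>, t) \<notin> B})"

definition fundamental_seq ::
  "'a measure \<Rightarrow> (real \<Rightarrow> 'a measure) \<Rightarrow> ('a \<times> real) set \<Rightarrow> (nat \<Rightarrow> 'a \<Rightarrow> ennreal) \<Rightarrow> bool" where
  "fundamental_seq P F B \<tau> \<longleftrightarrow>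
     (\<forall>n\<ge>1. stopping P F (\<tau> n)) \<and>
     (\<forall>\<omega>\<in>space P. mono_on {1..} (\<lambda>n. \<tau> n \<omega>)) \<and>
     B = (\<Union>n\<in>{1..}. sint_cc P (\<lambda>_. 0) (\<tau> n))"


section \<open>Processes, and processes on a set\<close>

definition process :: "'a measure \<Rightarrow> ('a \<times> real \<Rightarrow> real) \<Rightarrow> bool" where
  "process P X \<longleftrightarrow> (\<forall>t\<ge>0. (\<lambda>\<omega>. X (\<omega>, t)) \<in> borel_measurable P)"

definition indist :: "'a measure \<Rightarrow> ('a \<times> real \<Rightarrow> real) \<Rightarrow> ('a \<times> real \<Rightarrow> real) \<Rightarrow> bool" where
  "indist P X Y \<longleftrightarrow> (AE \<omega> in P. \<forall>t\<ge>0. X (\<omega>, t) = Y (\<omega>, t))"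

definition cut :: "('a \<times> real \<Rightarrow> real) \<Rightarrow> ('a \<times> real) set \<Rightarrow> ('a \<times> real \<Rightarrow> real)" where
  "cut X C = (\<lambda>z. if z \<in> C then X z else 0)"

text \<open>
  A real function on \<open>B\<close> is represented by a total function.  All notions concerning processes on
  \<open>B\<close> only depend on the values on \<open>B\<close>.
\<close>

definition process_on :: "'a measure \<Rightarrow> ('a \<times> real) set \<Rightarrow> ('a \<times> real \<Rightarrow> real) \<Rightarrow> bool" where
  "process_on P B X \<longleftrightarrow> process P (cut X B)"

definition eq_on :: "'a measure \<Rightarrow> ('a \<times> real) set \<Rightarrow> ('a \<times> real \<Rightarrow> real) \<Rightarrow> ('a \<times> real \<Rightarrow> real) \<Rightarrow> bool" where
  "eq_on P B X Y \<longleftrightarrow> indist P (cut X B) (cut Y B)"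

definition stopped :: "'a measure \<Rightarrow> ('a \<times> real \<Rightarrow> real) \<Rightarrow> ('a \<Rightarrow> ennreal) \<Rightarrow> ('a \<times> real \<Rightarrow> real)" where
  "stopped P X \<tau> = (\<lambda>(\<omega>, t).
     cut X (sint_cc P (\<lambda>_. 0) \<tau>) (\<omega>, t) +
     cut (\<lambda>(\<omega>, _). X (\<omega>, enn2real (\<tau> \<omega>))) (sint_oo P \<tau> (\<lambda>_. \<top>)) (\<omega>, t))"

definition coupled_seq ::
  "'a measure \<Rightarrow> (real \<Rightarrow> 'a measure) \<Rightarrow> ('a \<times> real) set \<Rightarrow> ('a \<times> real \<Rightarrow> real) \<Rightarrow>
   (nat \<Rightarrow> 'a \<Rightarrow> ennreal) \<Rightarrow> (nat \<Rightarrow> 'a \<times> real \<Rightarrow> real) \<Rightarrow> bool" where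
  "coupled_seq P F B X T Xs \<longleftrightarrow>
     (\<forall>n\<ge>1. stopping P F (T n)) \<and>
     (\<forall>\<omega>\<in>space P. mono_on {1..} (\<lambda>n. T n \<omega>) \<and> (\<lambda>n. T n \<omega>) \<longlonglongrightarrow> debut_compl B \<omega>) \<and>
     B \<subseteq> (\<Union>n\<in>{1..}. sint_cc P (\<lambda>_. 0) (T n)) \<and>
     (\<forall>n\<ge>1. process P (Xs n)) \<and>
     (\<forall>n\<ge>1. indist P (cut X (B \<inter> sint_cc P (\<lambda>_. 0) (T n)))
                     (cut (Xs n) (B \<inter> sint_cc P (\<lambda>_. 0) (T n))))"

definition class_on ::
  "'a measure \<Rightarrow> (real \<Rightarrow> 'a measure) \<Rightarrow> ('a \<times> real) set \<Rightarrow> ('a \<times> real \<Rightarrow> real) set \<Rightarrow>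
   ('a \<times> real \<Rightarrow> real) set" where
  "class_on P F B D = {X. process_on P B X \<and>
     (\<exists>T Xs. coupled_seq P F B X T Xs \<and> (\<forall>n\<ge>1. Xs n \<in> D))}"

definition fcs ::
  "'a measure \<Rightarrow> (real \<Rightarrow> 'a measure) \<Rightarrow> ('a \<times> real) set \<Rightarrow> ('a \<times> real \<Rightarrow> real) set \<Rightarrow>
   ('a \<times> real \<Rightarrow> real) \<Rightarrow> (nat \<Rightarrow> 'a \<Rightarrow> ennreal) \<Rightarrow> (nat \<Rightarrow> 'a \<times> real \<Rightarrow> real) \<Rightarrow> bool" where
  "fcs P F B D X T Xs \<longleftrightarrow>
     X \<in> class_on P F B D \<and> coupled_seq P F B X T Xs \<and> (\<forall>n\<ge>1. Xs n \<in> D)"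


section \<open>Lebesgue--Stieltjes integrals along a path\<close>

definition variation :: "(real \<Rightarrow> real) \<Rightarrow> real \<Rightarrow> ennreal" where
  "variation a t = (SUP d\<in>{d. d division_of {0..t}}. ennreal (\<Sum>k\<in>d. \<bar>a (Sup k) - a (Inf k)\<bar>))"

definition fv_path :: "(real \<Rightarrow> real) \<Rightarrow> real \<Rightarrow> bool" where
  "fv_path a t \<longleftrightarrow>
     (\<forall>s\<in>{0..<t}. continuous (at_right s) a) \<and>
     (\<forall>s\<in>{0<..t}. \<exists>l. (a \<longlongrightarrow> l) (at_left s)) \<and>
     variation a t < \<infinity>"

text \<open>
  The path on \<open>[0,t]\<close> and its variation (increased by \<open>\<bar>a 0\<bar>\<close>) are continued by \<open>0\<close> to negative
  times and as constants after \<open>t\<close>; their jump at \<open>0\<close> is what gives the measures below their mass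
  at \<open>0\<close>.
\<close>

definition path_ext :: "(real \<Rightarrow> real) \<Rightarrow> real \<Rightarrow> real \<Rightarrow> real" where
  "path_ext a t s = (if s < 0 then 0 else a (min s t))"

definition var_ext :: "(real \<Rightarrow> real) \<Rightarrow> real \<Rightarrow> real \<Rightarrow> real" where
  "var_ext a t s = (if s < 0 then 0 else \<bar>a 0\<bar> + enn2real (variation a (min s t)))"

definition abs_measure :: "(real \<Rightarrow> real) \<Rightarrow> real \<Rightarrow> real measure" where
  "abs_measure a t = interval_measure (var_ext a t)"

definition pos_measure :: "(real \<Rightarrow> real) \<Rightarrow> real \<Rightarrow> real measure" where
  "pos_measure a t = interval_measure (\<lambda>s. (var_ext a t s + path_ext a t s) / 2)"

definition neg_measure :: "(real \<Rightarrow> real) \<Rightarrow> real \<Rightarrow> real measure" where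
  "neg_measure a t = interval_measure (\<lambda>s. (var_ext a t s - path_ext a t s) / 2)"

text \<open>
  Finiteness of the integral of \<open>\<bar>h\<bar>\<close> over \<open>[0,t]\<close> with respect to \<open>\<bar>da\<bar>\<close>, which includes that this
  integral makes sense: \<open>a\<close> is cadlag of finite variation and \<open>h\<close> is Borel on \<open>[0,t]\<close>.
\<close>

definition path_integrable :: "(real \<Rightarrow> real) \<Rightarrow> (real \<Rightarrow> real) \<Rightarrow> real \<Rightarrow> bool" where
  "path_integrable h a t \<longleftrightarrow> fv_path a t \<and> set_integrable (abs_measure a t) {0..t} h"

definition path_integral :: "(real \<Rightarrow> real) \<Rightarrow> (real \<Rightarrow> real) \<Rightarrow> real \<Rightarrow> real" where
  "path_integral h a t =
     (LINT s:{0..t}|pos_measure a t. h s) - (LINT s:{0..t}|neg_measure a t. h s)"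


section \<open>Integrals of processes\<close>

definition measurable_processes :: "'a measure \<Rightarrow> ('a \<times> real \<Rightarrow> real) set" where
  "measurable_processes P = borel_measurable (P \<Otimes>\<^sub>M restrict_space borel {0..})"

definition fv_processes :: "'a measure \<Rightarrow> ('a \<times> real \<Rightarrow> real) set" where
  "fv_processes P = {X. process P X \<and> (\<forall>\<omega>\<in>space P. \<forall>t\<ge>0. fv_path (\<lambda>s. X (\<omega>, s)) t)}"

definition integrable_wrt :: "'a measure \<Rightarrow> ('a \<times> real \<Rightarrow> real) \<Rightarrow> ('a \<times> real \<Rightarrow> real) \<Rightarrow> bool" where
  "integrable_wrt P H A \<longleftrightarrow>
     (\<forall>\<omega>\<in>space P. \<forall>t\<ge>0. path_integrable (\<lambda>s. H (\<omega>, s)) (\<lambda>s. A (\<omega>, s)) t)"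

definition stieltjes :: "('a \<times> real \<Rightarrow> real) \<Rightarrow> ('a \<times> real \<Rightarrow> real) \<Rightarrow> ('a \<times> real \<Rightarrow> real)" where
  "stieltjes H A = (\<lambda>(\<omega>, t). path_integral (\<lambda>s. H (\<omega>, s)) (\<lambda>s. A (\<omega>, s)) t)"

definition integrable_on_wrt ::
  "('a \<times> real) set \<Rightarrow> ('a \<times> real \<Rightarrow> real) \<Rightarrow> ('a \<times> real \<Rightarrow> real) \<Rightarrow> bool" where
  "integrable_on_wrt B H A \<longleftrightarrow>
     (\<forall>(\<omega>, t)\<in>B. path_integrable (\<lambda>s. H (\<omega>, s)) (\<lambda>s. A (\<omega>, s)) t)"

definition stieltjes_on ::
  "('a \<times> real) set \<Rightarrow> ('a \<times> real \<Rightarrow> real) \<Rightarrow> ('a \<times> real \<Rightarrow> real) \<Rightarrow> ('a \<times> real \<Rightarrow> real)" where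
  "stieltjes_on B H A =
     restrict (\<lambda>(\<omega>, t). path_integral (\<lambda>s. H (\<omega>, s)) (\<lambda>s. A (\<omega>, s)) t) B"

text \<open>
  The process pasted together from \<open>H\<^sub>0 A\<^sub>0\<close> at time \<open>0\<close> and from \<open>Xs n\<close> on the \<open>n\<close>-th stochastic
  interval, restricted to \<open>B\<close>; the update of \<open>T\<close> is the convention \<open>T\<^sub>0 = 0\<close>.
\<close>

definition pasted ::
  "'a measure \<Rightarrow> ('a \<times> real) set \<Rightarrow> ('a \<times> real \<Rightarrow> real) \<Rightarrow> ('a \<times> real \<Rightarrow> real) \<Rightarrow>
   (nat \<Rightarrow> 'a \<Rightarrow> ennreal) \<Rightarrow> (nat \<Rightarrow> 'a \<times> real \<Rightarrow> real) \<Rightarrow> ('a \<times> real \<Rightarrow> real)" where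
  "pasted P B H A T Xs = (let T' = T(0 := \<lambda>_. 0) in
     restrict (\<lambda>z.
       cut (\<lambda>(\<omega>, _). H (\<omega>, 0) * A (\<omega>, 0)) (sint_cc P (\<lambda>_. 0) (\<lambda>_. 0)) z +
       (\<Sum>n. cut (Xs (Suc n)) (sint_oc P (T' n) (T' (Suc n))) z)) B)"

end

theory Submission
  imports Defs
begin

text \<open>
  Pathwise, the integral up to \<open>t\<close> only depends on the two paths up to \<open>t\<close>, so on \<open>B\<inter>[0,T\<^sub>n]\<close> every
  coupled integral agrees almost surely with the integral on \<open>B\<close>; this gives the pasting formulas.
  For right-continuous paths of finite variation the variation is right-continuous, because it is the
  least increasing function dominating the increments, and it is a supremum of sums over rational
  grids.  Hence the Stieltjes measures of the paths form a measurable kernel, and the integral process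
  is measurable with cadlag paths of finite variation.

  That the integral belongs to the localized class needs a fundamental sequence for \<open>B\<close>: the integral
  may explode at the end of an interval that is open on the right.  Such a sequence is constructed
  without section theorems.  For a random time \<open>\<tau>\<close>, every predictable set is inner regular, with
  respect to the law of \<open>(\<omega>, \<tau> \<omega>)\<close>, for the zero sets of continuous adapted processes.  For
  the end \<open>\<tau>\<close> of the sections of \<open>B\<close>, zero sets \<open>{X\<^sub>n = 0}\<close> outside \<open>B\<close> therefore exhaust almost surely the
  points \<open>(\<omega>, \<tau> \<omega>)\<close> outside \<open>B\<close>, and the times at which \<open>X\<^sub>n\<close> first falls below a small level
  announce them, by the Borel--Cantelli lemma.
\<close>

section \<open>Variation of paths\<close>

text \<open>Membership in \<open>class_on\<close> ties a process to measurable ones only up to a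
  null set of sample points, so it need not be jointly measurable on \<open>B\<close>. Measurability
  is therefore proved for a jointly measurable modification that vanishes on the exceptional set,
  and is carried over at fixed times by completeness of \<open>P\<close>; path properties of stopped
  integrals hold at every sample point. The coupled sequences given with \<open>H\<close> and
  \<open>A\<close> need not serve for the integral, since their times may pass the point where it
  explodes. Hence the need for intervals lying inside \<open>B\<close>. Continuous adapted processes
  are rich enough as test objects because a generating rectangle starts at a time \<open>u\<close>
  at which its base is known, so a ramp starting at \<open>u\<close> is adapted. Their zero sets
  replace compact sets in two respects: the set below a positive level is open in time, so its debut
  is visible at rational times; and if the zero set avoids \<open>B\<close>, the process has a
  positive minimum on every compact initial piece of a section. Conversely, a zero at a missing end
  point forces every positive level to be crossed strictly before it.\<close>

lemma division_of_Icc_elem: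
  fixes a b :: real
  assumes "d division_of {a..b}" "k \<in> d"
  shows "k = {Inf k..Sup k}" "a \<le> Inf k" "Inf k \<le> Sup k" "Sup k \<le> b"
proof -
  obtain x y where k: "k = cbox x y" using division_ofD(4)[OF assms] by blast
  moreover have "k \<noteq> {}" using division_ofD(3)[OF assms] .
  moreover have "k \<subseteq> {a..b}" using division_ofD(2)[OF assms] .
  ultimately show "k = {Inf k..Sup k}" "a \<le> Inf k" "Inf k \<le> Sup k" "Sup k \<le> b" by auto
qed

text \<open>A division is an unordered set of intervals, so telescoping is derived from the
  additivity of the interval function \<open>g (Sup K) - g (Inf K)\<close> over divisions; the value
  0 at the empty set makes it operative.\<close>

lemma sum_division_increments:
  fixes g :: "real \<Rightarrow> real"
  assumes "d division_of {a..b}" "a \<le> b"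
  shows "(\<Sum>k\<in>d. g (Sup k) - g (Inf k)) = g b - g a"
proof -
  let ?f = "\<lambda>K::real set. if K = {} then 0 else g (Sup K) - g (Inf K)"
  interpret operative_real plus 0 ?f
    rewrites "comm_monoid_set.F (+) 0 = sum"
    by standard[1] (auto simp add: sum_def)
  have "sum ?f d = ?f {a..b}" using division[of d a b] assms by simp
  moreover have "sum ?f d = (\<Sum>k\<in>d. g (Sup k) - g (Inf k))"
    using division_ofD(3)[OF assms(1)] by (intro sum.cong) auto
  ultimately show ?thesis using assms by simp
qed

lemma variation_cong:
  assumes "\<And>s. 0 \<le> s \<Longrightarrow> s \<le> t \<Longrightarrow> a s = b s"
  shows "variation a t = variation b t"
  unfolding variation_def
proof (intro SUP_cong refl arg_cong[where f=ennreal] sum.cong)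
  fix d k assume d: "d \<in> {d. d division_of {0..t}}" and k: "k \<in> d"
  from d have d: "d division_of {0..t}" by simp
  have "a (Sup k) = b (Sup k)" "a (Inf k) = b (Inf k)"
    using division_of_Icc_elem[OF d k] by (auto intro!: assms)
  then show "\<bar>a (Sup k) - a (Inf k)\<bar> = \<bar>b (Sup k) - b (Inf k)\<bar>" by simp
qed

text \<open>Upper half of the characterisation by domination: telescoping replaces a division by two
  values of \<open>g\<close>. The other half, that the variation itself dominates the increments, is
  \<open>enn2real_variation_increment\<close>.\<close>

lemma variation_le:
  assumes "0 \<le> t" and "\<And>l u. 0 \<le> l \<Longrightarrow> l \<le> u \<Longrightarrow> u \<le> t \<Longrightarrow> \<bar>a u - a l\<bar> \<le> g u - g l"
  shows "variation a t \<le> ennreal (g t - g 0)"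
  unfolding variation_def
proof (intro SUP_least ennreal_leI)
  fix d assume "d \<in> {d. d division_of {0..t}}"
  then have d: "d division_of {0..t}" by simp
  have "(\<Sum>k\<in>d. \<bar>a (Sup k) - a (Inf k)\<bar>) \<le> (\<Sum>k\<in>d. g (Sup k) - g (Inf k))"
    using division_of_Icc_elem[OF d] by (intro sum_mono assms) auto
  then show "(\<Sum>k\<in>d. \<bar>a (Sup k) - a (Inf k)\<bar>) \<le> g t - g 0"
    using sum_division_increments[OF d] assms(1) by simp
qed

lemma variation_0 [simp]: "variation a 0 = 0"
proof -
  have "\<bar>a u - a l\<bar> \<le> (\<lambda>_. 0) u - (\<lambda>_. 0) l" if "0 \<le> l" "l \<le> u" "u \<le> 0" for l u :: real
  proof -
    from that have "u = l" by linarith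
    then show ?thesis by simp
  qed
  from variation_le[OF order_refl this] show ?thesis by simp
qed

lemma division_of_Icc_exists: "0 \<le> (t::real) \<Longrightarrow> {{0..t}} division_of {0..t}"
  using division_of_self[of 0 t] by auto

text \<open>Every division of \<open>{0..s}\<close> extends to one of \<open>{0..t}\<close> by the
  interval \<open>{s..t}\<close>, which is a new member as soon as \<open>s < t\<close>.\<close>

lemma variation_add_increment:
  assumes "0 \<le> s" "s \<le> t"
  shows "variation a s + ennreal \<bar>a t - a s\<bar> \<le> variation a t"
proof (cases "s = t")
  case False
  with assms have st: "s < t" by simp
  let ?S = "\<lambda>d. \<Sum>k\<in>d. \<bar>a (Sup k) - a (Inf k)\<bar>"
  have "variation a s + ennreal \<bar>a t - a s\<bar> =
    (SUP d\<in>{d. d division_of {0..s}}. ennreal (?S d) + ennreal \<bar>a t - a s\<bar>)"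
    unfolding variation_def
    using division_of_Icc_exists[OF assms(1)] by (subst ennreal_SUP_add_left) auto
  also have "\<dots> \<le> variation a t"
  proof (rule SUP_least)
    fix d assume "d \<in> {d. d division_of {0..s}}"
    then have d: "d division_of {0..s}" by simp
    have e: "{{s..t}} division_of {s..t}" using division_of_self[of s t] st by auto
    have "d \<union> {{s..t}} division_of ({0..s} \<union> {s..t})"
      by (rule division_disjoint_union[OF d e]) auto
    moreover have "{0..s} \<union> {s..t} = {0..t}" using assms by auto
    ultimately have u: "insert {s..t} d division_of {0..t}" by simp
    have "{s..t} \<notin> d" using division_ofD(2)[OF d, of "{s..t}"] st by auto
    then have "?S (insert {s..t} d) = ?S d + \<bar>a t - a s\<bar>"
      using division_of_finite[OF d] st by simp
    then have "ennreal (?S d) + ennreal \<bar>a t - a s\<bar> = ennreal (?S (insert {s..t} d))"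
      by (subst ennreal_plus[symmetric]) (auto intro: sum_nonneg)
    also have "\<dots> \<le> variation a t"
      unfolding variation_def using u by (intro SUP_upper) auto
    finally show "ennreal (?S d) + ennreal \<bar>a t - a s\<bar> \<le> variation a t" .
  qed
  finally show ?thesis .
qed simp

lemma variation_mono: "0 \<le> s \<Longrightarrow> s \<le> t \<Longrightarrow> variation a s \<le> variation a t"
  using variation_add_increment[of s t a] by (rule order_trans[rotated]) auto

lemma enn2real_variation_increment:
  assumes "0 \<le> s" "s \<le> t" "variation a t < \<infinity>"
  shows "\<bar>a t - a s\<bar> \<le> enn2real (variation a t) - enn2real (variation a s)"
proof -
  have fs: "variation a s < \<infinity>" using variation_mono[OF assms(1,2), of a] assms(3) by order
  have "ennreal (enn2real (variation a s) + \<bar>a t - a s\<bar>) \<le> ennreal (enn2real (variation a t))"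
    using variation_add_increment[OF assms(1,2), of a] assms(3) fs
    by (simp add: ennreal_plus less_top)
  then show ?thesis by (subst (asm) ennreal_le_iff) auto
qed

lemma enn2real_variation_le:
  assumes "0 \<le> t" and "\<And>l u. 0 \<le> l \<Longrightarrow> l \<le> u \<Longrightarrow> u \<le> t \<Longrightarrow> \<bar>a u - a l\<bar> \<le> g u - g l"
  shows "variation a t < \<infinity>" "enn2real (variation a t) \<le> g t - g 0"
proof -
  have *: "variation a t \<le> ennreal (g t - g 0)" by (rule variation_le) (use assms in auto)
  then show "variation a t < \<infinity>" by (rule le_less_trans) auto
  have "0 \<le> g t - g 0" using assms(2)[of 0 t] assms(1) by simp
  then show "enn2real (variation a t) \<le> g t - g 0" using enn2real_mono[OF *] by simp
qed

text \<open>If the variation jumped by more than \<open>\<delta>\<close> to the right of \<open>s\<close>, lowering it by \<open>\<delta>\<close> after \<open>s\<close>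
  would still dominate the increments of \<open>a\<close>.\<close>

lemma variation_right_continuous:
  assumes s: "0 \<le> s" "s < t" and fin: "variation a t < \<infinity>"
    and cont: "continuous (at_right s) a"
  shows "continuous (at_right s) (\<lambda>x. enn2real (variation a x))"
proof -
  define v where "v = (\<lambda>x. enn2real (variation a x))"
  have fin': "variation a x < \<infinity>" if "0 \<le> x" "x \<le> t" for x
    using variation_mono[OF that, of a] fin by order
  have v_inc: "\<bar>a u - a l\<bar> \<le> v u - v l" if "0 \<le> l" "l \<le> u" "u \<le> t" for l u
    unfolding v_def using that by (intro enn2real_variation_increment fin') auto
  have v_mono: "v l \<le> v u" if "0 \<le> l" "l \<le> u" "u \<le> t" for l u
    using v_inc[OF that] by simp
  have small: "\<exists>r. s < r \<and> r \<le> t \<and> v r \<le> v s + \<delta>" if "\<delta> > 0" for \<delta>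
  proof (rule ccontr)
    assume "\<not> ?thesis"
    then have big: "v r > v s + \<delta>" if "s < r" "r \<le> t" for r using that by force
    define g where "g x = (if x \<le> s then v x else v x - \<delta>)" for x
    have "\<bar>a u - a l\<bar> \<le> g u - g l" if lu: "0 \<le> l" "l \<le> u" "u \<le> t" for l u
    proof (cases "l \<le> s \<and> s < u")
      case True
      have "(a \<longlongrightarrow> a s) (at_right s)" using cont by (simp add: continuous_within)
      then have lim: "((\<lambda>r. v u - v s - \<delta> + \<bar>a r - a s\<bar>) \<longlongrightarrow> v u - v s - \<delta> + \<bar>a s - a s\<bar>) (at_right s)"
        by (intro tendsto_intros)
      \<comment> \<open>For an increment across \<open>s\<close>, compare on \<open>{r..u}\<close>
        with \<open>r\<close> just after \<open>s\<close>: there \<open>v\<close> has already gained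
        more than \<open>\<delta>\<close>, while \<open>a r\<close> tends to
        \<open>a s\<close>.\<close>
      have ev: "eventually (\<lambda>r. \<bar>a u - a s\<bar> \<le> v u - v s - \<delta> + \<bar>a r - a s\<bar>) (at_right s)"
        unfolding eventually_at_right_field
      proof (intro exI[of _ u] conjI allI impI)
        fix r assume r: "s < r" "r < u"
        have "\<bar>a u - a r\<bar> \<le> v u - v r" using r lu s True by (intro v_inc) auto
        moreover have "v r > v s + \<delta>" using r lu by (intro big) auto
        ultimately show "\<bar>a u - a s\<bar> \<le> v u - v s - \<delta> + \<bar>a r - a s\<bar>" by linarith
      qed (use True in auto)
      have "\<bar>a u - a s\<bar> \<le> v u - v s - \<delta> + \<bar>a s - a s\<bar>"
        by (rule tendsto_lowerbound[OF lim ev]) simp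
      moreover have "\<bar>a s - a l\<bar> \<le> v s - v l" using lu s True by (intro v_inc) auto
      ultimately show ?thesis using True unfolding g_def by auto
    next
      case False
      then show ?thesis using v_inc[OF lu] lu unfolding g_def by auto
    qed
    \<comment> \<open>Minimality of the variation gives \<open>v t \<le> g t\<close>, although
      \<open>g t\<close> is \<open>v t - \<delta>\<close>.\<close>
    from enn2real_variation_le(2)[of t a g, OF _ this] s have "v t \<le> g t - g 0"
      unfolding v_def by auto
    moreover have "g 0 = 0" using s unfolding g_def v_def by simp
    ultimately show False using s that unfolding g_def by auto
  qed
  have "(v \<longlongrightarrow> v s) (at_right s)"
  proof (rule tendstoI)
    fix e :: real assume "0 < e"
    then obtain r where r: "s < r" "r \<le> t" "v r \<le> v s + e / 2" using small[of "e/2"] by auto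
    show "eventually (\<lambda>x. dist (v x) (v s) < e) (at_right s)"
      unfolding eventually_at_right_field
    proof (intro exI[of _ r] conjI allI impI)
      fix x assume x: "s < x" "x < r"
      have "v s \<le> v x" "v x \<le> v r" using x r s by (auto intro!: v_mono)
      then show "dist (v x) (v s) < e" using r \<open>0 < e\<close> by (simp add: dist_real_def)
    qed (use r in auto)
  qed
  then show ?thesis unfolding continuous_within v_def .
qed

text \<open>The variation stopped at \<open>u\<close> dominates the increments of the stopped path;
  conversely, the two paths coincide up to \<open>min t u\<close>.\<close>

lemma variation_min:
  assumes "0 \<le> t" "0 \<le> u"
  shows "variation (\<lambda>s. a (min s u)) t = variation a (min t u)"
proof (rule antisym)
  show "variation (\<lambda>s. a (min s u)) t \<le> variation a (min t u)"
  proof (cases "variation a (min t u) < \<infinity>")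
    case True
    have "variation (\<lambda>s. a (min s u)) t \<le>
      ennreal (enn2real (variation a (min t u)) - enn2real (variation a (min 0 u)))"
    proof (rule variation_le)
      fix l r assume *: "0 \<le> l" "l \<le> r" "r \<le> t"
      have "variation a (min r u) \<le> variation a (min t u)"
        using * assms by (intro variation_mono) auto
      with True have "variation a (min r u) < \<infinity>" by order
      then show "\<bar>a (min r u) - a (min l u)\<bar>
          \<le> enn2real (variation a (min r u)) - enn2real (variation a (min l u))"
        using * assms by (intro enn2real_variation_increment) auto
    qed fact
    then show ?thesis using assms True by (simp add: less_top)
  next
    case False
    then show ?thesis by (simp add: not_less top_unique)
  qed
  have "variation a (min t u) = variation (\<lambda>s. a (min s u)) (min t u)"
    by (rule variation_cong) auto
  also have "\<dots> \<le> variation (\<lambda>s. a (min s u)) t"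
    using assms by (intro variation_mono) auto
  finally show "variation a (min t u) \<le> variation (\<lambda>s. a (min s u)) t" .
qed

text \<open>Points may repeat, as they do in a grid cut off at \<open>t\<close>, so they need not
  come from a division; the sum is built up one increment at a time instead.\<close>

lemma sum_le_variation:
  assumes "mono x" "x 0 = 0" "x n \<le> t"
  shows "ennreal (\<Sum>i<n. \<bar>a (x (Suc i)) - a (x i)\<bar>) \<le> variation a t"
proof -
  have pos: "0 \<le> x i" for i using monoD[OF assms(1), of 0 i] assms(2) by simp
  have "ennreal (\<Sum>i<n. \<bar>a (x (Suc i)) - a (x i)\<bar>) \<le> variation a (x n)"
  proof (induction n)
    case (Suc n)
    have "ennreal (\<Sum>i<Suc n. \<bar>a (x (Suc i)) - a (x i)\<bar>)
        = ennreal (\<Sum>i<n. \<bar>a (x (Suc i)) - a (x i)\<bar>) + ennreal \<bar>a (x (Suc n)) - a (x n)\<bar>"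
      by (simp add: ennreal_plus sum_nonneg)
    also have "\<dots> \<le> variation a (x n) + ennreal \<bar>a (x (Suc n)) - a (x n)\<bar>"
      using Suc by (intro add_right_mono)
    also have "\<dots> \<le> variation a (x (Suc n))"
      using pos monoD[OF assms(1), of n "Suc n"] by (intro variation_add_increment) auto
    finally show ?case .
  qed simp
  also have "\<dots> \<le> variation a t" using pos assms(3) by (intro variation_mono)
  finally show ?thesis .
qed

text \<open>Division points are rounded up to the grid of mesh \<open>1 / Suc m\<close>, which is harmless in the limit
  because of right continuity.\<close>

lemma variation_eq_SUP_grid:
  fixes a :: "real \<Rightarrow> real"
  assumes t: "0 \<le> t" and cont: "\<And>s. 0 \<le> s \<Longrightarrow> s < t \<Longrightarrow> continuous (at_right s) a"
  shows "variation a t = (SUP m. ennreal (\<Sum>i<nat \<lceil>t * real (Suc m)\<rceil>.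
    \<bar>a (min t (real (Suc i) / real (Suc m))) - a (min t (real i / real (Suc m)))\<bar>))"
proof (rule antisym)
  let ?D = "\<lambda>m s. \<Sum>i<nat \<lceil>s * real (Suc m)\<rceil>.
    \<bar>a (min t (real (Suc i) / real (Suc m))) - a (min t (real i / real (Suc m)))\<bar>"
  let ?x = "\<lambda>m i. min t (real i / real (Suc m))"
  show "(SUP m. ennreal (?D m t)) \<le> variation a t"
    using t by (intro SUP_least sum_le_variation[of "?x _"])
      (auto intro!: monoI min.mono divide_right_mono)
  let ?g = "\<lambda>m s. min t (real (nat \<lceil>s * real (Suc m)\<rceil>) / real (Suc m))"
  \<comment> \<open>\<open>?D m\<close> acts as the dominating function for the path read at the
    rounded points \<open>?g m\<close>.\<close>
  have g_le: "\<bar>a (?g m u) - a (?g m l)\<bar> \<le> ?D m u - ?D m l" if "l \<le> u" for l u m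
  proof -
    let ?n = "\<lambda>s. nat \<lceil>s * real (Suc m)\<rceil>"
    have n: "?n l \<le> ?n u"
      using that by (intro nat_mono ceiling_mono mult_right_mono) auto
    have tele: "a (?x m p) - a (?x m q) = (\<Sum>i\<in>{q..<p}. a (?x m (Suc i)) - a (?x m i))" if "q \<le> p" for p q
      using sum_Suc_diff'[OF that, of "\<lambda>i. a (?x m i)"] by simp
    have "\<bar>a (?x m (?n u)) - a (?x m (?n l))\<bar> \<le> (\<Sum>i\<in>{?n l..<?n u}. \<bar>a (?x m (Suc i)) - a (?x m i)\<bar>)"
      unfolding tele[OF n] by (rule sum_abs)
    also have "\<dots> = ?D m u - ?D m l"
      using sum_diff_nat_ivl[of 0 "?n l" "?n u" "\<lambda>i. \<bar>a (?x m (Suc i)) - a (?x m i)\<bar>"] n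
      by (simp add: atLeast0LessThan)
    finally show ?thesis .
  qed
  have lim: "(\<lambda>m. a (?g m s)) \<longlonglongrightarrow> a s" if s: "0 \<le> s" "s \<le> t" for s
  proof (cases "s = t")
    case True
    have "t \<le> real (nat \<lceil>s * real (Suc m)\<rceil>) / real (Suc m)" for m
      using True s by (simp add: field_simps del: of_nat_Suc)
    then have "?g m s = s" for m using True by (simp add: min_absorb1)
    then show ?thesis by simp
  next
    case False
    have ge: "s \<le> ?g m s" for m
      using s by (simp add: field_simps del: of_nat_Suc)
    have le: "?g m s \<le> s + 1 / real (Suc m)" for m
    proof -
      have "real (nat \<lceil>s * real (Suc m)\<rceil>) \<le> s * real (Suc m) + 1"
        using s by (simp del: of_nat_Suc)
      then have "real (nat \<lceil>s * real (Suc m)\<rceil>) / real (Suc m) \<le> s + 1 / real (Suc m)"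
        by (simp add: field_simps del: of_nat_Suc)
      then show ?thesis by simp
    qed
    have l: "(\<lambda>m. ?g m s) \<longlonglongrightarrow> s"
    proof (rule tendsto_sandwich[of "\<lambda>_. s" _ _ "\<lambda>m. s + 1 / real (Suc m)"])
      show "(\<lambda>m. s + 1 / real (Suc m)) \<longlonglongrightarrow> s"
        using tendsto_add[OF tendsto_const LIMSEQ_Suc[OF lim_inverse_n'], of s] by simp
    qed (use ge le in auto)
    have "continuous (at s within {s..}) a"
      using cont[of s] s False by (auto simp: continuous_within at_within_Ici_at_right)
    then show ?thesis
      using l ge by (auto simp: continuous_within_sequentially comp_def)
  qed
  show "variation a t \<le> (SUP m. ennreal (?D m t))"
    unfolding variation_def
  proof (rule SUP_least)
    fix d assume "d \<in> {d. d division_of {0..t}}"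
    then have d: "d division_of {0..t}" by simp
    have l: "(\<lambda>m. ennreal (\<Sum>k\<in>d. \<bar>a (?g m (Sup k)) - a (?g m (Inf k))\<bar>))
      \<longlonglongrightarrow> ennreal (\<Sum>k\<in>d. \<bar>a (Sup k) - a (Inf k)\<bar>)"
      using division_of_Icc_elem[OF d]
      by (intro tendsto_ennrealI tendsto_sum tendsto_rabs tendsto_diff lim) force+
    show "ennreal (\<Sum>k\<in>d. \<bar>a (Sup k) - a (Inf k)\<bar>) \<le> (SUP m. ennreal (?D m t))"
    proof (rule LIMSEQ_le_const2[OF l], intro exI allI impI)
      fix m :: nat
      have "(\<Sum>k\<in>d. \<bar>a (?g m (Sup k)) - a (?g m (Inf k))\<bar>) \<le> (\<Sum>k\<in>d. ?D m (Sup k) - ?D m (Inf k))"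
        using division_of_Icc_elem[OF d] by (intro sum_mono g_le) auto
      also have "\<dots> = ?D m t"
        using sum_division_increments[OF d t, of "?D m"] by simp
      finally have "ennreal (\<Sum>k\<in>d. \<bar>a (?g m (Sup k)) - a (?g m (Inf k))\<bar>) \<le> ennreal (?D m t)"
        by (rule ennreal_leI)
      also have "\<dots> \<le> (SUP m. ennreal (?D m t))" by (rule SUP_upper) simp
      finally show "ennreal (\<Sum>k\<in>d. \<bar>a (?g m (Sup k)) - a (?g m (Inf k))\<bar>) \<le> (SUP m. ennreal (?D m t))" .
    qed
  qed
qed

section \<open>Paths of finite variation: restriction, agreement and stopping\<close>

lemma fv_path_variation_finite: "fv_path a t \<Longrightarrow> 0 \<le> s \<Longrightarrow> s \<le> t \<Longrightarrow> variation a s < \<infinity>"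
  using variation_mono[of s t a] unfolding fv_path_def by (meson order.strict_trans1)

lemma fv_path_mono: "fv_path a t \<Longrightarrow> 0 \<le> s \<Longrightarrow> s \<le> t \<Longrightarrow> fv_path a s"
  using fv_path_variation_finite[of a t s] unfolding fv_path_def by auto

lemma tendsto_at_right_eq_on:
  fixes a b :: "real \<Rightarrow> real"
  assumes "s < t" "\<And>x. s < x \<Longrightarrow> x < t \<Longrightarrow> a x = b x"
  shows "(a \<longlongrightarrow> l) (at_right s) \<longleftrightarrow> (b \<longlongrightarrow> l) (at_right s)"
  by (rule tendsto_cong) (use assms in \<open>auto simp: eventually_at_right_field\<close>)

lemma tendsto_at_left_eq_on:
  fixes a b :: "real \<Rightarrow> real"
  assumes "t < s" "\<And>x. t < x \<Longrightarrow> x < s \<Longrightarrow> a x = b x"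
  shows "(a \<longlongrightarrow> l) (at_left s) \<longleftrightarrow> (b \<longlongrightarrow> l) (at_left s)"
  by (rule tendsto_cong) (use assms in \<open>auto simp: eventually_at_left_field\<close>)

lemma fv_path_cong:
  assumes "\<And>s. 0 \<le> s \<Longrightarrow> s \<le> t \<Longrightarrow> a s = b s"
  shows "fv_path a t \<longleftrightarrow> fv_path b t"
proof -
  have "continuous (at_right s) a \<longleftrightarrow> continuous (at_right s) b" if "s \<in> {0..<t}" for s
    using that tendsto_at_right_eq_on[of s t a b "a s"] assms by (auto simp: continuous_within)
  moreover have "(a \<longlongrightarrow> l) (at_left s) \<longleftrightarrow> (b \<longlongrightarrow> l) (at_left s)" if "s \<in> {0<..t}" for s l
    using that assms by (intro tendsto_at_left_eq_on[of 0]) auto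
  moreover have "variation a t = variation b t" by (rule variation_cong) (rule assms)
  ultimately show ?thesis unfolding fv_path_def by simp
qed

lemma fv_path_min:
  assumes "fv_path a u" "0 \<le> u" "0 \<le> t"
  shows "fv_path (\<lambda>s. a (min s u)) t"
  unfolding fv_path_def
proof (intro conjI ballI)
  fix s assume s: "s \<in> {0..<t}"
  show "continuous (at_right s) (\<lambda>s. a (min s u))"
  proof (cases "s < u")
    case True
    then have "(a \<longlongrightarrow> a s) (at_right s)" using assms s by (auto simp: fv_path_def continuous_within)
    then show ?thesis
      using True tendsto_at_right_eq_on[of s u a "\<lambda>s. a (min s u)" "a s"] by (auto simp: continuous_within)
  next
    case False
    then show ?thesis
      using tendsto_at_right_eq_on[of s "s + 1" "\<lambda>_. a u" "\<lambda>s. a (min s u)" "a u"]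
      by (auto simp: continuous_within min_absorb2)
  qed
next
  fix s assume s: "s \<in> {0<..t}"
  show "\<exists>l. ((\<lambda>s. a (min s u)) \<longlongrightarrow> l) (at_left s)"
  proof (cases "s \<le> u")
    case True
    then have "s \<in> {0<..u}" using s by simp
    then obtain l where "(a \<longlongrightarrow> l) (at_left s)" using assms(1) unfolding fv_path_def by blast
    then show ?thesis
      using True s tendsto_at_left_eq_on[of 0 s a "\<lambda>s. a (min s u)" l] by (auto simp: min_def)
  next
    case False
    then show ?thesis
      using tendsto_at_left_eq_on[of u s "\<lambda>_. a u" "\<lambda>s. a (min s u)" "a u"] by (auto simp: min_absorb2)
  qed
next
  show "variation (\<lambda>s. a (min s u)) t < \<infinity>"
    unfolding variation_min[OF assms(3,2)] using assms by (intro fv_path_variation_finite[of a u]) auto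
qed

section \<open>Stieltjes measures and integrals along a path\<close>

text \<open>The distribution functions of finite measures carried by \<open>{0..t}\<close>. A
  positive value at 0 is the mass of the point 0.\<close>

definition dist_fun :: "(real \<Rightarrow> real) \<Rightarrow> real \<Rightarrow> bool" where
  "dist_fun F t \<longleftrightarrow> 0 \<le> t \<and> mono F \<and> (\<forall>s. continuous (at_right s) F) \<and>
     (\<forall>s<0. F s = 0) \<and> (\<forall>s>t. F s = F t)"

context
  fixes F :: "real \<Rightarrow> real" and t :: real
  assumes F: "dist_fun F t"
begin

lemma dist_funD:
  "x \<le> y \<Longrightarrow> F x \<le> F y" "continuous (at_right s) F" "s < 0 \<Longrightarrow> F s = 0" "t < s \<Longrightarrow> F s = F t" "0 \<le> t"
  using F monoD[of F x y] unfolding dist_fun_def by blast+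

lemma dist_fun_nonneg: "0 \<le> F s"
proof -
  have "F (min s (-1)) \<le> F s" using F by (intro monoD[of F]) (auto simp: dist_fun_def)
  moreover have "F (min s (-1)) = 0" using F by (auto simp: dist_fun_def)
  ultimately show ?thesis by simp
qed

lemma dist_fun_limits: "(F \<longlongrightarrow> 0) at_bot" "(F \<longlongrightarrow> F t) at_top"
proof -
  have "eventually (\<lambda>s. F s = 0) at_bot"
    using F unfolding eventually_at_bot_linorder dist_fun_def by (intro exI[of _ "-1"]) auto
  then show "(F \<longlongrightarrow> 0) at_bot" by (rule tendsto_eventually)
  have "eventually (\<lambda>s. F s = F t) at_top"
    using F unfolding eventually_at_top_dense dist_fun_def by auto
  then show "(F \<longlongrightarrow> F t) at_top" by (rule tendsto_eventually)
qed

lemma finite_borel_measure_dist_fun: "finite_borel_measure (interval_measure F)"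
  by (rule finite_borel_measure_interval_measure[OF dist_funD(1,2) dist_fun_limits dist_fun_nonneg])

lemma emeasure_dist_fun_Iic: "emeasure (interval_measure F) {..x} = ennreal (F x)"
  by (rule emeasure_interval_measure_Iic[OF dist_funD(1,2) dist_fun_limits(1)])

lemma emeasure_dist_fun_UNIV: "emeasure (interval_measure F) UNIV = ennreal (F t)"
  by (rule interval_measure_UNIV[OF dist_funD(1,2) dist_fun_limits dist_fun_nonneg])

lemma dist_fun_AE_nonneg: "AE s in interval_measure F. 0 \<le> s"
proof -
  have "emeasure (interval_measure F) (\<Union>n. {..- inverse (real (Suc n))}) = 0"
    by (intro emeasure_UN_eq_0) (auto simp: emeasure_dist_fun_Iic dist_funD(3) simp del: of_nat_Suc)
  moreover have "(\<Union>n. {..- inverse (real (Suc n))}) = {..<0}"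
  proof (intro equalityI subsetI)
    fix x :: real assume "x \<in> {..<0}"
    then obtain n where "inverse (real (Suc n)) < - x" using reals_Archimedean[of "- x"] by auto
    then have "x \<le> - inverse (real (Suc n))" by simp
    then show "x \<in> (\<Union>n. {..- inverse (real (Suc n))})" by blast
  next
    fix x :: real assume "x \<in> (\<Union>n. {..- inverse (real (Suc n))})"
    then obtain n where "x \<le> - inverse (real (Suc n))" by blast
    moreover have "0 < inverse (real (Suc n))" by simp
    ultimately show "x \<in> {..<0}" unfolding lessThan_iff by linarith
  qed
  ultimately have "{..<0} \<in> null_sets (interval_measure F)" by (simp add: null_sets_def)
  from AE_not_in[OF this] show ?thesis by (rule AE_mp) (auto intro!: AE_I2)
qed

lemma dist_fun_AE_le: "AE s in interval_measure F. s \<le> t"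
proof -
  interpret finite_borel_measure "interval_measure F" by (rule finite_borel_measure_dist_fun)
  have "emeasure (interval_measure F) (UNIV - {..t}) = 0"
    by (subst emeasure_Diff) (auto simp: emeasure_dist_fun_UNIV emeasure_dist_fun_Iic)
  then have "UNIV - {..t} \<in> null_sets (interval_measure F)" by (simp add: null_sets_def)
  from AE_not_in[OF this] show ?thesis by (rule AE_mp) (auto intro!: AE_I2)
qed

lemma measure_dist_fun_singleton_0: "measure (interval_measure F) {0} = F 0"
proof -
  interpret finite_borel_measure "interval_measure F" by (rule finite_borel_measure_dist_fun)
  have "measure (interval_measure F) {0} = measure (interval_measure F) {..0}"
    by (rule measure_eq_AE) (use dist_fun_AE_nonneg in auto)
  then show ?thesis using dist_fun_nonneg by (simp add: measure_def emeasure_dist_fun_Iic)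
qed

lemma dist_fun_min:
  assumes "0 \<le> u"
  shows "dist_fun (\<lambda>s. F (min s u)) u"
proof -
  have "continuous (at_right s) (\<lambda>s. F (min s u))" for s
  proof (cases "s < u")
    case True
    have "(F \<longlongrightarrow> F s) (at_right s)" using F by (auto simp: dist_fun_def continuous_within)
    then show ?thesis
      using True tendsto_at_right_eq_on[of s u F "\<lambda>s. F (min s u)" "F s"] by (auto simp: continuous_within)
  next
    case False
    then show ?thesis
      using tendsto_at_right_eq_on[of s "s + 1" "\<lambda>_. F u" "\<lambda>s. F (min s u)" "F u"]
      by (auto simp: continuous_within min_absorb2)
  qed
  then show ?thesis
    using assms dist_funD(1,3,4,5) unfolding dist_fun_def by (auto intro!: monoI)
qed

end

text \<open>Makes the measures attached to upper limits before \<open>t\<close> restrictions of the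
  one attached to \<open>t\<close>. Both sides have the same distribution function.\<close>

lemma interval_measure_min:
  assumes F: "dist_fun F t" and "0 \<le> u"
  shows "interval_measure (\<lambda>s. F (min s u)) = density (interval_measure F) (indicator {..u})"
    (is "?L = ?R")
proof (rule cdf_unique')
  have R: "emeasure ?R X = emeasure (interval_measure F) ({..u} \<inter> X)" if "X \<in> sets borel" for X
  proof -
    have "(\<lambda>x. indicator {..u} x * indicator X x :: ennreal) = indicator ({..u} \<inter> X)"
      by (auto simp: indicator_def)
    then show ?thesis using that by (simp add: emeasure_density)
  qed
  have "emeasure ?R (space ?R) \<noteq> \<infinity>"
    using R[of UNIV] by (simp add: emeasure_dist_fun_Iic[OF F])
  then show "finite_borel_measure ?R"
    by (intro finite_borel_measure.intro finite_borel_measure_axioms.intro finite_measureI) auto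
  have L: "dist_fun (\<lambda>s. F (min s u)) u" by (rule dist_fun_min) fact+
  show "finite_borel_measure ?L" by (rule finite_borel_measure_dist_fun[OF L])
  show "cdf ?L = cdf ?R"
  proof
    fix x
    have "emeasure ?L {..x} = ennreal (F (min x u))"
      by (rule emeasure_dist_fun_Iic[OF L])
    moreover have "emeasure ?R {..x} = ennreal (F (min x u))"
      using R[of "{..x}"] emeasure_dist_fun_Iic[OF F, of "min u x"]
      by (simp add: min.commute)
    ultimately show "cdf ?L x = cdf ?R x"
      unfolding cdf_def measure_def by simp
  qed
qed

text \<open>The set function on the right is made into a measure \<open>N\<close>, and distribution
  functions are compared. It serves to split the variation measure into the positive and the
  negative one.\<close>

lemma emeasure_interval_measure_add:
  assumes F: "dist_fun F t" and G: "dist_fun G t" and X: "X \<in> sets borel"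
  shows "emeasure (interval_measure (\<lambda>s. F s + G s)) X =
    emeasure (interval_measure F) X + emeasure (interval_measure G) X"
proof -
  define N where "N = measure_of UNIV (sets borel)
    (\<lambda>X. emeasure (interval_measure F) X + emeasure (interval_measure G) X)"
  have sN: "sets N = sets borel" unfolding N_def
    by (metis sets.sigma_sets_eq sets_measure_of sets.space_closed space_borel)
  have N: "emeasure N X = emeasure (interval_measure F) X + emeasure (interval_measure G) X"
    if X: "X \<in> sets borel" for X
  proof (rule emeasure_measure_of[OF N_def])
    show "X \<in> sets N" using X sN by simp
    show "positive (sets N) (\<lambda>X. emeasure (interval_measure F) X + emeasure (interval_measure G) X)"
      by (simp add: positive_def)
    show "countably_additive (sets N) (\<lambda>X. emeasure (interval_measure F) X + emeasure (interval_measure G) X)"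
    proof (rule countably_additiveI)
      fix A :: "nat \<Rightarrow> real set" assume A: "range A \<subseteq> sets N" "disjoint_family A"
      then have "range A \<subseteq> sets (interval_measure F)" "range A \<subseteq> sets (interval_measure G)"
        using sN by auto
      then show "(\<Sum>i. emeasure (interval_measure F) (A i) + emeasure (interval_measure G) (A i)) =
        emeasure (interval_measure F) (\<Union> (range A)) + emeasure (interval_measure G) (\<Union> (range A))"
        using A by (simp add: suminf_add[symmetric] suminf_emeasure)
    qed
  qed auto
  have "mono (\<lambda>s. F s + G s)"
    by (rule monoI) (intro add_mono dist_funD(1)[OF F] dist_funD(1)[OF G])
  then have FG: "dist_fun (\<lambda>s. F s + G s) t"
    using F G unfolding dist_fun_def by (auto intro!: continuous_intros)
  have "interval_measure (\<lambda>s. F s + G s) = N"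
  proof (rule cdf_unique')
    show "finite_borel_measure (interval_measure (\<lambda>s. F s + G s))"
      by (rule finite_borel_measure_dist_fun[OF FG])
    have "emeasure N (space N) \<noteq> \<infinity>"
      using N[of UNIV] sets_eq_imp_space_eq[OF sN]
      by (simp add: emeasure_dist_fun_UNIV[OF F] emeasure_dist_fun_UNIV[OF G])
    then show "finite_borel_measure N"
      using sN by (intro finite_borel_measure.intro finite_borel_measure_axioms.intro finite_measureI)
    show "cdf (interval_measure (\<lambda>s. F s + G s)) = cdf N"
      by (rule ext) (simp add: cdf_def measure_def N emeasure_dist_fun_Iic[OF FG] emeasure_dist_fun_Iic[OF F]
          emeasure_dist_fun_Iic[OF G] ennreal_plus dist_fun_nonneg[OF F] dist_fun_nonneg[OF G])
  qed
  then show ?thesis using N[OF X] by simp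
qed

lemma dist_funI:
  assumes "0 \<le> t" "0 \<le> f 0" and m: "\<And>l u. 0 \<le> l \<Longrightarrow> l \<le> u \<Longrightarrow> u \<le> t \<Longrightarrow> f l \<le> f u"
    and c: "\<And>s. 0 \<le> s \<Longrightarrow> s < t \<Longrightarrow> continuous (at_right s) f"
  shows "dist_fun (\<lambda>s. if s < 0 then 0 else f (min s t)) t" (is "dist_fun ?G t")
proof -
  have "continuous (at_right s) ?G" for s
  proof -
    consider "s < 0" | "0 \<le> s" "s < t" | "t \<le> s" by linarith
    then show ?thesis
    proof cases
      case 1
      then show ?thesis
        using tendsto_at_right_eq_on[of s 0 "\<lambda>_. 0" ?G 0] by (auto simp: continuous_within)
    next
      case 2
      then show ?thesis
        using tendsto_at_right_eq_on[of s t f ?G "f s"] c[of s] by (auto simp: continuous_within)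
    next
      case 3
      then show ?thesis
        using tendsto_at_right_eq_on[of s "s + 1" "\<lambda>_. f t" ?G "f t"] assms(1)
        by (auto simp: continuous_within min_absorb2)
    qed
  qed
  moreover have "mono ?G"
  proof (rule monoI)
    fix x y :: real assume "x \<le> y"
    moreover have "0 \<le> f (min y t)" if "0 \<le> y"
      using m[of 0 "min y t"] that assms(1,2) by simp
    ultimately show "?G x \<le> ?G y" using assms(1) by (auto intro!: m)
  qed
  ultimately show ?thesis using assms(1) unfolding dist_fun_def by auto
qed

text \<open>Together with \<open>neg_dist\<close> this is the Jordan decomposition: the two
  functions differ by the extended path and add up to the extended variation.\<close>

definition pos_dist :: "(real \<Rightarrow> real) \<Rightarrow> real \<Rightarrow> real \<Rightarrow> real" where
  "pos_dist a t s = (var_ext a t s + path_ext a t s) / 2"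

definition neg_dist :: "(real \<Rightarrow> real) \<Rightarrow> real \<Rightarrow> real \<Rightarrow> real" where
  "neg_dist a t s = (var_ext a t s - path_ext a t s) / 2"

lemma pos_measure_eq: "pos_measure a t = interval_measure (pos_dist a t)"
  unfolding pos_measure_def pos_dist_def ..

lemma neg_measure_eq: "neg_measure a t = interval_measure (neg_dist a t)"
  unfolding neg_measure_def neg_dist_def ..

lemma sets_path_measure [simp, measurable_cong]:
  "sets (abs_measure a t) = sets borel" "sets (pos_measure a t) = sets borel" "sets (neg_measure a t) = sets borel"
  unfolding abs_measure_def pos_measure_def neg_measure_def by simp_all

lemma space_path_measure [simp]:
  "space (abs_measure a t) = UNIV" "space (pos_measure a t) = UNIV" "space (neg_measure a t) = UNIV"
  unfolding abs_measure_def pos_measure_def neg_measure_def by simp_all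

lemma dist_fun_path:
  assumes "fv_path a t" "0 \<le> t"
  shows "dist_fun (var_ext a t) t" "dist_fun (pos_dist a t) t" "dist_fun (neg_dist a t) t"
proof -
  define v where "v x = enn2real (variation a x)" for x
  have v0: "v 0 = 0" unfolding v_def by simp
  have fin: "variation a s < \<infinity>" if "0 \<le> s" "s \<le> t" for s
    using fv_path_variation_finite[OF assms(1) that] .
  have inc: "\<bar>a u - a l\<bar> \<le> v u - v l" if "0 \<le> l" "l \<le> u" "u \<le> t" for l u
    unfolding v_def using that by (intro enn2real_variation_increment fin) auto
  have ca: "continuous (at_right s) a" if "0 \<le> s" "s < t" for s
    using assms(1) that unfolding fv_path_def by auto
  have cv: "continuous (at_right s) v" if "0 \<le> s" "s < t" for s
    unfolding v_def using that ca by (intro variation_right_continuous[of s t] fin) auto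
  \<comment> \<open>One family covers the three functions: \<open>b = 0\<close> and
    \<open>c = 1\<close> for the variation, \<open>b = 1\<close> or \<open>b = -1\<close> and
    \<open>c = 1/2\<close> for the two parts. The term \<open>\<bar>a 0\<bar>\<close> keeps the mass
    at 0 nonnegative, and the increments of \<open>v\<close> absorb those of
    \<open>a\<close>.\<close>
  have dist: "dist_fun (\<lambda>s. if s < 0 then 0 else (\<lambda>x. c * (\<bar>a 0\<bar> + v x + b * a x)) (min s t)) t"
    if "b = 0 \<or> b = 1 \<or> b = -1" "0 < c" for b c
  proof (rule dist_funI)
    show "0 \<le> c * (\<bar>a 0\<bar> + v 0 + b * a 0)" using that v0 by auto
    fix l u :: real assume lu: "0 \<le> l" "l \<le> u" "u \<le> t"
    have "b * a l - b * a u \<le> v u - v l" using inc[OF lu] that(1) by auto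
    then show "c * (\<bar>a 0\<bar> + v l + b * a l) \<le> c * (\<bar>a 0\<bar> + v u + b * a u)"
      using that(2) by (intro mult_left_mono) auto
  qed (auto intro!: continuous_intros cv ca assms)
  have "dist_fun (\<lambda>s. if s < 0 then 0 else (\<lambda>x. 1 * (\<bar>a 0\<bar> + v x + 0 * a x)) (min s t)) t"
    by (rule dist) auto
  moreover have "(\<lambda>s. if s < 0 then 0 else (\<lambda>x. 1 * (\<bar>a 0\<bar> + v x + 0 * a x)) (min s t)) = var_ext a t"
    by (auto simp: fun_eq_iff var_ext_def v_def)
  ultimately show "dist_fun (var_ext a t) t" by simp
  have "dist_fun (\<lambda>s. if s < 0 then 0 else (\<lambda>x. 1 / 2 * (\<bar>a 0\<bar> + v x + 1 * a x)) (min s t)) t"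
    by (rule dist) auto
  moreover have "(\<lambda>s. if s < 0 then 0 else (\<lambda>x. 1 / 2 * (\<bar>a 0\<bar> + v x + 1 * a x)) (min s t)) = pos_dist a t"
    by (auto simp: fun_eq_iff pos_dist_def var_ext_def path_ext_def v_def)
  ultimately show "dist_fun (pos_dist a t) t" by simp
  have "dist_fun (\<lambda>s. if s < 0 then 0 else (\<lambda>x. 1 / 2 * (\<bar>a 0\<bar> + v x + - 1 * a x)) (min s t)) t"
    by (rule dist) auto
  moreover have "(\<lambda>s. if s < 0 then 0 else (\<lambda>x. 1 / 2 * (\<bar>a 0\<bar> + v x + - 1 * a x)) (min s t)) = neg_dist a t"
    by (auto simp: fun_eq_iff neg_dist_def var_ext_def path_ext_def v_def)
  ultimately show "dist_fun (neg_dist a t) t" by simp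
qed

lemma path_dist_min:
  assumes "0 \<le> u" "u \<le> t"
  shows "var_ext a u = (\<lambda>s. var_ext a t (min s u))" "pos_dist a u = (\<lambda>s. pos_dist a t (min s u))"
    "neg_dist a u = (\<lambda>s. neg_dist a t (min s u))"
  using assms by (auto simp: fun_eq_iff var_ext_def path_ext_def pos_dist_def neg_dist_def min_def)

lemma path_measure_density:
  assumes "fv_path a t" "0 \<le> u" "u \<le> t"
  shows "abs_measure a u = density (abs_measure a t) (indicator {..u})"
    "pos_measure a u = density (pos_measure a t) (indicator {..u})"
    "neg_measure a u = density (neg_measure a t) (indicator {..u})"
proof -
  have "0 \<le> t" using assms by simp
  note d = dist_fun_path[OF assms(1) this]
  show "abs_measure a u = density (abs_measure a t) (indicator {..u})"
    unfolding abs_measure_def path_dist_min[OF assms(2,3)] by (rule interval_measure_min[OF d(1) assms(2)])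
  show "pos_measure a u = density (pos_measure a t) (indicator {..u})"
    unfolding pos_measure_eq path_dist_min[OF assms(2,3)] by (rule interval_measure_min[OF d(2) assms(2)])
  show "neg_measure a u = density (neg_measure a t) (indicator {..u})"
    unfolding neg_measure_eq path_dist_min[OF assms(2,3)] by (rule interval_measure_min[OF d(3) assms(2)])
qed

lemma set_integral_density_Iic:
  fixes h :: "real \<Rightarrow> real"
  assumes [measurable_cong]: "sets M = sets borel" and m: "set_borel_measurable M {0..t} h" and "u \<le> t"
  shows "(LINT s:{0..u}|density M (indicator {..u}). h s) = (LINT s:{0..u}|M. h s)"
    "set_integrable (density M (indicator {..u})) {0..u} h \<longleftrightarrow> set_integrable M {0..u} h"
proof -
  have "set_borel_measurable M {0..u} h"
    by (rule set_borel_measurable_subset[OF m]) (use assms in auto)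
  then have [measurable]: "(\<lambda>s. indicator {0..u} s *\<^sub>R h s) \<in> borel_measurable M"
    unfolding set_borel_measurable_def .
  have i: "indicator {..u} = (\<lambda>x. ennreal (indicator {..u} x))" by (auto simp: fun_eq_iff indicator_def)
  have e: "indicator {..u} s *\<^sub>R indicator {0..u} s *\<^sub>R h s = indicator {0..u} s *\<^sub>R h s" for s
    by (auto simp: indicator_def)
  show "(LINT s:{0..u}|density M (indicator {..u}). h s) = (LINT s:{0..u}|M. h s)"
    unfolding set_lebesgue_integral_def i by (subst integral_density) (simp_all add: e del: real_scaleR_def scaleR_scaleR)
  show "set_integrable (density M (indicator {..u})) {0..u} h \<longleftrightarrow> set_integrable M {0..u} h"
    unfolding set_integrable_def i by (subst integrable_density) (simp_all add: e del: real_scaleR_def scaleR_scaleR)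
qed

lemma path_integrable_measurable:
  assumes "path_integrable h a t"
  shows "(\<lambda>s. indicator {0..t} s * h s) \<in> borel_measurable borel"
proof -
  have "(\<lambda>s. indicator {0..t} s * h s) \<in> borel_measurable (abs_measure a t)"
    using assms unfolding path_integrable_def set_integrable_def real_scaleR_def by auto
  then show ?thesis by simp
qed

text \<open>Both measures lie below the variation measure, because it is their sum.\<close>

lemma path_integrable_pos_neg:
  assumes "path_integrable h a t" "0 \<le> t"
  shows "set_integrable (pos_measure a t) {0..t} h" "set_integrable (neg_measure a t) {0..t} h"
proof -
  have fv: "fv_path a t" using assms unfolding path_integrable_def by simp
  note d = dist_fun_path[OF fv assms(2)]
  have "abs_measure a t = interval_measure (\<lambda>s. pos_dist a t s + neg_dist a t s)"
    unfolding abs_measure_def pos_dist_def neg_dist_def by (simp add: field_simps)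
  then have add: "emeasure (abs_measure a t) X = emeasure (pos_measure a t) X + emeasure (neg_measure a t) X"
    if "X \<in> sets borel" for X
    using emeasure_interval_measure_add[OF d(2,3) that] unfolding pos_measure_eq neg_measure_eq by simp
  have "M \<le> abs_measure a t" if "M = pos_measure a t \<or> M = neg_measure a t" for M
    using that by (subst le_measure) (auto simp: add)
  then have nn: "nn_integral M f \<le> nn_integral (abs_measure a t) f"
    if "M = pos_measure a t \<or> M = neg_measure a t" for M f
    using that by (intro nn_integral_mono_measure) auto
  have "set_integrable M {0..t} h" if M: "M = pos_measure a t \<or> M = neg_measure a t" for M
    unfolding set_integrable_def real_scaleR_def
  proof (rule integrableI_bounded)
    show "(\<lambda>s. indicator {0..t} s * h s) \<in> borel_measurable M"
      using path_integrable_measurable[OF assms(1)] M by auto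
    have "integrable (abs_measure a t) (\<lambda>s. indicator {0..t} s * h s)"
      using assms unfolding path_integrable_def set_integrable_def real_scaleR_def by simp
    then show "(\<integral>\<^sup>+ s. ennreal (norm (indicator {0..t} s * h s)) \<partial>M) < \<infinity>"
      using nn[OF M] unfolding integrable_iff_bounded by (meson order.strict_trans1)
  qed
  then show "set_integrable (pos_measure a t) {0..t} h" "set_integrable (neg_measure a t) {0..t} h" by auto
qed

text \<open>By definition the measures change with the upper limit \<open>u\<close>. Here they are
  those of the fixed time \<open>t\<close>, so that \<open>u\<close> survives only in the domain of
  integration.\<close>

lemma path_integral_eq:
  assumes "path_integrable h a t" "0 \<le> u" "u \<le> t"
  shows "path_integral h a u = (LINT s:{0..u}|pos_measure a t. h s) - (LINT s:{0..u}|neg_measure a t. h s)"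
proof -
  have fv: "fv_path a t" using assms unfolding path_integrable_def by simp
  have m: "set_borel_measurable M {0..t} h" if "sets M = sets borel" for M
    using path_integrable_measurable[OF assms(1)] that
    unfolding set_borel_measurable_def by (simp cong: measurable_cong_sets)
  show ?thesis
    unfolding path_integral_def path_measure_density[OF fv assms(2,3)]
    by (subst (1 2) set_integral_density_Iic(1)[OF _ m assms(3)]) auto
qed

lemma path_measure_cong:
  assumes "\<And>s. 0 \<le> s \<Longrightarrow> s \<le> t \<Longrightarrow> a s = b s" "0 \<le> t"
  shows "abs_measure a t = abs_measure b t" "pos_measure a t = pos_measure b t" "neg_measure a t = neg_measure b t"
proof -
  have "var_ext a t = var_ext b t"
  proof
    fix s
    show "var_ext a t s = var_ext b t s"
      using assms variation_cong[of "min s t" a b] unfolding var_ext_def by auto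
  qed
  moreover have "path_ext a t = path_ext b t"
    using assms unfolding path_ext_def by (auto simp: fun_eq_iff)
  ultimately show "abs_measure a t = abs_measure b t" "pos_measure a t = pos_measure b t"
    "neg_measure a t = neg_measure b t"
    unfolding abs_measure_def pos_measure_def neg_measure_def by simp_all
qed

lemma path_integral_cong:
  assumes "\<And>s. 0 \<le> s \<Longrightarrow> s \<le> t \<Longrightarrow> a s = b s" "\<And>s. 0 \<le> s \<Longrightarrow> s \<le> t \<Longrightarrow> h s = k s" "0 \<le> t"
  shows "path_integral h a t = path_integral k b t" "path_integrable h a t \<longleftrightarrow> path_integrable k b t"
proof -
  have "(\<lambda>s. indicator {0..t} s *\<^sub>R h s) = (\<lambda>s. indicator {0..t} s *\<^sub>R k s)"
    using assms(2) by (auto simp: fun_eq_iff indicator_def)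
  moreover note path_measure_cong[OF assms(1,3)] fv_path_cong[OF assms(1)]
  ultimately show "path_integral h a t = path_integral k b t" "path_integrable h a t \<longleftrightarrow> path_integrable k b t"
    unfolding path_integral_def path_integrable_def set_integrable_def set_lebesgue_integral_def by simp_all
qed

text \<open>Integration runs over the point 0 alone, whose masses under the positive and the
  negative measure differ by \<open>a 0\<close>.\<close>

lemma path_integral_0:
  assumes "path_integrable h a 0"
  shows "path_integral h a 0 = h 0 * a 0"
proof -
  have fv: "fv_path a 0" using assms unfolding path_integrable_def by simp
  note d = dist_fun_path[OF fv order_refl]
  have *: "(LINT s:{0..0}|interval_measure F. h s) = F 0 * h 0" if "dist_fun F 0" for F
  proof -
    have "(\<lambda>s. indicator {0..0} s *\<^sub>R h s) = (\<lambda>s. indicator {0} s * h 0)"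
      by (auto simp: fun_eq_iff indicator_def)
    then show ?thesis
      unfolding set_lebesgue_integral_def by (simp add: measure_dist_fun_singleton_0[OF that])
  qed
  show ?thesis
    unfolding path_integral_def pos_measure_eq neg_measure_eq *[OF d(2)] *[OF d(3)]
    by (simp add: pos_dist_def neg_dist_def path_ext_def var_ext_def field_simps)
qed

text \<open>A path stopped at \<open>u\<close> does not charge later times: its measures at
  \<open>t\<close> are those of the original path at \<open>u\<close>, and for these the two
  integrands agree almost everywhere.\<close>

lemma path_stopped:
  assumes h: "path_integrable h a u" and u: "0 \<le> u" "u \<le> t"
  shows "path_integrable (\<lambda>s. h (min s u)) (\<lambda>s. a (min s u)) t"
    "path_integral (\<lambda>s. h (min s u)) (\<lambda>s. a (min s u)) t = path_integral h a u"
proof -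
  let ?h = "\<lambda>s. h (min s u)" and ?a = "\<lambda>s. a (min s u)"
  have fv: "fv_path a u" using h unfolding path_integrable_def by simp
  have v: "var_ext ?a t = var_ext a u"
  proof
    fix s show "var_ext ?a t s = var_ext a u s"
      using u variation_min[of "min s t" u a] unfolding var_ext_def by (auto simp: min_def)
  qed
  have p: "path_ext ?a t = path_ext a u"
    using u unfolding path_ext_def by (auto simp: fun_eq_iff min_def)
  have m: "abs_measure ?a t = abs_measure a u" "pos_measure ?a t = pos_measure a u"
    "neg_measure ?a t = neg_measure a u"
    unfolding abs_measure_def pos_measure_def neg_measure_def v p by simp_all
  have [measurable]: "(\<lambda>s. indicator {0..u} s * h s) \<in> borel_measurable borel"
    by (rule path_integrable_measurable[OF h])
  have "(\<lambda>s. indicator {0..t} s * ?h s) = (\<lambda>s. indicator {0..u} s * h s + indicator {u<..t} s * h u)"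
    using u by (auto simp: fun_eq_iff indicator_def min_def)
  then have [measurable]: "(\<lambda>s. indicator {0..t} s * ?h s) \<in> borel_measurable borel" by simp
  note d = dist_fun_path[OF fv u(1)]
  have ae: "AE s in M. indicator {0..t} s * ?h s = indicator {0..u} s * h s"
    if "AE s in M. s \<le> u" for M
    using that by eventually_elim (use u in \<open>auto simp: indicator_def min_def\<close>)
  have ae: "AE s in abs_measure a u. indicator {0..t} s * ?h s = indicator {0..u} s * h s"
    "AE s in pos_measure a u. indicator {0..t} s * ?h s = indicator {0..u} s * h s"
    "AE s in neg_measure a u. indicator {0..t} s * ?h s = indicator {0..u} s * h s"
    unfolding abs_measure_def pos_measure_eq neg_measure_eq
    using d by (auto intro!: ae dest: dist_fun_AE_le)
  have "integrable (abs_measure a u) (\<lambda>s. indicator {0..t} s * ?h s) \<longleftrightarrow>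
    integrable (abs_measure a u) (\<lambda>s. indicator {0..u} s * h s)"
    by (rule integrable_cong_AE) (use ae in auto)
  then show "path_integrable ?h ?a t"
    using h fv_path_min[OF fv u(1), of t] u
    unfolding path_integrable_def set_integrable_def m real_scaleR_def by simp
  have "(LINT s|pos_measure a u. indicator {0..t} s * ?h s) = (LINT s|pos_measure a u. indicator {0..u} s * h s)"
    "(LINT s|neg_measure a u. indicator {0..t} s * ?h s) = (LINT s|neg_measure a u. indicator {0..u} s * h s)"
    using ae by (auto intro!: integral_cong_AE)
  then show "path_integral ?h ?a t = path_integral h a u"
    unfolding path_integral_def set_lebesgue_integral_def m real_scaleR_def by simp
qed

section \<open>The integral as a function of its upper limit\<close>

context
  fixes M :: "real measure" and f :: "real \<Rightarrow> real"
  assumes M [measurable_cong]: "sets M = sets borel" and f: "integrable M f"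
begin

lemma integrable_indicator_times: "X \<in> sets borel \<Longrightarrow> integrable M (\<lambda>s. indicator X s * f s)"
  using integrable_mult_indicator[of X M f] f M by simp

lemma integral_Iic_tendsto:
  assumes X: "\<And>n. X n \<in> sets borel" "Y \<in> sets borel"
    and "\<And>s. (\<lambda>n. indicator (X n) s :: real) \<longlonglongrightarrow> indicator Y s"
  shows "(\<lambda>n. LINT s|M. indicator (X n) s * f s) \<longlonglongrightarrow> (LINT s|M. indicator Y s * f s)"
proof (rule integral_dominated_convergence[where w="\<lambda>s. \<bar>f s\<bar>"])
  show "(\<lambda>s. indicator Y s * f s) \<in> borel_measurable M"
    using integrable_indicator_times[OF X(2)] by auto
  show "(\<lambda>s. indicator (X n) s * f s) \<in> borel_measurable M" for n
    using integrable_indicator_times[OF X(1)] by auto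
  show "integrable M (\<lambda>s. \<bar>f s\<bar>)" using f by auto
  show "AE s in M. (\<lambda>n. indicator (X n) s * f s) \<longlonglongrightarrow> indicator Y s * f s"
    using assms(3) by (auto intro!: tendsto_mult)
  show "AE s in M. norm (indicator (X n) s * f s) \<le> \<bar>f s\<bar>" for n
    by (auto simp: indicator_def)
qed

lemma integral_Iic_right_continuous: "continuous (at_right u) (\<lambda>u. LINT s|M. indicator {..u} s * f s)"
  unfolding continuous_within
proof (rule tendsto_at_right_sequentially[of u "u + 1"])
  fix S :: "nat \<Rightarrow> real" assume S: "\<And>n. u < S n" "decseq S" "S \<longlonglongrightarrow> u"
  show "(\<lambda>n. LINT s|M. indicator {..S n} s * f s) \<longlonglongrightarrow> (LINT s|M. indicator {..u} s * f s)"
  proof (rule integral_Iic_tendsto)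
    fix s
    show "(\<lambda>n. indicator {..S n} s :: real) \<longlonglongrightarrow> indicator {..u} s"
    proof (cases "s \<le> u")
      case True
      then have "s \<le> S n" for n using S(1)[of n] by simp
      then show ?thesis using True by simp
    next
      case False
      then have "eventually (\<lambda>n. S n < s) sequentially" using order_tendstoD(2)[OF S(3)] by simp
      then show ?thesis
        using False by (intro tendsto_eventually) (auto elim!: eventually_mono)
    qed
  qed auto
qed simp

lemma integral_Iic_left_limit:
  "((\<lambda>u. LINT s|M. indicator {..u} s * f s) \<longlongrightarrow> (LINT s|M. indicator {..<u} s * f s)) (at_left u)"
proof (rule tendsto_at_left_sequentially[of "u - 1"])
  fix S :: "nat \<Rightarrow> real" assume S: "\<And>n. S n < u" "incseq S" "S \<longlonglongrightarrow> u"
  show "(\<lambda>n. LINT s|M. indicator {..S n} s * f s) \<longlonglongrightarrow> (LINT s|M. indicator {..<u} s * f s)"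
  proof (rule integral_Iic_tendsto)
    fix s
    show "(\<lambda>n. indicator {..S n} s :: real) \<longlonglongrightarrow> indicator {..<u} s"
    proof (cases "s < u")
      case True
      then have "eventually (\<lambda>n. s < S n) sequentially" using order_tendstoD(1)[OF S(3)] by simp
      then show ?thesis
        using True by (intro tendsto_eventually) (auto elim!: eventually_mono)
    next
      case False
      then have "\<not> s \<le> S n" for n using S(1)[of n] by simp
      then show ?thesis using False by simp
    qed
  qed auto
qed simp

lemma integral_Iic_increment:
  assumes "l \<le> u"
  shows "\<bar>(LINT s|M. indicator {..u} s * f s) - (LINT s|M. indicator {..l} s * f s)\<bar>
    \<le> (LINT s|M. indicator {..u} s * \<bar>f s\<bar>) - (LINT s|M. indicator {..l} s * \<bar>f s\<bar>)"
proof -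
  have i: "integrable M (\<lambda>s. indicator {..v} s * f s)" for v by (rule integrable_indicator_times) simp
  have ia: "integrable M (\<lambda>s. indicator {..v} s * \<bar>f s\<bar>)" for v
    using integrable_abs[OF i[of v]] by (simp add: abs_mult)
  have "(LINT s|M. indicator {..u} s * f s) - (LINT s|M. indicator {..l} s * f s)
    = (LINT s|M. indicator {..u} s * f s - indicator {..l} s * f s)"
    using i by simp
  also have "\<bar>\<dots>\<bar> \<le> (LINT s|M. \<bar>indicator {..u} s * f s - indicator {..l} s * f s\<bar>)"
    using integral_norm_bound[of M "\<lambda>s. indicator {..u} s * f s - indicator {..l} s * f s"] by simp
  also have "\<dots> = (LINT s|M. indicator {..u} s * \<bar>f s\<bar> - indicator {..l} s * \<bar>f s\<bar>)"
    using assms by (intro Bochner_Integration.integral_cong) (auto simp: indicator_def)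
  also have "\<dots> = (LINT s|M. indicator {..u} s * \<bar>f s\<bar>) - (LINT s|M. indicator {..l} s * \<bar>f s\<bar>)"
    using ia by simp
  finally show ?thesis .
qed

end

text \<open>\<open>c\<close> expresses the integral through the measures of the fixed time
  \<open>t\<close> and makes sense for every real upper limit, so its one-sided limits follow from
  dominated convergence without boundary cases. Its variation is finite because the integral
  \<open>g\<close> of the absolute value dominates its increments.\<close>

lemma fv_path_path_integral:
  assumes h: "path_integrable h a t" and t: "0 \<le> t"
  shows "fv_path (\<lambda>u. path_integral h a u) t"
proof -
  let ?M = "pos_measure a t" and ?N = "neg_measure a t"
  let ?f = "\<lambda>s. indicator {0..t} s * h s"
  have iM: "integrable ?M ?f" and iN: "integrable ?N ?f"
    using path_integrable_pos_neg[OF h t] unfolding set_integrable_def real_scaleR_def by simp_all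
  define c where "c u = (LINT s|?M. indicator {..u} s * ?f s) - (LINT s|?N. indicator {..u} s * ?f s)" for u
  define g where "g u = (LINT s|?M. indicator {..u} s * \<bar>?f s\<bar>) + (LINT s|?N. indicator {..u} s * \<bar>?f s\<bar>)" for u
  have "path_integral h a u = c u" if "0 \<le> u" "u \<le> t" for u
  proof -
    have "(\<lambda>s. indicator {0..u} s * h s) = (\<lambda>s. indicator {..u} s * ?f s)"
      using that by (auto simp: fun_eq_iff indicator_def)
    then show ?thesis
      unfolding path_integral_eq[OF h that] c_def set_lebesgue_integral_def real_scaleR_def by (simp only:)
  qed
  moreover have "fv_path c t"
    unfolding fv_path_def
  proof (intro conjI ballI)
    show "continuous (at_right s) c" for s
      unfolding c_def by (intro continuous_diff integral_Iic_right_continuous iM iN) auto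
    show "\<exists>l. (c \<longlongrightarrow> l) (at_left s)" for s
      unfolding c_def by (rule exI, rule tendsto_diff[OF integral_Iic_left_limit[OF _ iM] integral_Iic_left_limit[OF _ iN]]) simp_all
    have "\<bar>c u - c l\<bar> \<le> g u - g l" if "l \<le> u" for l u
      using integral_Iic_increment[OF _ iM that] integral_Iic_increment[OF _ iN that]
      unfolding c_def g_def by simp
    then show "variation c t < \<infinity>"
      using t by (intro enn2real_variation_le(1)[of t c g]) auto
  qed
  ultimately show ?thesis using fv_path_cong[of t "\<lambda>u. path_integral h a u" c] by simp
qed

section \<open>Measurable dependence of the integral on the sample point\<close>

lemma borel_measurable_nn_integral_interval_measure:
  fixes G :: "'a \<Rightarrow> real \<Rightarrow> real" and f :: "'a \<Rightarrow> real \<Rightarrow> ennreal"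
  assumes G: "\<And>\<omega>. \<omega> \<in> space M \<Longrightarrow> dist_fun (G \<omega>) t"
    and [measurable]: "\<And>s. (\<lambda>\<omega>. G \<omega> s) \<in> borel_measurable M"
    and f: "(\<lambda>(\<omega>, s). f \<omega> s) \<in> borel_measurable (M \<Otimes>\<^sub>M borel)"
  shows "(\<lambda>\<omega>. \<integral>\<^sup>+ s. f \<omega> s \<partial>interval_measure (G \<omega>)) \<in> borel_measurable M"
proof -
  \<comment> \<open>The measures are scaled down to a subprobability kernel, for which measurability
    need only be checked on half-lines, and the factor is restored at the end. Adding 1 to the total
    mass \<open>G \<omega> t\<close> avoids division by 0.\<close>
  define r where "r \<omega> = ennreal (1 / (1 + G \<omega> t))" for \<omega>
  have [measurable]: "r \<in> borel_measurable M" unfolding r_def by simp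
  define K where "K \<omega> = scale_measure (r \<omega>) (interval_measure (G \<omega>))" for \<omega>
  have K: "K \<in> measurable M (subprob_algebra borel)"
  proof (rule measurable_subprob_algebra_generated[where \<Omega>=UNIV and G="range atMost"])
    show "sets borel = sigma_sets UNIV (range (atMost :: real \<Rightarrow> _))"
      by (subst borel_eq_atMost) simp
    show "Int_stable (range (atMost :: real \<Rightarrow> _))"
      by (auto simp: Int_stable_def)
    fix \<omega> assume \<omega>: "\<omega> \<in> space M"
    show "subprob_space (K \<omega>)"
    proof (rule subprob_spaceI)
      have "emeasure (K \<omega>) (space (K \<omega>)) = ennreal (1 / (1 + G \<omega> t) * G \<omega> t)"
        unfolding K_def r_def using dist_fun_nonneg[OF G[OF \<omega>], of t]
        by (simp add: emeasure_dist_fun_UNIV[OF G[OF \<omega>]] space_scale_measure ennreal_mult[symmetric])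
      also have "\<dots> \<le> 1"
        using dist_fun_nonneg[OF G[OF \<omega>], of t] by (simp add: field_simps)
      finally show "emeasure (K \<omega>) (space (K \<omega>)) \<le> 1" .
    qed (simp add: K_def space_scale_measure)
  next
    fix A :: "real set" assume "A \<in> range atMost"
    then obtain x where A: "A = {..x}" by blast
    show "(\<lambda>\<omega>. emeasure (K \<omega>) A) \<in> borel_measurable M"
      by (rule measurable_cong[THEN iffD2, of _ _ "\<lambda>\<omega>. r \<omega> * ennreal (G \<omega> x)"])
        (auto simp: A K_def emeasure_dist_fun_Iic[OF G])
  next
    show "(\<lambda>\<omega>. emeasure (K \<omega>) UNIV) \<in> borel_measurable M"
      by (rule measurable_cong[THEN iffD2, of _ _ "\<lambda>\<omega>. r \<omega> * ennreal (G \<omega> t)"])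
        (auto simp: K_def emeasure_dist_fun_UNIV[OF G])
  qed (auto simp: K_def)
  have "(\<lambda>\<omega>. ennreal (1 + G \<omega> t) * (\<integral>\<^sup>+ s. f \<omega> s \<partial>K \<omega>)) \<in> borel_measurable M"
    using nn_integral_measurable_subprob_algebra2[OF f K] by simp
  moreover have "ennreal (1 + G \<omega> t) * (\<integral>\<^sup>+ s. f \<omega> s \<partial>K \<omega>) = (\<integral>\<^sup>+ s. f \<omega> s \<partial>interval_measure (G \<omega>))"
    if \<omega>: "\<omega> \<in> space M" for \<omega>
  proof -
    have "(\<lambda>s. f \<omega> s) \<in> borel_measurable borel"
      using measurable_Pair2[OF f \<omega>] by simp
    then have "(\<integral>\<^sup>+ s. f \<omega> s \<partial>K \<omega>) = r \<omega> * (\<integral>\<^sup>+ s. f \<omega> s \<partial>interval_measure (G \<omega>))"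
      unfolding K_def by (subst nn_integral_scale_measure) simp_all
    moreover have "ennreal (1 + G \<omega> t) * r \<omega> = 1"
      unfolding r_def using dist_fun_nonneg[OF G[OF \<omega>], of t]
      by (subst ennreal_mult[symmetric]) (auto simp: field_simps)
    ultimately show ?thesis by (simp add: mult.assoc[symmetric])
  qed
  ultimately show ?thesis by (subst measurable_cong[symmetric]) auto
qed

lemma fv_processesD:
  assumes "A \<in> fv_processes P"
  shows "0 \<le> s \<Longrightarrow> (\<lambda>\<omega>. A (\<omega>, s)) \<in> borel_measurable P"
    and "\<omega> \<in> space P \<Longrightarrow> 0 \<le> t \<Longrightarrow> fv_path (\<lambda>s. A (\<omega>, s)) t"
    and "\<omega> \<in> space P \<Longrightarrow> 0 \<le> s \<Longrightarrow> continuous (at_right s) (\<lambda>s. A (\<omega>, s))"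
proof -
  show "0 \<le> s \<Longrightarrow> (\<lambda>\<omega>. A (\<omega>, s)) \<in> borel_measurable P"
    using assms by (auto simp: fv_processes_def process_def)
  show fv: "fv_path (\<lambda>s. A (\<omega>, s)) t" if "\<omega> \<in> space P" "0 \<le> t" for \<omega> t
    using assms that by (auto simp: fv_processes_def)
  show "\<omega> \<in> space P \<Longrightarrow> 0 \<le> s \<Longrightarrow> continuous (at_right s) (\<lambda>s. A (\<omega>, s))"
    using fv[of \<omega> "s + 1"] by (auto simp: fv_path_def)
qed

lemma borel_measurable_variation:
  assumes A: "A \<in> fv_processes P" and t: "0 \<le> t"
  shows "(\<lambda>\<omega>. variation (\<lambda>s. A (\<omega>, s)) t) \<in> borel_measurable P"
proof -
  have [measurable]: "(\<lambda>\<omega>. A (\<omega>, min t (real i / real (Suc m)))) \<in> borel_measurable P" for i m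
    using t by (intro fv_processesD[OF A]) auto
  show ?thesis
    by (subst measurable_cong[OF variation_eq_SUP_grid[OF t]])
      (auto intro: fv_processesD[OF A] simp del: of_nat_Suc)
qed

lemma borel_measurable_path_integral:
  assumes H: "H \<in> measurable_processes P" and A: "A \<in> fv_processes P" and t: "0 \<le> t"
    and HA: "\<And>\<omega>. \<omega> \<in> space P \<Longrightarrow> path_integrable (\<lambda>s. H (\<omega>, s)) (\<lambda>s. A (\<omega>, s)) t"
  shows "(\<lambda>\<omega>. path_integral (\<lambda>s. H (\<omega>, s)) (\<lambda>s. A (\<omega>, s)) t) \<in> borel_measurable P"
proof -
  let ?a = "\<lambda>\<omega> s. A (\<omega>, s)"
  let ?f = "\<lambda>\<omega> s. indicator {0..t} s * H (\<omega>, s)"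
  have [measurable]: "(\<lambda>\<omega>. A (\<omega>, s)) \<in> borel_measurable P" if "0 \<le> s" for s
    using that by (rule fv_processesD[OF A])
  have [measurable]: "(\<lambda>\<omega>. variation (?a \<omega>) s) \<in> borel_measurable P" if "0 \<le> s" for s
    using that by (rule borel_measurable_variation[OF A])
  have v[measurable]: "(\<lambda>\<omega>. var_ext (?a \<omega>) t s) \<in> borel_measurable P" for s
    unfolding var_ext_def using t by (cases "s < 0") simp_all
  have p[measurable]: "(\<lambda>\<omega>. path_ext (?a \<omega>) t s) \<in> borel_measurable P" for s
    unfolding path_ext_def using t by (cases "s < 0") simp_all
  have "H \<in> borel_measurable (P \<Otimes>\<^sub>M restrict_space borel {0..})"
    using H by (simp add: measurable_processes_def)
  \<comment> \<open>\<open>H\<close> is jointly measurable over nonnegative times only. Composing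
    with \<open>max s 0\<close> extends it to the whole line, and the indicator of
    \<open>{0..t}\<close> hides the change.\<close>
  moreover have "(\<lambda>(\<omega>, s). (\<omega>, max s 0)) \<in> P \<Otimes>\<^sub>M borel \<rightarrow>\<^sub>M P \<Otimes>\<^sub>M restrict_space borel {0::real..}"
    by (auto simp: split_beta' intro!: measurable_Pair measurable_restrict_space2)
  ultimately have "(\<lambda>(\<omega>, s). H (\<omega>, max s 0)) \<in> borel_measurable (P \<Otimes>\<^sub>M borel)"
    using measurable_compose by (fastforce simp: split_beta')
  then have "(\<lambda>(\<omega>, s). indicator {0..t} s * H (\<omega>, max s 0)) \<in> borel_measurable (P \<Otimes>\<^sub>M borel)"
    by (simp add: split_beta')
  moreover have "(\<lambda>(\<omega>, s). indicator {0..t} s * H (\<omega>, max s 0)) = (\<lambda>(\<omega>, s). ?f \<omega> s)"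
    by (auto simp: fun_eq_iff indicator_def max_def)
  ultimately have [measurable]: "(\<lambda>z. indicator {0..t} (snd z) * H z) \<in> borel_measurable (P \<Otimes>\<^sub>M borel)"
    by (simp add: split_beta')
  have fv: "\<omega> \<in> space P \<Longrightarrow> fv_path (?a \<omega>) t" for \<omega> by (rule fv_processesD(2)[OF A _ t])
  have *: "(\<lambda>\<omega>. LINT s|interval_measure (G \<omega>). ?f \<omega> s) \<in> borel_measurable P"
    if "\<And>\<omega>. \<omega> \<in> space P \<Longrightarrow> dist_fun (G \<omega>) t" "\<And>s. (\<lambda>\<omega>. G \<omega> s) \<in> borel_measurable P"
      "\<And>\<omega>. \<omega> \<in> space P \<Longrightarrow> integrable (interval_measure (G \<omega>)) (?f \<omega>)" for G
  proof -
    have [measurable]: "(\<lambda>\<omega>. \<integral>\<^sup>+ s. ennreal (?f \<omega> s) \<partial>interval_measure (G \<omega>)) \<in> borel_measurable P"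
      "(\<lambda>\<omega>. \<integral>\<^sup>+ s. ennreal (- ?f \<omega> s) \<partial>interval_measure (G \<omega>)) \<in> borel_measurable P"
      by (rule borel_measurable_nn_integral_interval_measure[OF that(1,2)]; simp add: split_beta')+
    show ?thesis
      by (subst measurable_cong[OF real_lebesgue_integral_def[OF that(3)]]) auto
  qed
  have "(\<lambda>\<omega>. LINT s|pos_measure (?a \<omega>) t. ?f \<omega> s) \<in> borel_measurable P"
    unfolding pos_measure_eq
  proof (rule *)
    show "integrable (interval_measure (pos_dist (?a \<omega>) t)) (?f \<omega>)" if "\<omega> \<in> space P" for \<omega>
      using path_integrable_pos_neg(1)[OF HA[OF that] t]
      unfolding pos_measure_eq set_integrable_def real_scaleR_def .
  qed (use fv t dist_fun_path in \<open>auto simp: pos_dist_def\<close>)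
  moreover have "(\<lambda>\<omega>. LINT s|neg_measure (?a \<omega>) t. ?f \<omega> s) \<in> borel_measurable P"
    unfolding neg_measure_eq
  proof (rule *)
    show "integrable (interval_measure (neg_dist (?a \<omega>) t)) (?f \<omega>)" if "\<omega> \<in> space P" for \<omega>
      using path_integrable_pos_neg(2)[OF HA[OF that] t]
      unfolding neg_measure_eq set_integrable_def real_scaleR_def .
  qed (use fv t dist_fun_path in \<open>auto simp: neg_dist_def\<close>)
  ultimately show ?thesis
    unfolding path_integral_def set_lebesgue_integral_def real_scaleR_def by simp
qed

lemma measurable_processes_right_continuous:
  assumes meas: "\<And>s. 0 \<le> s \<Longrightarrow> (\<lambda>\<omega>. A (\<omega>, s)) \<in> borel_measurable P"
    and cont: "\<And>\<omega> s. \<omega> \<in> space P \<Longrightarrow> 0 \<le> s \<Longrightarrow> continuous (at_right s) (\<lambda>s. A (\<omega>, s))"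
  shows "A \<in> measurable_processes P"
proof -
  let ?N = "P \<Otimes>\<^sub>M restrict_space borel {0::real..}"
  \<comment> \<open>The first point of the grid of mesh \<open>1 / Suc n\<close> strictly after
    \<open>s\<close>: strictness is what \<open>at_right\<close> asks for, and having countably many
    grid points makes the approximants jointly measurable.\<close>
  define g where "g n s = (real (nat \<lfloor>s * real (Suc n)\<rfloor>) + 1) / real (Suc n)" for n and s :: real
  have g: "s < g n s" "g n s \<le> s + 1 / real (Suc n)" if "0 \<le> s" for s n
  proof -
    have "s * real (Suc n) < real (nat \<lfloor>s * real (Suc n)\<rfloor>) + 1"
      using that by (simp del: of_nat_Suc)
    then show "s < g n s" unfolding g_def by (simp add: field_simps del: of_nat_Suc)
    have "real (nat \<lfloor>s * real (Suc n)\<rfloor>) \<le> s * real (Suc n)"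
      using that by (simp del: of_nat_Suc)
    then show "g n s \<le> s + 1 / real (Suc n)"
      unfolding g_def by (simp add: field_simps del: of_nat_Suc)
  qed
  have "(\<lambda>z. A (fst z, g n (snd z))) \<in> borel_measurable ?N" for n
  proof -
    have "(\<lambda>z. A (fst z, (real k + 1) / real (Suc n))) \<in> borel_measurable ?N" for k
      by (rule measurable_compose[OF measurable_fst]) (auto intro!: meas)
    moreover have "(\<lambda>z. nat \<lfloor>snd z * real (Suc n)\<rfloor>) \<in> ?N \<rightarrow>\<^sub>M count_space UNIV"
    proof -
      have "(\<lambda>s. s) \<in> restrict_space borel {0::real..} \<rightarrow>\<^sub>M borel"
        by (rule measurable_restrict_space1) simp
      from measurable_compose[OF measurable_snd this] have [measurable]: "(\<lambda>z. snd z) \<in> ?N \<rightarrow>\<^sub>M borel" .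
      show ?thesis by measurable
    qed
    ultimately show ?thesis
      unfolding g_def
      by (rule measurable_compose_countable[where g="\<lambda>z. nat \<lfloor>snd z * real (Suc n)\<rfloor>"
            and f="\<lambda>k z. A (fst z, (real k + 1) / real (Suc n))"])
  qed
  then have "A \<in> borel_measurable ?N"
  proof (rule borel_measurable_LIMSEQ_real[rotated])
    fix z assume "z \<in> space ?N"
    then obtain \<omega> s where z: "z = (\<omega>, s)" "\<omega> \<in> space P" "0 \<le> s"
      by (auto simp: space_pair_measure space_restrict_space)
    have lim: "(\<lambda>n. g n s) \<longlonglongrightarrow> s"
    proof (rule tendsto_sandwich[of "\<lambda>_. s" _ _ "\<lambda>n. s + 1 / real (Suc n)"])
      show "(\<lambda>n. s + 1 / real (Suc n)) \<longlonglongrightarrow> s"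
        using tendsto_add[OF tendsto_const LIMSEQ_Suc[OF lim_inverse_n'], of s] by simp
      show "\<forall>\<^sub>F n in sequentially. s \<le> g n s"
        using g(1)[OF z(3)] by (auto intro!: always_eventually less_imp_le)
      show "\<forall>\<^sub>F n in sequentially. g n s \<le> s + 1 / real (Suc n)"
        using g(2)[OF z(3)] by (auto intro!: always_eventually)
    qed simp
    have "continuous (at_right s) (\<lambda>s. A (\<omega>, s))"
      by (rule cont[OF z(2,3)])
    then show "(\<lambda>n. A (fst z, g n (snd z))) \<longlonglongrightarrow> A z"
      using lim g(1)[OF z(3)] unfolding continuous_within_sequentially by (auto simp: comp_def z)
  qed
  then show ?thesis unfolding measurable_processes_def .
qed

lemma fv_processes_subset_measurable: "fv_processes P \<subseteq> measurable_processes P"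
  using measurable_processes_right_continuous fv_processesD by (metis subsetI)

section \<open>Fundamental sequences of predictable sets of interval type\<close>

context usual_filtered_prob_space
begin

lemma space_F_real: "0 \<le> t \<Longrightarrow> space (F t) = space P"
  using space_F[of "ennreal t"] by (simp add: extended_filtration_def)

lemma sets_F_real_mono: "0 \<le> s \<Longrightarrow> s \<le> t \<Longrightarrow> sets (F s) \<subseteq> sets (F t)"
  using sets_F_mono[of "ennreal s" "ennreal t"] by (simp add: extended_filtration_def ennreal_leI)

lemma sets_F_real_P: "0 \<le> s \<Longrightarrow> sets (F s) \<subseteq> sets P"
  using sets_F_mono[of "ennreal s" \<top>] by (simp add: extended_filtration_def)

lemma subset_null_in_F:
  assumes "N \<in> null_sets P" "A \<subseteq> N" "0 \<le> t"
  shows "A \<in> sets (F t)"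
  using complete2[OF assms(2,1)] null_sets_F0 sets_F_real_mono[OF order_refl assms(3)] by blast

lemma measurable_F_mono:
  assumes "0 \<le> s" "s \<le> t" "f \<in> borel_measurable (F s)"
  shows "f \<in> borel_measurable (F t)"
  using measurable_mono[of borel borel "F s" "F t"] assms space_F_real[of s] space_F_real[of t]
    sets_F_real_mono[of s t] by auto

lemma measurable_F_P: "0 \<le> s \<Longrightarrow> f \<in> borel_measurable (F s) \<Longrightarrow> f \<in> borel_measurable P"
  using measurable_mono[of borel borel "F s" P] space_F_real[of s] sets_F_real_P[of s] by auto

lemma stopping_iff: "stopping P F T \<longleftrightarrow> (\<forall>t\<ge>0. {\<omega>\<in>space P. T \<omega> \<le> ennreal t} \<in> sets (F t))"
proof
  assume T: "stopping P F T"
  show "\<forall>t\<ge>0. {\<omega>\<in>space P. T \<omega> \<le> ennreal t} \<in> sets (F t)"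
  proof (intro allI impI)
    fix t :: real assume "0 \<le> t"
    then show "{\<omega>\<in>space P. T \<omega> \<le> ennreal t} \<in> sets (F t)"
      using T stopping_timeD[of "extended_filtration P F" T "ennreal t"]
      by (simp add: stopping_def pred_def extended_filtration_def space_F_real)
  qed
next
  assume *: "\<forall>t\<ge>0. {\<omega>\<in>space P. T \<omega> \<le> ennreal t} \<in> sets (F t)"
  show "stopping P F T"
    unfolding stopping_def
  proof (rule stopping_timeI)
    fix t :: ennreal
    show "Measurable.pred (extended_filtration P F t) (\<lambda>\<omega>. T \<omega> \<le> t)"
      using *[rule_format, of "enn2real t"]
      by (cases t) (simp_all add: extended_filtration_def pred_def space_F_real)
  qed
qed

lemma stopping_measurable:
  assumes "stopping P F T" shows "T \<in> borel_measurable P"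
  using assms unfolding stopping_def
  by (rule measurable_stopping_time)
    (use sets_F_mono[of _ \<top>] space_F in \<open>auto simp: extended_filtration_def split: if_splits\<close>)

text \<open>Right continuity of the filtration bridges the two inequalities. The times built below
  are infima, for which the strict inequality is the one that reduces to countably many
  conditions.\<close>

lemma stopping_from_less:
  assumes less: "\<And>t. 0 \<le> t \<Longrightarrow> {\<omega>\<in>space P. T \<omega> < ennreal t} \<in> sets (F t)"
  shows "stopping P F T"
  unfolding stopping_iff
proof (intro allI impI)
  fix t :: real assume t: "0 \<le> t"
  have "{\<omega>\<in>space P. T \<omega> \<le> ennreal t} \<in> sets (F s)" if s: "t < s" for s
  proof -
    \<comment> \<open>From index \<open>N\<close> on, the sets \<open>?A n\<close> belong to
      \<open>F s\<close>, and the later ones alone determine the intersection.\<close>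
    obtain N where N: "inverse (real (Suc N)) < s - t" using reals_Archimedean[of "s - t"] s by auto
    have "{\<omega>\<in>space P. T \<omega> \<le> ennreal t} = (\<Inter>n\<in>{N..}. {\<omega>\<in>space P. T \<omega> < ennreal (t + inverse (real (Suc n)))})"
      (is "_ = (\<Inter>n\<in>_. ?A n)")
    proof (intro equalityI subsetI)
      fix \<omega> assume "\<omega> \<in> {\<omega>\<in>space P. T \<omega> \<le> ennreal t}"
      moreover have "ennreal t < ennreal (t + inverse (real (Suc n)))" for n
        using t by (intro ennreal_lessI add_nonneg_pos) auto
      ultimately show "\<omega> \<in> (\<Inter>n\<in>{N..}. ?A n)" by (auto intro: le_less_trans simp del: of_nat_Suc)
    next
      fix \<omega> assume \<omega>: "\<omega> \<in> (\<Inter>n\<in>{N..}. ?A n)"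
      have lim: "(\<lambda>n. ennreal (t + inverse (real (Suc n)))) \<longlonglongrightarrow> ennreal (t + 0)"
        by (intro tendsto_ennrealI tendsto_add tendsto_const LIMSEQ_inverse_real_of_nat)
      have "T \<omega> \<le> ennreal (t + 0)"
        by (rule LIMSEQ_le_const[OF lim]) (use \<omega> in \<open>auto intro!: exI[of _ N] less_imp_le\<close>)
      then show "\<omega> \<in> {\<omega>\<in>space P. T \<omega> \<le> ennreal t}" using \<omega> by auto
    qed
    moreover have "?A n \<in> sets (F s)" if "N \<le> n" for n
    proof -
      have "inverse (real (Suc n)) \<le> inverse (real (Suc N))"
        using that by (intro le_imp_inverse_le) auto
      then have "t + inverse (real (Suc n)) \<le> s" using N by linarith
      then show ?thesis
        using less[of "t + inverse (real (Suc n))"] sets_F_real_mono[of "t + inverse (real (Suc n))" s] t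
        by auto
    qed
    then have "(\<Inter>n\<in>{N..}. ?A n) \<in> sets (F s)"
      by (intro sets.countable_INT') auto
    ultimately show ?thesis by simp
  qed
  then show "{\<omega>\<in>space P. T \<omega> \<le> ennreal t} \<in> sets (F t)"
    unfolding right_continuous[OF t] by auto
qed

text \<open>By completeness and the choice of \<open>F 0\<close>, every subset of a null set lies in
  every \<open>F t\<close>. This pays for redefining the announcing sequence on its exceptional
  set.\<close>

lemma stopping_modification:
  assumes T: "stopping P F T" and N: "N \<in> null_sets P"
    and eq: "\<And>\<omega>. \<omega> \<in> space P - N \<Longrightarrow> T' \<omega> = T \<omega>"
  shows "stopping P F T'"
  unfolding stopping_iff
proof (intro allI impI)
  fix t :: real assume t: "0 \<le> t"
  have "{\<omega>\<in>space P. T' \<omega> \<le> ennreal t} =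
      ({\<omega>\<in>space P. T \<omega> \<le> ennreal t} - N) \<union> {\<omega>\<in>space P \<inter> N. T' \<omega> \<le> ennreal t}"
  proof (intro set_eqI)
    fix \<omega>
    show "\<omega> \<in> {\<omega>\<in>space P. T' \<omega> \<le> ennreal t} \<longleftrightarrow>
      \<omega> \<in> ({\<omega>\<in>space P. T \<omega> \<le> ennreal t} - N) \<union> {\<omega>\<in>space P \<inter> N. T' \<omega> \<le> ennreal t}"
      using eq[of \<omega>] by (cases "\<omega> \<in> N") auto
  qed
  moreover have "N \<in> sets (F t)" by (rule subset_null_in_F[OF N order_refl t])
  moreover have "{\<omega>\<in>space P \<inter> N. T' \<omega> \<le> ennreal t} \<in> sets (F t)"
    by (rule subset_null_in_F[OF N _ t]) blast
  moreover have "{\<omega>\<in>space P. T \<omega> \<le> ennreal t} \<in> sets (F t)"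
    using T t unfolding stopping_iff by blast
  ultimately show "{\<omega>\<in>space P. T' \<omega> \<le> ennreal t} \<in> sets (F t)"
    by (simp add: sets.Diff sets.Un)
qed

section \<open>Predictable sets and their sections\<close>

lemma predictable_induct [consumes 1, case_names initial interval Compl Union]:
  assumes C: "C \<in> sets (predictable_sigma P F)"
    and initial: "\<And>D. D \<in> sets (F 0) \<Longrightarrow> D \<subseteq> space P \<Longrightarrow> Q (D \<times> {0})"
    and interval: "\<And>D u v. 0 \<le> u \<Longrightarrow> u < v \<Longrightarrow> D \<in> sets (F u) \<Longrightarrow> D \<subseteq> space P \<Longrightarrow> Q (D \<times> {u<..v})"
    and Compl: "\<And>C. C \<subseteq> space P \<times> {0..} \<Longrightarrow> Q C \<Longrightarrow> Q (space P \<times> {0..} - C)"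
    and Union: "\<And>C :: nat \<Rightarrow> ('a \<times> real) set. (\<And>n. C n \<subseteq> space P \<times> {0..}) \<Longrightarrow> (\<And>n. Q (C n)) \<Longrightarrow> Q (\<Union>n. C n)"
  shows "C \<subseteq> space P \<times> {0..} \<and> Q C"
proof -
  let ?G = "{C \<times> {0} |C. C \<in> sets (F 0)} \<union> {C \<times> {s<..t} |C s t. 0 \<le> s \<and> s < t \<and> C \<in> sets (F s)}"
  have sub: "C \<subseteq> space P" if "C \<in> sets (F u)" "0 \<le> u" for C u
    using sets.sets_into_space[OF that(1)] space_F_real[OF that(2)] by simp
  have "?G \<subseteq> Pow (space P \<times> {0..})"
    by (auto dest: sub)
  then have "C \<in> sigma_sets (space P \<times> {0..}) ?G"
    using C unfolding predictable_sigma_def by (simp add: sets_measure_of)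
  then show ?thesis
  proof induction
    case (Basic a)
    then consider D where "a = D \<times> {0}" "D \<in> sets (F 0)"
      | D u v where "a = D \<times> {u<..v}" "0 \<le> u" "u < v" "D \<in> sets (F u)" by blast
    then show ?case
    proof cases
      case 1
      then show ?thesis using initial[of D] sub[of D 0] by auto
    next
      case 2
      then show ?thesis using interval[of u v D] sub[of D u] by auto
    qed
  next
    case Empty
    \<comment> \<open>The empty set is a union of empty rectangles, so the rule \<open>Union\<close>
      covers it.\<close>
    have "Q (\<Union>n::nat. if n = 0 then {} \<times> {0} else {} \<times> {0})"
      by (rule Union) (auto intro: initial[of "{}", simplified])
    then show ?case by simp
  next
    case (Compl a)
    then show ?case by (auto intro: assms(4))
  next
    case (Union a)
    then show ?case by (auto intro!: assms(5))
  qed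
qed

lemma predictable_subset: "C \<in> sets (predictable_sigma P F) \<Longrightarrow> C \<subseteq> space P \<times> {0..}"
  using predictable_induct[of C "\<lambda>_. True"] by simp

lemma predictable_section:
  assumes "C \<in> sets (predictable_sigma P F)" and s: "0 \<le> s"
  shows "{\<omega>\<in>space P. (\<omega>, s) \<in> C} \<in> sets (F s)"
proof -
  have "C \<subseteq> space P \<times> {0..} \<and> {\<omega>\<in>space P. (\<omega>, s) \<in> C} \<in> sets (F s)"
    using assms(1)
  proof (induction rule: predictable_induct)
    case (initial D)
    then have "{\<omega>\<in>space P. (\<omega>, s) \<in> D \<times> {0}} = (if s = 0 then D else {})" by auto
    then show ?case using initial by auto
  next
    case (interval D u v)
    then have "{\<omega>\<in>space P. (\<omega>, s) \<in> D \<times> {u<..v}} = (if u < s \<and> s \<le> v then D else {})" by auto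
    then show ?case using interval sets_F_real_mono[of u s] by auto
  next
    case (Compl C)
    have "{\<omega>\<in>space P. (\<omega>, s) \<in> space P \<times> {0..} - C} = space (F s) - {\<omega>\<in>space P. (\<omega>, s) \<in> C}"
      using s space_F_real[OF s] by auto
    then show ?case using Compl by (simp add: sets.compl_sets)
  next
    case (Union C)
    have "{\<omega>\<in>space P. (\<omega>, s) \<in> (\<Union>n. C n)} = (\<Union>n. {\<omega>\<in>space P. (\<omega>, s) \<in> C n})" by auto
    then show ?case using Union by auto
  qed
  then show ?thesis ..
qed

lemma predictable_product_measurable:
  assumes "C \<in> sets (predictable_sigma P F)"
  shows "C \<in> sets (P \<Otimes>\<^sub>M borel)"
proof -
  have "C \<subseteq> space P \<times> {0..} \<and> C \<in> sets (P \<Otimes>\<^sub>M borel)"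
    using assms
  proof (induction rule: predictable_induct)
    case (initial D)
    then show ?case using sets_F_real_P[of 0] by (auto intro!: pair_measureI)
  next
    case (interval D u v)
    then show ?case using sets_F_real_P[of u] by (auto intro!: pair_measureI)
  next
    case (Compl C)
    then show ?case by (intro sets.Diff pair_measureI) auto
  next
    case (Union C)
    then show ?case by auto
  qed
  then show ?thesis ..
qed

section \<open>Inner regularity along a random time\<close>

text \<open>The zero sets of these processes play the role of the compact sets in inner regularity.\<close>

definition test_process :: "('a \<Rightarrow> real \<Rightarrow> real) \<Rightarrow> bool" where
  "test_process X \<longleftrightarrow> (\<forall>\<omega>\<in>space P. continuous_on {0..} (X \<omega>)) \<and>
     (\<forall>s\<ge>0. (\<lambda>\<omega>. X \<omega> s) \<in> borel_measurable (F s)) \<and> (\<forall>\<omega> s. 0 \<le> X \<omega> s \<and> X \<omega> s \<le> 1)"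

definition zero_set :: "('a \<Rightarrow> real \<Rightarrow> real) \<Rightarrow> ('a \<times> real) set" where
  "zero_set X = {(\<omega>, s). \<omega> \<in> space P \<and> 0 \<le> s \<and> X \<omega> s = 0}"

lemma test_processD:
  assumes "test_process X"
  shows "\<omega> \<in> space P \<Longrightarrow> continuous_on {0..} (X \<omega>)" "0 \<le> s \<Longrightarrow> (\<lambda>\<omega>. X \<omega> s) \<in> borel_measurable (F s)"
    "0 \<le> X \<omega> s" "X \<omega> s \<le> 1"
  using assms unfolding test_process_def by auto

lemma test_process_continuous_at_right:
  assumes "test_process X" "\<omega> \<in> space P" "0 \<le> s"
  shows "continuous (at_right s) (X \<omega>)"
  using test_processD(1)[OF assms(1,2)] assms(3)
  by (auto simp: continuous_on_eq_continuous_within intro: continuous_within_subset)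

lemma test_process_at_random_time:
  assumes X: "test_process X" and \<tau>: "\<tau> \<in> borel_measurable P" "\<And>\<omega>. 0 \<le> \<tau> \<omega>"
  shows "(\<lambda>\<omega>. X \<omega> (\<tau> \<omega>)) \<in> borel_measurable P"
proof -
  have "(\<lambda>(\<omega>, s). X \<omega> s) \<in> measurable_processes P"
  proof (rule measurable_processes_right_continuous)
    show "(\<lambda>\<omega>. case (\<omega>, s) of (\<omega>, s) \<Rightarrow> X \<omega> s) \<in> borel_measurable P" if "0 \<le> s" for s
      using measurable_F_P[OF that test_processD(2)[OF X that]] by simp
    show "continuous (at_right s) (\<lambda>s. case (\<omega>, s) of (\<omega>, s) \<Rightarrow> X \<omega> s)" if "\<omega> \<in> space P" "0 \<le> s" for \<omega> s
      using test_process_continuous_at_right[OF X that] by simp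
  qed
  then have XM: "(\<lambda>(\<omega>, s). X \<omega> s) \<in> borel_measurable (P \<Otimes>\<^sub>M restrict_space borel {0..})"
    unfolding measurable_processes_def .
  have "\<tau> \<in> P \<rightarrow>\<^sub>M restrict_space borel {0..}"
    using \<tau> by (intro measurable_restrict_space2) simp_all
  then have "(\<lambda>\<omega>. (\<omega>, \<tau> \<omega>)) \<in> P \<rightarrow>\<^sub>M P \<Otimes>\<^sub>M restrict_space borel {0..}"
    by (intro measurable_Pair measurable_ident_sets refl)
  from measurable_compose[OF this XM] show ?thesis by simp
qed

text \<open>Approximation of \<open>C\<close> and of its complement at once: the event is that the
  point \<open>(\<omega>, \<tau> \<omega>)\<close> is caught neither by a zero set inside
  \<open>C\<close> nor by one outside. This symmetric form passes to complements by exchanging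
  \<open>X\<close> and \<open>Y\<close>, which is what allows an induction over the
  sigma-algebra.\<close>

definition regular :: "('a \<Rightarrow> real) \<Rightarrow> ('a \<times> real) set \<Rightarrow> bool" where
  "regular \<tau> C \<longleftrightarrow> (\<forall>e>0. \<exists>X Y. test_process X \<and> test_process Y \<and> zero_set X \<subseteq> C \<and> zero_set Y \<inter> C = {} \<and>
     prob {\<omega>\<in>space P. X \<omega> (\<tau> \<omega>) \<noteq> 0 \<and> Y \<omega> (\<tau> \<omega>) \<noteq> 0} < e)"

context
  fixes \<tau> :: "'a \<Rightarrow> real"
  assumes \<tau>: "\<tau> \<in> borel_measurable P" "\<And>\<omega>. 0 \<le> \<tau> \<omega>"
begin

lemma test_process_measurable_at:
  "test_process X \<Longrightarrow> (\<lambda>\<omega>. X \<omega> (\<tau> \<omega>)) \<in> borel_measurable P"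
  by (rule test_process_at_random_time[OF _ \<tau>])

text \<open>From inside, \<open>X\<close> itself leaves no error. The complement is the increasing
  union of the sets where \<open>X\<close> is at least \<open>1 / Suc m\<close>, and these are the
  zero sets of \<open>Y m\<close>.\<close>

lemma regular_zero_set:
  assumes X: "test_process X"
  shows "regular \<tau> (zero_set X)"
  unfolding regular_def
proof (intro allI impI)
  fix e :: real assume e: "0 < e"
  define Y where "Y m \<omega> s = max 0 (inverse (real (Suc m)) - X \<omega> s)" for m \<omega> s
  have Yne: "Y m \<omega> s \<noteq> 0 \<longleftrightarrow> X \<omega> s < inverse (real (Suc m))" for m \<omega> s
    unfolding Y_def by (simp add: max_def del: of_nat_Suc) linarith
  have i1: "inverse (real (Suc m)) \<le> 1" for m by (simp add: field_simps)
  have Y: "test_process (Y m)" for m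
    unfolding test_process_def
  proof (intro conjI ballI allI impI)
    show "continuous_on {0..} (Y m \<omega>)" if "\<omega> \<in> space P" for \<omega>
      unfolding Y_def by (intro continuous_intros test_processD(1)[OF X that])
    show "(\<lambda>\<omega>. Y m \<omega> s) \<in> borel_measurable (F s)" if "0 \<le> s" for s
      using test_processD(2)[OF X that] unfolding Y_def by simp
    show "Y m \<omega> s \<le> 1" for \<omega> s
      using i1[of m] test_processD(3)[OF X, of \<omega> s] unfolding Y_def by (simp del: of_nat_Suc)
  qed (simp add: Y_def)
  let ?A = "\<lambda>m. {\<omega>\<in>space P. X \<omega> (\<tau> \<omega>) \<noteq> 0 \<and> Y m \<omega> (\<tau> \<omega>) \<noteq> 0}"
  have "(\<lambda>m. prob (?A m)) \<longlonglongrightarrow> prob (\<Inter>m. ?A m)"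
  proof (rule finite_Lim_measure_decseq)
    have [measurable]: "(\<lambda>\<omega>. X \<omega> (\<tau> \<omega>)) \<in> borel_measurable P" "(\<lambda>\<omega>. Y m \<omega> (\<tau> \<omega>)) \<in> borel_measurable P" for m
      by (intro test_process_measurable_at X Y)+
    show "range ?A \<subseteq> sets P" by (intro image_subsetI) measurable
    show "decseq ?A"
    proof (rule decseq_SucI)
      fix m
      have "inverse (real (Suc (Suc m))) \<le> inverse (real (Suc m))"
        by (intro le_imp_inverse_le) auto
      then have *: "x < inverse (real (Suc m))" if "x < inverse (real (Suc (Suc m)))" for x
        using that by linarith
      show "?A (Suc m) \<subseteq> ?A m"
        using * unfolding Yne by blast
    qed
  qed
  moreover have "(\<Inter>m. ?A m) = {}"
  proof (rule ccontr)
    assume "(\<Inter>m. ?A m) \<noteq> {}"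
    then obtain \<omega> where \<omega>: "\<And>m. \<omega> \<in> ?A m" by blast
    then have "0 < X \<omega> (\<tau> \<omega>)" using test_processD(3)[OF X, of \<omega> "\<tau> \<omega>"] by fastforce
    then obtain m where "inverse (real (Suc m)) < X \<omega> (\<tau> \<omega>)" using reals_Archimedean by blast
    then show False using \<omega>[of m] unfolding Yne by (simp del: of_nat_Suc)
  qed
  ultimately have "(\<lambda>m. prob (?A m)) \<longlonglongrightarrow> 0" by simp
  then have "eventually (\<lambda>m. prob (?A m) < e) sequentially" using e by (rule order_tendstoD(2))
  then obtain m where "prob (?A m) < e" by (auto simp: eventually_sequentially)
  moreover have "zero_set (Y m) \<inter> zero_set X = {}"
    unfolding zero_set_def Y_def by (auto simp: max_def)
  ultimately show "\<exists>X' Y. test_process X' \<and> test_process Y \<and> zero_set X' \<subseteq> zero_set X \<and>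
      zero_set Y \<inter> zero_set X = {} \<and> prob {\<omega>\<in>space P. X' \<omega> (\<tau> \<omega>) \<noteq> 0 \<and> Y \<omega> (\<tau> \<omega>) \<noteq> 0} < e"
    using X Y by blast
qed

lemma regular_Compl:
  assumes "regular \<tau> C"
  shows "regular \<tau> (space P \<times> {0..} - C)"
  unfolding regular_def
proof (intro allI impI)
  fix e :: real assume "0 < e"
  then obtain X Y where XY: "test_process X" "test_process Y" "zero_set X \<subseteq> C" "zero_set Y \<inter> C = {}"
    "prob {\<omega>\<in>space P. X \<omega> (\<tau> \<omega>) \<noteq> 0 \<and> Y \<omega> (\<tau> \<omega>) \<noteq> 0} < e"
    using assms unfolding regular_def by blast
  have "zero_set Y \<subseteq> space P \<times> {0..}" unfolding zero_set_def by auto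
  moreover have "{\<omega>\<in>space P. Y \<omega> (\<tau> \<omega>) \<noteq> 0 \<and> X \<omega> (\<tau> \<omega>) \<noteq> 0} = {\<omega>\<in>space P. X \<omega> (\<tau> \<omega>) \<noteq> 0 \<and> Y \<omega> (\<tau> \<omega>) \<noteq> 0}"
    by auto
  ultimately show "\<exists>X Y. test_process X \<and> test_process Y \<and> zero_set X \<subseteq> space P \<times> {0..} - C \<and>
    zero_set Y \<inter> (space P \<times> {0..} - C) = {} \<and> prob {\<omega>\<in>space P. X \<omega> (\<tau> \<omega>) \<noteq> 0 \<and> Y \<omega> (\<tau> \<omega>) \<noteq> 0} < e"
    using XY by (intro exI[of _ Y] exI[of _ X]) auto
qed

text \<open>A sum of nonnegative terms vanishes only where all of them do. The weights add up to 1,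
  which keeps the bound by 1 and gives uniform convergence, hence continuity.\<close>

lemma test_process_sum:
  assumes Y: "\<And>n. test_process (Y n)"
  shows "test_process (\<lambda>\<omega> s. \<Sum>n. (1/2) ^ Suc n * Y n \<omega> s)"
    and "zero_set (\<lambda>\<omega> s. \<Sum>n. (1/2) ^ Suc n * Y n \<omega> s) = (\<Inter>n. zero_set (Y n))"
    and "(\<Sum>n. (1/2) ^ Suc n * Y n \<omega> s) = 0 \<longleftrightarrow> (\<forall>n. Y n \<omega> s = 0)"
proof -
  let ?f = "\<lambda>\<omega> s n. (1/2) ^ Suc n * Y n \<omega> s"
  have half: "(\<lambda>n. (1/2::real) ^ Suc n) sums 1" by (rule power_half_series)
  have nn: "0 \<le> ?f \<omega> s n" and le: "?f \<omega> s n \<le> (1/2) ^ Suc n" for \<omega> s n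
    using test_processD(3,4)[OF Y, of n \<omega> s] by (auto intro!: mult_left_le simp del: power_Suc)
  have sm: "summable (?f \<omega> s)" for \<omega> s
    by (rule summable_comparison_test[OF _ sums_summable[OF half]]) (use nn le in \<open>auto simp del: power_Suc\<close>)
  show z: "suminf (?f \<omega> s) = 0 \<longleftrightarrow> (\<forall>n. Y n \<omega> s = 0)" for \<omega> s
    using suminf_eq_zero_iff[OF sm nn, of \<omega> s] by simp
  show "zero_set (\<lambda>\<omega> s. suminf (?f \<omega> s)) = (\<Inter>n. zero_set (Y n))"
    unfolding zero_set_def z by auto
  show "test_process (\<lambda>\<omega> s. suminf (?f \<omega> s))"
    unfolding test_process_def
  proof (intro conjI ballI allI impI)
    fix \<omega> assume \<omega>: "\<omega> \<in> space P"
    have "uniform_limit {0..} (\<lambda>n s. \<Sum>i<n. ?f \<omega> s i) (\<lambda>s. suminf (?f \<omega> s)) sequentially"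
      by (rule Weierstrass_m_test[OF _ sums_summable[OF half]]) (use nn le in \<open>auto simp del: power_Suc\<close>)
    then show "continuous_on {0..} (\<lambda>s. suminf (?f \<omega> s))"
      by (rule uniform_limit_theorem[rotated])
        (auto intro!: always_eventually continuous_intros test_processD(1)[OF Y \<omega>])
  next
    fix s :: real assume "0 \<le> s"
    then show "(\<lambda>\<omega>. suminf (?f \<omega> s)) \<in> borel_measurable (F s)"
      by (intro borel_measurable_suminf borel_measurable_times borel_measurable_const test_processD(2)[OF Y])
  next
    fix \<omega> s
    show "0 \<le> suminf (?f \<omega> s)" by (rule suminf_nonneg[OF sm nn])
    show "suminf (?f \<omega> s) \<le> 1"
      using suminf_le[OF le sm sums_summable[OF half], of \<omega> s] sums_unique[OF half] by simp
  qed
qed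

text \<open>Yields finite unions of zero sets. An infinite product may vanish where no factor does,
  whence the truncation in \<open>regular_Union\<close>.\<close>

lemma test_process_prod:
  assumes X: "\<And>n. test_process (X n)"
  shows "test_process (\<lambda>\<omega> s. \<Prod>n<N. X n \<omega> s)"
  unfolding test_process_def
proof (intro conjI ballI allI impI)
  show "continuous_on {0..} (\<lambda>s. \<Prod>n<N. X n \<omega> s)" if "\<omega> \<in> space P" for \<omega>
    by (intro continuous_intros test_processD(1)[OF X that])
  show "(\<lambda>\<omega>. \<Prod>n<N. X n \<omega> s) \<in> borel_measurable (F s)" if "0 \<le> s" for s
    by (intro borel_measurable_prod test_processD(2)[OF X that])
  show "0 \<le> (\<Prod>n<N. X n \<omega> s)" "(\<Prod>n<N. X n \<omega> s) \<le> 1" for \<omega> s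
    using test_processD(3,4)[OF X] by (auto intro!: prod_nonneg prod_le_1)
qed

lemma regular_Union:
  fixes C :: "nat \<Rightarrow> ('a \<times> real) set"
  assumes C: "\<And>n. regular \<tau> (C n)"
  shows "regular \<tau> (\<Union>n. C n)"
  unfolding regular_def
proof (intro allI impI)
  fix e :: real assume e: "0 < e"
  \<comment> \<open>Half of \<open>e\<close> is spread geometrically over the approximations of the
    \<open>C n\<close>; the other half pays for keeping finitely many inner zero sets.\<close>
  define d where "d n = e / 2 * (1/2) ^ Suc n" for n
  have dpos: "0 < d n" for n unfolding d_def using e by simp
  let ?Q = "\<lambda>n X Y. test_process X \<and> test_process Y \<and> zero_set X \<subseteq> C n \<and> zero_set Y \<inter> C n = {} \<and>
     prob {\<omega>\<in>space P. X \<omega> (\<tau> \<omega>) \<noteq> 0 \<and> Y \<omega> (\<tau> \<omega>) \<noteq> 0} < d n"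
  have "\<forall>n. \<exists>X Y. ?Q n X Y"
    using C dpos unfolding regular_def by blast
  then obtain X where "\<forall>n. \<exists>Y. ?Q n (X n) Y" by (rule choice[THEN exE])
  then obtain Y where XY: "\<forall>n. ?Q n (X n) (Y n)" by (rule choice[THEN exE])
  then have XY: "\<And>n. test_process (X n)" "\<And>n. test_process (Y n)"
    "\<And>n. zero_set (X n) \<subseteq> C n" "\<And>n. zero_set (Y n) \<inter> C n = {}"
    "\<And>n. prob {\<omega>\<in>space P. X n \<omega> (\<tau> \<omega>) \<noteq> 0 \<and> Y n \<omega> (\<tau> \<omega>) \<noteq> 0} < d n"
    by blast+
  have [measurable]: "(\<lambda>\<omega>. X n \<omega> (\<tau> \<omega>)) \<in> borel_measurable P" "(\<lambda>\<omega>. Y n \<omega> (\<tau> \<omega>)) \<in> borel_measurable P" for n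
    by (intro test_process_measurable_at XY)+
  let ?E = "\<lambda>n. {\<omega>\<in>space P. X n \<omega> (\<tau> \<omega>) \<noteq> 0 \<and> Y n \<omega> (\<tau> \<omega>) \<noteq> 0}"
  \<comment> \<open>The sample points caught by some \<open>X n\<close>, but by none of the first
    \<open>N\<close>. These events decrease to the empty set.\<close>
  let ?D = "\<lambda>N. {\<omega>\<in>space P. (\<exists>n. X n \<omega> (\<tau> \<omega>) = 0) \<and> (\<forall>n<N. X n \<omega> (\<tau> \<omega>) \<noteq> 0)}"
  have "(\<lambda>N. prob (?D N)) \<longlonglongrightarrow> prob (\<Inter>N. ?D N)"
  proof (rule finite_Lim_measure_decseq)
    show "range ?D \<subseteq> sets P" by (intro image_subsetI) measurable
    show "decseq ?D" by (rule decseq_SucI) (auto simp: less_Suc_eq)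
  qed
  moreover have "(\<Inter>N. ?D N) = {}"
  proof (rule ccontr)
    assume "(\<Inter>N. ?D N) \<noteq> {}"
    then obtain \<omega> where \<omega>: "\<And>N. \<omega> \<in> ?D N" by blast
    then obtain n where "X n \<omega> (\<tau> \<omega>) = 0" by blast
    then show False using \<omega>[of "Suc n"] by blast
  qed
  ultimately have "(\<lambda>N. prob (?D N)) \<longlonglongrightarrow> 0" by simp
  then have "eventually (\<lambda>N. prob (?D N) < e / 2) sequentially" using e by (intro order_tendstoD(2)) auto
  then obtain N where N: "prob (?D N) < e / 2" by (auto simp: eventually_sequentially)
  define X' where "X' \<omega> s = (\<Prod>n<N. X n \<omega> s)" for \<omega> s
  define Y' where "Y' \<omega> s = (\<Sum>n. (1/2) ^ Suc n * Y n \<omega> s)" for \<omega> s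
  have X': "test_process X'" unfolding X'_def[abs_def] by (rule test_process_prod) (rule XY)
  have Y': "test_process Y'" unfolding Y'_def[abs_def] by (rule test_process_sum) (rule XY)
  have [measurable]: "(\<lambda>\<omega>. X' \<omega> (\<tau> \<omega>)) \<in> borel_measurable P" "(\<lambda>\<omega>. Y' \<omega> (\<tau> \<omega>)) \<in> borel_measurable P"
    by (intro test_process_measurable_at X' Y')+
  have dsum: "d sums (e / 2)"
    using sums_mult[OF power_half_series, of "e/2"] unfolding d_def mult_1_right .
  have s: "summable (\<lambda>n. prob (?E n))"
    by (rule summable_comparison_test'[OF sums_summable[OF dsum], of 0]) (simp add: less_imp_le[OF XY(5)])
  have "prob (\<Union>n. ?E n) \<le> (\<Sum>n. prob (?E n))"
    by (rule finite_measure_subadditive_countably[OF _ s]) auto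
  also have "\<dots> \<le> e / 2"
    using suminf_le[OF less_imp_le[OF XY(5)] s sums_summable[OF dsum]] sums_unique[OF dsum] by simp
  finally have E: "prob (\<Union>n. ?E n) \<le> e / 2" .
  \<comment> \<open>If the sum does not vanish, some \<open>Y k\<close> does not. Either
    \<open>X k\<close> does not vanish, which is \<open>?E k\<close>, or it does, and then the
    nonvanishing product puts the point into \<open>?D N\<close>.\<close>
  have "{\<omega>\<in>space P. X' \<omega> (\<tau> \<omega>) \<noteq> 0 \<and> Y' \<omega> (\<tau> \<omega>) \<noteq> 0} \<subseteq> (\<Union>n. ?E n) \<union> ?D N"
  proof
    fix \<omega> assume \<omega>: "\<omega> \<in> {\<omega>\<in>space P. X' \<omega> (\<tau> \<omega>) \<noteq> 0 \<and> Y' \<omega> (\<tau> \<omega>) \<noteq> 0}"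
    then have X0: "\<forall>n<N. X n \<omega> (\<tau> \<omega>) \<noteq> 0" unfolding X'_def by simp
    from \<omega> have "Y' \<omega> (\<tau> \<omega>) \<noteq> 0" by simp
    then have "\<not> (\<forall>k. Y k \<omega> (\<tau> \<omega>) = 0)"
      unfolding Y'_def test_process_sum(3)[OF XY(2)] .
    then obtain k where k: "Y k \<omega> (\<tau> \<omega>) \<noteq> 0" by blast
    show "\<omega> \<in> (\<Union>n. ?E n) \<union> ?D N"
      using X0 k \<omega> by (cases "X k \<omega> (\<tau> \<omega>) = 0") blast+
  qed
  then have "prob {\<omega>\<in>space P. X' \<omega> (\<tau> \<omega>) \<noteq> 0 \<and> Y' \<omega> (\<tau> \<omega>) \<noteq> 0} \<le> prob ((\<Union>n. ?E n) \<union> ?D N)"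
    by (rule finite_measure_mono) auto
  also have "\<dots> \<le> prob (\<Union>n. ?E n) + prob (?D N)"
    by (rule measure_Un_le) auto
  also have "\<dots> < e" using E N by simp
  finally have "prob {\<omega>\<in>space P. X' \<omega> (\<tau> \<omega>) \<noteq> 0 \<and> Y' \<omega> (\<tau> \<omega>) \<noteq> 0} < e" .
  moreover have "zero_set X' \<subseteq> (\<Union>n. C n)"
  proof -
    have "zero_set X' \<subseteq> (\<Union>n. zero_set (X n))" unfolding zero_set_def X'_def by force
    then show ?thesis using XY(3) by blast
  qed
  moreover have "zero_set Y' \<inter> (\<Union>n. C n) = {}"
  proof -
    have "zero_set Y' = (\<Inter>n. zero_set (Y n))"
      unfolding Y'_def[abs_def] by (rule test_process_sum(2)) (rule XY)
    then show ?thesis using XY(4) by blast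
  qed
  moreover note X' Y'
  ultimately show "\<exists>X Y. test_process X \<and> test_process Y \<and> zero_set X \<subseteq> (\<Union>n. C n) \<and>
    zero_set Y \<inter> (\<Union>n. C n) = {} \<and> prob {\<omega>\<in>space P. X \<omega> (\<tau> \<omega>) \<noteq> 0 \<and> Y \<omega> (\<tau> \<omega>) \<noteq> 0} < e"
    by (intro exI conjI)
qed

lemma regular_Int:
  assumes "regular \<tau> C" "regular \<tau> D" "C \<subseteq> space P \<times> {0..}"
  shows "regular \<tau> (C \<inter> D)"
proof -
  let ?\<Omega> = "space P \<times> {0..}"
  define E where "E n = (if n = (0::nat) then ?\<Omega> - C else ?\<Omega> - D)" for n
  have "regular \<tau> (\<Union>n. E n)"
    unfolding E_def using assms(1,2) by (intro regular_Union) (auto intro: regular_Compl)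
  from regular_Compl[OF this] have "regular \<tau> (?\<Omega> - (\<Union>n. E n))" .
  moreover have "?\<Omega> - (\<Union>n. E n) = C \<inter> D"
    using assms(3) unfolding E_def by (auto split: if_splits)
  ultimately show ?thesis by simp
qed

lemma regular_predictable:
  assumes "C \<in> sets (predictable_sigma P F)"
  shows "regular \<tau> C"
proof -
  have "C \<subseteq> space P \<times> {0..} \<and> regular \<tau> C"
    using assms
  proof (induction rule: predictable_induct)
    case (initial D)
      \<comment> \<open>Identically 1 for sample points outside \<open>D\<close>; on
        \<open>D\<close> it vanishes at time 0 only.\<close>
      define X where "X \<omega> s = min 1 (\<bar>s\<bar> + indicator (space P - D) \<omega>)" for \<omega> and s :: real
      have "test_process X"
        unfolding test_process_def
      proof (intro conjI ballI allI impI)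
        show "(\<lambda>\<omega>. X \<omega> s) \<in> borel_measurable (F s)" if "0 \<le> s" for s
        proof -
          have [measurable]: "D \<in> sets (F s)" "space P \<in> sets (F s)"
            using initial sets_F_real_mono[of 0 s] that space_F_real[OF that] sets.top[of "F s"] by auto
          show ?thesis unfolding X_def by measurable
        qed
      qed (auto simp: X_def intro!: continuous_intros)
      moreover have "zero_set X = D \<times> {0}"
        using initial unfolding zero_set_def X_def
        by (auto simp: indicator_def of_bool_def min_def split: if_splits)
      ultimately show ?case using regular_zero_set[of X] by simp
  next
    case (interval D u v)
      \<comment> \<open>\<open>D\<close> is known only from time \<open>u\<close> on, but
        \<open>V\<close> vanishes until then, so it is adapted. The rectangle is where
        \<open>U\<close> vanishes and \<open>V\<close> does not: the open left end comes from a
        complement, the closed right end from a zero set.\<close>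
      define V where "V \<omega> s = min 1 (max 0 (s - u)) * indicator D \<omega>" for \<omega> and s :: real
      define U where "U \<omega> s = min 1 (max 0 (s - v))" for \<omega> :: 'a and s :: real
      have "test_process U"
        unfolding test_process_def U_def by (auto intro!: continuous_intros)
      have "test_process V"
        unfolding test_process_def
      proof (intro conjI ballI allI impI)
        show "(\<lambda>\<omega>. V \<omega> s) \<in> borel_measurable (F s)" if "0 \<le> s" for s
        proof (cases "s \<le> u")
          case True
          then have "(\<lambda>\<omega>. V \<omega> s) = (\<lambda>_. 0)" unfolding V_def by auto
          then show ?thesis by simp
        next
          case False
          then have [measurable]: "D \<in> sets (F s)" using interval sets_F_real_mono[of u s] by auto
          show ?thesis unfolding V_def by measurable
        qed
      qed (auto simp: V_def indicator_def intro!: continuous_intros)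
      have "regular \<tau> ((space P \<times> {0..} - zero_set V) \<inter> zero_set U)"
        by (intro regular_Int regular_Compl regular_zero_set) (fact | auto)+
      moreover have "(space P \<times> {0..} - zero_set V) \<inter> zero_set U = D \<times> {u<..v}"
        using interval unfolding zero_set_def U_def V_def by (auto simp: indicator_def min_def max_def split: if_splits)
      ultimately show ?case by simp
  qed (auto intro: regular_Compl regular_Union)
  then show ?thesis ..
qed

end

section \<open>Hitting times of low levels and the construction of a fundamental sequence\<close>

definition hitting :: "('a \<Rightarrow> real \<Rightarrow> real) \<Rightarrow> real \<Rightarrow> 'a \<Rightarrow> ennreal" where
  "hitting X e \<omega> = (INF u\<in>{u. 0 \<le> u \<and> X \<omega> u < e}. ennreal u)"

lemma hitting_less_iff: "hitting X e \<omega> < ennreal t \<longleftrightarrow> (\<exists>u. 0 \<le> u \<and> u < t \<and> X \<omega> u < e)"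
  unfolding hitting_def INF_less_iff by (auto simp: ennreal_less_iff)

text \<open>A time before \<open>t\<close> at which the path is below \<open>e\<close> can be moved
  to the right to a rational one, still before \<open>t\<close>, because the path is right
  continuous.\<close>

lemma hitting_less_sets:
  assumes X: "test_process X" and t: "0 \<le> t"
  shows "{\<omega>\<in>space P. hitting X e \<omega> < ennreal t} \<in> sets (F t)"
proof -
  have "{\<omega>\<in>space P. hitting X e \<omega> < ennreal t} =
    (\<Union>q\<in>{q\<in>\<rat>. 0 \<le> q \<and> q < t}. {\<omega>\<in>space P. X \<omega> q < e})" (is "?L = ?R")
  proof (intro equalityI subsetI)
    fix \<omega> assume \<omega>: "\<omega> \<in> ?L"
    then obtain u where u: "0 \<le> u" "u < t" "X \<omega> u < e" unfolding hitting_less_iff by blast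
    have "(X \<omega> \<longlongrightarrow> X \<omega> u) (at_right u)"
      using test_process_continuous_at_right[OF X _ u(1), of \<omega>] \<omega> by (simp add: continuous_within)
    then have "eventually (\<lambda>x. X \<omega> x < e) (at_right u)" using u(3) by (rule order_tendstoD(2))
    then obtain b where b: "u < b" "\<And>y. u < y \<Longrightarrow> y < b \<Longrightarrow> X \<omega> y < e"
      unfolding eventually_at_right_field by blast
    obtain q where "q \<in> \<rat>" "u < q" "q < min b t" using Rats_dense_in_real[of u "min b t"] u b by auto
    then show "\<omega> \<in> ?R" using \<omega> u b by auto
  qed (auto simp: hitting_less_iff)
  moreover have "{\<omega>\<in>space P. X \<omega> q < e} \<in> sets (F t)" if "0 \<le> q" "q < t" for q
  proof -
    have [measurable]: "(\<lambda>\<omega>. X \<omega> q) \<in> borel_measurable (F t)"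
      using that by (intro measurable_F_mono[OF _ _ test_processD(2)[OF X]]) auto
    have "{\<omega>\<in>space (F t). X \<omega> q < e} \<in> sets (F t)" by measurable
    then show ?thesis using space_F_real[OF t] by simp
  qed
  ultimately show ?thesis
    by (auto intro!: sets.countable_UN' countable_subset[OF _ countable_rat])
qed

text \<open>The compact interval \<open>{0..Q \<omega>}\<close> of times lies in \<open>B\<close>,
  off the zero set, so the continuous path has a positive minimum there. Hence no sample point
  crosses all levels before \<open>Q \<omega>\<close>, and the probabilities tend to 0.\<close>

lemma hitting_small_prob:
  assumes X: "test_process X" and disj: "zero_set X \<inter> B = {}"
    and Q [measurable]: "Q \<in> borel_measurable P"
    and QB: "\<And>\<omega> t. \<omega> \<in> space P \<Longrightarrow> 0 \<le> t \<Longrightarrow> t \<le> Q \<omega> \<Longrightarrow> (\<omega>, t) \<in> B" and d: "0 < d"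
  shows "\<exists>e>0. prob {\<omega>\<in>space P. hitting X e \<omega> < ennreal (Q \<omega>)} < d"
proof -
  let ?e = "\<lambda>m. inverse (real (Suc m))"
  let ?E = "\<lambda>m. {\<omega>\<in>space P. hitting X (?e m) \<omega> < ennreal (Q \<omega>)}"
  have [measurable]: "hitting X e \<in> borel_measurable P" for e
    by (intro stopping_measurable stopping_from_less hitting_less_sets X)
  have mono: "?e (Suc m) \<le> ?e m" for m by (intro le_imp_inverse_le) auto
  have "(\<lambda>m. prob (?E m)) \<longlonglongrightarrow> prob (\<Inter>m. ?E m)"
  proof (rule finite_Lim_measure_decseq)
    show "range ?E \<subseteq> sets P" by (intro image_subsetI) measurable
    show "decseq ?E"
    proof (rule decseq_SucI, rule subsetI)
      fix m \<omega> assume "\<omega> \<in> ?E (Suc m)"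
      then show "\<omega> \<in> ?E m" unfolding mem_Collect_eq hitting_less_iff using mono[of m] by (meson order.strict_trans2)
    qed
  qed
  moreover have "(\<Inter>m. ?E m) = {}"
  proof (rule ccontr)
    assume "(\<Inter>m. ?E m) \<noteq> {}"
    then obtain \<omega> where \<omega>: "\<And>m. \<omega> \<in> ?E m" by blast
    then have sp: "\<omega> \<in> space P" by blast
    have "\<exists>u. 0 \<le> u \<and> u < Q \<omega> \<and> X \<omega> u < ?e m" for m
      using \<omega>[of m] unfolding mem_Collect_eq hitting_less_iff by blast
    then have ne: "{0..Q \<omega>} \<noteq> {}" by fastforce
    have "continuous_on {0..Q \<omega>} (X \<omega>)"
      by (rule continuous_on_subset[OF test_processD(1)[OF X sp]]) auto
    then obtain x where x: "x \<in> {0..Q \<omega>}" "\<And>y. y \<in> {0..Q \<omega>} \<Longrightarrow> X \<omega> x \<le> X \<omega> y"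
      using continuous_attains_inf[OF compact_Icc ne] by blast
    have "(\<omega>, x) \<in> B" using QB[OF sp] x(1) by auto
    then have "X \<omega> x \<noteq> 0" using disj x(1) sp unfolding zero_set_def by auto
    then have "0 < X \<omega> x" using test_processD(3)[OF X, of \<omega> x] by linarith
    then obtain m where m: "?e m < X \<omega> x" using reals_Archimedean by blast
    obtain u where "0 \<le> u" "u < Q \<omega>" "X \<omega> u < ?e m"
      using \<omega>[of m] unfolding mem_Collect_eq hitting_less_iff by blast
    then show False using x(2)[of u] m by auto
  qed
  ultimately have "(\<lambda>m. prob (?E m)) \<longlonglongrightarrow> 0" by simp
  then have "eventually (\<lambda>m. prob (?E m) < d) sequentially" using d by (rule order_tendstoD(2))
  then obtain m where "prob (?E m) < d" by (auto simp: eventually_sequentially)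
  then show ?thesis by (intro exI[of _ "?e m"]) simp
qed

text \<open>\<open>T\<close> is the end of the sections. The \<open>Q n\<close> exhaust the sections
  from inside but are mere random variables: they gauge how low the levels must be chosen, and
  replace the announcing times on a null set.\<close>

lemma psit_exhaustion:
  assumes B: "psit P F B"
  obtains T :: "'a \<Rightarrow> ennreal" and Q :: "nat \<Rightarrow> 'a \<Rightarrow> real"
  where "stopping P F T" "\<And>n. Q n \<in> borel_measurable P" "\<And>n \<omega>. 0 \<le> Q n \<omega>"
    "\<And>\<omega>. \<omega> \<in> space P \<Longrightarrow> mono (\<lambda>n. Q n \<omega>)"
    "\<And>\<omega> t. \<omega> \<in> space P \<Longrightarrow> (\<omega>, t) \<in> B \<longleftrightarrow> 0 \<le> t \<and> (\<exists>n. t \<le> Q n \<omega>)"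
    "\<And>\<omega>. \<omega> \<in> space P \<Longrightarrow> (\<omega>, enn2real (T \<omega>)) \<notin> B \<Longrightarrow> 0 < T \<omega> \<and> T \<omega> < \<top>"
    "\<And>\<omega> t. \<omega> \<in> space P \<Longrightarrow> 0 \<le> t \<Longrightarrow> ennreal t < T \<omega> \<Longrightarrow> (\<omega>, t) \<in> B"
    "\<And>\<omega> t. \<omega> \<in> space P \<Longrightarrow> (\<omega>, t) \<in> B \<Longrightarrow> 0 \<le> t \<and> ennreal t \<le> T \<omega>"
proof -
  have Bp: "B \<in> sets (predictable_sigma P F)" using B[unfolded psit_def] by (rule conjunct1)
  from B[unfolded psit_def] obtain T :: "'a \<Rightarrow> ennreal" where T [measurable]: "T \<in> borel_measurable P" and
    sec': "\<forall>\<omega>\<in>space P. {t. (\<omega>, t) \<in> B} \<noteq> {} \<and>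
          ({t. (\<omega>, t) \<in> B} = {t. 0 \<le> t \<and> ennreal t < T \<omega>} \<or>
           {t. (\<omega>, t) \<in> B} = {t. 0 \<le> t \<and> ennreal t \<le> T \<omega>})"
    by (elim conjE exE)
  note sec = bspec[OF sec']
  define \<tau> where "\<tau> \<omega> = enn2real (T \<omega>)" for \<omega>
  have [measurable]: "\<tau> \<in> borel_measurable P" unfolding \<tau>_def[abs_def] by simp
  have \<tau>0: "0 \<le> \<tau> \<omega>" for \<omega> unfolding \<tau>_def by simp
  have b_lt: "(\<omega>, t) \<in> B" if "\<omega> \<in> space P" "0 \<le> t" "ennreal t < T \<omega>" for \<omega> t
  proof -
    have "t \<in> {t. 0 \<le> t \<and> ennreal t < T \<omega>}" "t \<in> {t. 0 \<le> t \<and> ennreal t \<le> T \<omega>}"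
      using that(2,3) by simp_all
    with conjunct2[OF sec[OF that(1)]] have "t \<in> {t. (\<omega>, t) \<in> B}"
      by (elim disjE) (simp_all only:)
    then show ?thesis by simp
  qed
  have b_ge: "0 \<le> t \<and> ennreal t \<le> T \<omega>" if "\<omega> \<in> space P" "(\<omega>, t) \<in> B" for \<omega> t
  proof -
    from that(2) have "t \<in> {t. (\<omega>, t) \<in> B}" by simp
    with conjunct2[OF sec[OF that(1)]]
    have "t \<in> {t. 0 \<le> t \<and> ennreal t < T \<omega>} \<or> t \<in> {t. 0 \<le> t \<and> ennreal t \<le> T \<omega>}"
      by (elim disjE) (simp_all only: simp_thms)
    then show ?thesis by auto
  qed
  have T\<tau>: "T \<omega> = ennreal (\<tau> \<omega>)" if "T \<omega> \<noteq> \<top>" for \<omega>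
    unfolding \<tau>_def using that by (simp add: less_top)
  have out: "0 < T \<omega> \<and> T \<omega> < \<top>" if \<omega>: "\<omega> \<in> space P" "(\<omega>, \<tau> \<omega>) \<notin> B" for \<omega>
  proof (intro conjI)
    show "0 < T \<omega>"
    proof (rule ccontr)
      assume "\<not> 0 < T \<omega>"
      then have T0: "T \<omega> = 0" by simp
      obtain t where "(\<omega>, t) \<in> B" using sec[OF \<omega>(1)] by blast
      moreover from b_ge[OF \<omega>(1) this] have "t = 0" unfolding T0 by (simp add: ennreal_eq_0_iff)
      ultimately show False using \<omega>(2) unfolding \<tau>_def T0 by simp
    qed
    \<comment> \<open>If \<open>T \<omega>\<close> were \<open>\<top>\<close>, then
      \<open>\<tau> \<omega>\<close> would be 0 by the convention of \<open>enn2real\<close>, and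
      time 0 would belong to the section.\<close>
    then show "T \<omega> < \<top>"
      using b_lt[OF \<omega>(1) \<tau>0, of \<omega>] \<omega>(2) unfolding \<tau>_def by (cases "T \<omega> = \<top>") (auto simp: less_top)
  qed
  \<comment> \<open>A section ends before \<open>t\<close> if and only if it misses a rational time
    before \<open>t\<close>, and missing \<open>q\<close> is an event of \<open>F q\<close> by
    predictability.\<close>
  have less: "{\<omega>\<in>space P. T \<omega> < ennreal t} \<in> sets (F t)" if t: "0 \<le> t" for t
  proof -
    have "{\<omega>\<in>space P. T \<omega> < ennreal t} =
      (\<Union>q\<in>{q\<in>\<rat>. 0 \<le> q \<and> q < t}. {\<omega>\<in>space P. (\<omega>, q) \<notin> B})" (is "?L = ?R")
    proof (intro equalityI subsetI)
      fix \<omega> assume \<omega>: "\<omega> \<in> ?L"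
      then have "T \<omega> = ennreal (\<tau> \<omega>)" by (intro T\<tau>) auto
      with \<omega> have "\<tau> \<omega> < t" using \<tau>0[of \<omega>] by (simp add: ennreal_less_iff)
      then obtain q where q: "q \<in> \<rat>" "\<tau> \<omega> < q" "q < t" using Rats_dense_in_real by blast
      have "(\<omega>, q) \<notin> B"
        using b_ge[of \<omega> q] \<omega> q \<tau>0[of \<omega>] \<open>T \<omega> = _\<close> by auto
      then show "\<omega> \<in> ?R" using \<omega> q \<tau>0[of \<omega>] by auto
    next
      fix \<omega> assume "\<omega> \<in> ?R"
      then obtain q where q: "0 \<le> q" "q < t" "\<omega> \<in> space P" "(\<omega>, q) \<notin> B" by blast
      then have "T \<omega> \<le> ennreal q" using b_lt[of \<omega> q] by force
      also have "\<dots> < ennreal t" using q by (simp add: ennreal_less_iff)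
      finally show "\<omega> \<in> ?L" using q by simp
    qed
    moreover have "{\<omega>\<in>space P. (\<omega>, q) \<notin> B} \<in> sets (F t)" if q: "0 \<le> q" "q < t" for q
    proof -
      have "{\<omega>\<in>space P. (\<omega>, q) \<notin> B} = space (F q) - {\<omega>\<in>space P. (\<omega>, q) \<in> B}"
        using space_F_real[OF q(1)] by auto
      then have "{\<omega>\<in>space P. (\<omega>, q) \<notin> B} \<in> sets (F q)"
        using predictable_section[OF Bp q(1)] by (simp add: sets.compl_sets)
      then show ?thesis using sets_F_real_mono[of q t] q by auto
    qed
    ultimately show ?thesis
      by (auto intro!: sets.countable_UN' countable_subset[OF _ countable_rat])
  qed
  have Bm: "B \<in> sets (P \<Otimes>\<^sub>M borel)" by (rule predictable_product_measurable[OF Bp])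
  have B\<tau>: "(\<lambda>\<omega>. (\<omega>, \<tau> \<omega>)) \<in> P \<rightarrow>\<^sub>M P \<Otimes>\<^sub>M borel" by measurable
  have [measurable]: "Measurable.pred P (\<lambda>\<omega>. (\<omega>, \<tau> \<omega>) \<in> B)"
    unfolding pred_def using measurable_sets[OF B\<tau> Bm] by (simp add: vimage_def Int_def conj_commute)
  \<comment> \<open>An unbounded section is exhausted by the integers, and one containing its end by
    that end. A missing end is positive, so the factors \<open>n / (n + 1)\<close> keep
    \<open>Q n\<close> strictly before it.\<close>
  define Q where "Q n \<omega> = (if T \<omega> = \<top> then real n else if (\<omega>, \<tau> \<omega>) \<in> B then \<tau> \<omega>
    else \<tau> \<omega> * (real n / (real n + 1)))" for n \<omega>
  have Qm: "Q n \<in> borel_measurable P" for n unfolding Q_def[abs_def] by measurable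
  have Q0: "0 \<le> Q n \<omega>" for n \<omega> unfolding Q_def using \<tau>0 by simp
  have Qmono: "mono (\<lambda>n. Q n \<omega>)" for \<omega>
  proof (rule monoI)
    fix m n :: nat assume "m \<le> n"
    then have "real m / (real m + 1) \<le> real n / (real n + 1)" by (simp add: field_simps)
    then show "Q m \<omega> \<le> Q n \<omega>" unfolding Q_def using \<tau>0[of \<omega>] \<open>m \<le> n\<close> by (auto intro: mult_left_mono simp del: times_divide_eq_right)
  qed
  have QB: "(\<omega>, t) \<in> B \<longleftrightarrow> 0 \<le> t \<and> (\<exists>n. t \<le> Q n \<omega>)" if \<omega>: "\<omega> \<in> space P" for \<omega> t
  proof (cases "0 \<le> t")
    case t: True
    consider "T \<omega> = \<top>" | "T \<omega> \<noteq> \<top>" "(\<omega>, \<tau> \<omega>) \<in> B" | "T \<omega> \<noteq> \<top>" "(\<omega>, \<tau> \<omega>) \<notin> B" by blast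
    then show ?thesis
    proof cases
      case 1
      then have "(\<omega>, t) \<in> B" using b_lt[OF \<omega> t] by simp
      moreover have "\<exists>n. t \<le> Q n \<omega>" using real_arch_simple[of t] 1 by (simp add: Q_def)
      ultimately show ?thesis using t by simp
    next
      case 2
      have "(\<omega>, t) \<in> B \<longleftrightarrow> t \<le> \<tau> \<omega>"
      proof
        show "t \<le> \<tau> \<omega>" if "(\<omega>, t) \<in> B"
          using b_ge[OF \<omega> that] T\<tau>[OF 2(1)] \<tau>0[of \<omega>] by simp
        show "(\<omega>, t) \<in> B" if "t \<le> \<tau> \<omega>"
          using b_lt[OF \<omega> t] 2(2) that T\<tau>[OF 2(1)] t by (cases "t = \<tau> \<omega>") (auto simp: ennreal_less_iff)
      qed
      then show ?thesis using t 2 by (simp add: Q_def)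
    next
      case 3
      have "(\<omega>, t) \<in> B \<longleftrightarrow> t < \<tau> \<omega>"
      proof
        assume tB: "(\<omega>, t) \<in> B"
        then have "t \<le> \<tau> \<omega>" using b_ge[OF \<omega> tB] T\<tau>[OF 3(1)] \<tau>0[of \<omega>] by simp
        then show "t < \<tau> \<omega>" using 3(2) tB by (cases "t = \<tau> \<omega>") auto
      next
        show "(\<omega>, t) \<in> B" if "t < \<tau> \<omega>"
          using b_lt[OF \<omega> t] that T\<tau>[OF 3(1)] t by (auto simp: ennreal_less_iff)
      qed
      moreover have "t < \<tau> \<omega> \<longleftrightarrow> (\<exists>n. t \<le> Q n \<omega>)"
      proof
        assume tt: "t < \<tau> \<omega>"
        obtain n :: nat where "t / (\<tau> \<omega> - t) \<le> real n" using real_arch_simple by blast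
        then have "t \<le> Q n \<omega>" using tt 3 by (simp add: Q_def field_simps)
        then show "\<exists>n. t \<le> Q n \<omega>" ..
      next
        assume "\<exists>n. t \<le> Q n \<omega>"
        then obtain n where "t \<le> \<tau> \<omega> * (real n / (real n + 1))" using 3 by (auto simp: Q_def)
        moreover have "0 < \<tau> \<omega>" using out[OF \<omega> 3(2)] T\<tau>[OF 3(1)] by simp
        then have "\<tau> \<omega> * (real n / (real n + 1)) < \<tau> \<omega> * 1"
          by (intro mult_strict_left_mono) auto
        ultimately show "t < \<tau> \<omega>" by simp
      qed
      ultimately show ?thesis using t by simp
    qed
  next
    case False
    then show ?thesis using b_ge[OF \<omega>, of t] by auto
  qed
  show thesis
    by (rule that[OF stopping_from_less[OF less] Qm Q0 Qmono QB out[unfolded \<tau>_def] b_lt b_ge])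
qed

lemma psit_fundamental_seq:
  assumes B: "psit P F B"
  obtains \<tau> where "fundamental_seq P F B \<tau>"
proof -
  obtain T and Q :: "nat \<Rightarrow> 'a \<Rightarrow> real" where T: "stopping P F T" and Qm: "\<And>n. Q n \<in> borel_measurable P" and Q0: "\<And>n \<omega>. 0 \<le> Q n \<omega>"
    and Qmono: "\<And>\<omega>. \<omega> \<in> space P \<Longrightarrow> mono (\<lambda>n. Q n \<omega>)"
    and QB: "\<And>\<omega> t. \<omega> \<in> space P \<Longrightarrow> (\<omega>, t) \<in> B \<longleftrightarrow> 0 \<le> t \<and> (\<exists>n. t \<le> Q n \<omega>)"
    and out: "\<And>\<omega>. \<omega> \<in> space P \<Longrightarrow> (\<omega>, enn2real (T \<omega>)) \<notin> B \<Longrightarrow> 0 < T \<omega> \<and> T \<omega> < \<top>"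
    and b_lt: "\<And>\<omega> t. \<omega> \<in> space P \<Longrightarrow> 0 \<le> t \<Longrightarrow> ennreal t < T \<omega> \<Longrightarrow> (\<omega>, t) \<in> B"
    and b_ge: "\<And>\<omega> t. \<omega> \<in> space P \<Longrightarrow> (\<omega>, t) \<in> B \<Longrightarrow> 0 \<le> t \<and> ennreal t \<le> T \<omega>"
    by (fact psit_exhaustion[OF B])
  note [measurable] = Qm
  have Bp: "B \<in> sets (predictable_sigma P F)" using B[unfolded psit_def] by (rule conjunct1)
  define \<tau> where "\<tau> \<omega> = enn2real (T \<omega>)" for \<omega>
  have [measurable]: "T \<in> borel_measurable P" by (rule stopping_measurable[OF T])
  have \<tau>m [measurable]: "\<tau> \<in> borel_measurable P" unfolding \<tau>_def[abs_def] by simp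
  have \<tau>0: "0 \<le> \<tau> \<omega>" for \<omega> unfolding \<tau>_def by simp
  have Bm: "B \<in> sets (P \<Otimes>\<^sub>M borel)" by (rule predictable_product_measurable[OF Bp])
  have B\<tau>: "(\<lambda>\<omega>. (\<omega>, \<tau> \<omega>)) \<in> P \<rightarrow>\<^sub>M P \<Otimes>\<^sub>M borel" by measurable
  have [measurable]: "Measurable.pred P (\<lambda>\<omega>. (\<omega>, \<tau> \<omega>) \<in> B)"
    unfolding pred_def using measurable_sets[OF B\<tau> Bm] by (simp add: vimage_def Int_def conj_commute)
  have QinB: "(\<omega>, t) \<in> B" if "\<omega> \<in> space P" "0 \<le> t" "t \<le> Q n \<omega>" for \<omega> t n
    using QB that by blast
  define d where "d n = (1/2::real) ^ n" for n :: nat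
  have d: "0 < d n" for n unfolding d_def by simp
  have dsum: "summable d" unfolding d_def by (rule summable_geometric) simp
  have reg: "regular \<tau> B" by (rule regular_predictable[OF \<tau>m \<tau>0 Bp])
  let ?good = "\<lambda>n X. test_process X \<and> zero_set X \<inter> B = {} \<and>
    prob {\<omega>\<in>space P. X \<omega> (\<tau> \<omega>) \<noteq> 0 \<and> (\<omega>, \<tau> \<omega>) \<notin> B} < d n"
  have "\<exists>X. ?good n X" for n
  proof -
    from reg[unfolded regular_def, rule_format, OF d[of n]] obtain Y X where YX: "test_process Y" "test_process X" "zero_set Y \<subseteq> B" "zero_set X \<inter> B = {}"
      "prob {\<omega>\<in>space P. Y \<omega> (\<tau> \<omega>) \<noteq> 0 \<and> X \<omega> (\<tau> \<omega>) \<noteq> 0} < d n"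
      by (elim exE conjE)
    have [measurable]: "(\<lambda>\<omega>. X \<omega> (\<tau> \<omega>)) \<in> borel_measurable P" "(\<lambda>\<omega>. Y \<omega> (\<tau> \<omega>)) \<in> borel_measurable P"
      by (rule test_process_at_random_time[OF YX(2) \<tau>m \<tau>0], rule test_process_at_random_time[OF YX(1) \<tau>m \<tau>0])
    \<comment> \<open>When the point lies outside \<open>B\<close>, it escapes the zero set of
      \<open>Y\<close>, so a failure of \<open>X\<close> to catch it is a failure of both.\<close>
    have "{\<omega>\<in>space P. X \<omega> (\<tau> \<omega>) \<noteq> 0 \<and> (\<omega>, \<tau> \<omega>) \<notin> B}
        \<subseteq> {\<omega>\<in>space P. Y \<omega> (\<tau> \<omega>) \<noteq> 0 \<and> X \<omega> (\<tau> \<omega>) \<noteq> 0}"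
      using YX(3) \<tau>0 unfolding zero_set_def by blast
    then have "prob {\<omega>\<in>space P. X \<omega> (\<tau> \<omega>) \<noteq> 0 \<and> (\<omega>, \<tau> \<omega>) \<notin> B}
        \<le> prob {\<omega>\<in>space P. Y \<omega> (\<tau> \<omega>) \<noteq> 0 \<and> X \<omega> (\<tau> \<omega>) \<noteq> 0}"
      by (rule finite_measure_mono) measurable
    then have "?good n X" using YX by simp
    show ?thesis by (rule exI[of _ X]) fact
  qed
  then have "\<forall>n. \<exists>X. ?good n X" ..
  then obtain X where X: "\<forall>n. ?good n (X n)" by (rule choice[THEN exE])
  then have Xt: "test_process (X n)" and XB: "zero_set (X n) \<inter> B = {}"
    and Xp: "prob {\<omega>\<in>space P. X n \<omega> (\<tau> \<omega>) \<noteq> 0 \<and> (\<omega>, \<tau> \<omega>) \<notin> B} < d n" for n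
    by blast+
  \<comment> \<open>The level for \<open>X n\<close> is chosen so low that crossing it before
    \<open>Q n\<close> has probability less than \<open>d n\<close>.\<close>
  have "\<forall>n. \<exists>e>0. prob {\<omega>\<in>space P. hitting (X n) e \<omega> < ennreal (Q n \<omega>)} < d n"
    by (intro allI hitting_small_prob[OF Xt XB Qm QinB d])
  then obtain e where e: "\<forall>n. e n > 0 \<and> prob {\<omega>\<in>space P. hitting (X n) (e n) \<omega> < ennreal (Q n \<omega>)} < d n"
    by (rule choice[THEN exE])
  define \<sigma> where "\<sigma> n = hitting (X n) (e n)" for n
  have \<sigma>_less: "{\<omega>\<in>space P. \<sigma> n \<omega> < ennreal t} \<in> sets (F t)" if "0 \<le> t" for n t
    unfolding \<sigma>_def by (rule hitting_less_sets[OF Xt that])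
  have [measurable]: "\<sigma> n \<in> borel_measurable P" for n
    by (intro stopping_measurable stopping_from_less \<sigma>_less)
  have [measurable]: "(\<lambda>\<omega>. X n \<omega> (\<tau> \<omega>)) \<in> borel_measurable P" for n
    by (rule test_process_at_random_time[OF Xt \<tau>m \<tau>0])
  \<comment> \<open>The two ways to fail: announcing too early, and not vanishing at a missing end
    point. Their probabilities are summable, so almost surely each occurs only finitely
    often.\<close>
  let ?E1 = "\<lambda>n. {\<omega>\<in>space P. \<sigma> n \<omega> < ennreal (Q n \<omega>)}"
  let ?E2 = "\<lambda>n. {\<omega>\<in>space P. X n \<omega> (\<tau> \<omega>) \<noteq> 0 \<and> (\<omega>, \<tau> \<omega>) \<notin> B}"
  have ae1: "AE \<omega> in P. eventually (\<lambda>n. \<omega> \<in> space P - ?E1 n) sequentially"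
  proof (rule borel_cantelli_AE1)
    show "summable (\<lambda>n. prob (?E1 n))"
      by (rule summable_comparison_test'[OF dsum, of 0]) (use e in \<open>auto simp: \<sigma>_def less_imp_le\<close>)
    show "emeasure P (?E1 n) < \<infinity>" for n by (simp add: less_top[symmetric])
  qed measurable
  have ae2: "AE \<omega> in P. eventually (\<lambda>n. \<omega> \<in> space P - ?E2 n) sequentially"
  proof (rule borel_cantelli_AE1)
    show "summable (\<lambda>n. prob (?E2 n))"
      by (rule summable_comparison_test'[OF dsum, of 0]) (simp add: less_imp_le[OF Xp])
    show "emeasure P (?E2 n) < \<infinity>" for n by (simp add: less_top[symmetric])
  qed measurable
  from ae1 ae2 have "AE \<omega> in P. \<exists>N. \<forall>n\<ge>N. \<omega> \<notin> ?E1 n \<and> \<omega> \<notin> ?E2 n"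
  proof eventually_elim
    case (elim \<omega>)
    then have "eventually (\<lambda>n. \<omega> \<notin> ?E1 n \<and> \<omega> \<notin> ?E2 n) sequentially"
      by eventually_elim blast
    then show ?case unfolding eventually_sequentially .
  qed
  then have null: "{\<omega>\<in>space P. \<not> (\<exists>N. \<forall>n\<ge>N. \<omega> \<notin> ?E1 n \<and> \<omega> \<notin> ?E2 n)} \<in> null_sets P" (is "?N \<in> _")
    unfolding AE_iff_null_sets .
  \<comment> \<open>The infimum over the tail makes the sequence increase, and the minimum with
    \<open>T\<close> keeps it from running past the section. On the exceptional null set
    \<open>Q n\<close> does the same work.\<close>
  define \<rho> where "\<rho> n \<omega> = (if \<omega> \<in> ?N then ennreal (Q n \<omega>) else min (INF j\<in>{n..}. \<sigma> j \<omega>) (T \<omega>))" for n \<omega>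
  have "stopping P F (\<lambda>\<omega>. min (INF j\<in>{n..}. \<sigma> j \<omega>) (T \<omega>))" for n
  proof -
    have "stopping P F (\<lambda>\<omega>. INF j\<in>{n..}. \<sigma> j \<omega>)"
    proof (rule stopping_from_less)
      fix t :: real assume t: "0 \<le> t"
      have "{\<omega>\<in>space P. (INF j\<in>{n..}. \<sigma> j \<omega>) < ennreal t} = (\<Union>j\<in>{n..}. {\<omega>\<in>space P. \<sigma> j \<omega> < ennreal t})"
        by (auto simp: INF_less_iff)
      also have "\<dots> \<in> sets (F t)" using \<sigma>_less[OF t] by (intro sets.countable_UN') auto
      finally show "{\<omega>\<in>space P. (INF j\<in>{n..}. \<sigma> j \<omega>) < ennreal t} \<in> sets (F t)" .
    qed
    with T show ?thesis unfolding stopping_def by (intro stopping_time_min)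
  qed
  then have st: "stopping P F (\<rho> n)" for n
    by (rule stopping_modification[OF _ null]) (auto simp: \<rho>_def)
  have mono: "mono_on {1..} (\<lambda>n. \<rho> n \<omega>)" if "\<omega> \<in> space P" for \<omega>
  proof (rule mono_onI)
    fix m n :: nat assume "m \<le> n"
    then have "(INF j\<in>{m..}. \<sigma> j \<omega>) \<le> (INF j\<in>{n..}. \<sigma> j \<omega>)" by (intro INF_superset_mono) auto
    moreover have "Q m \<omega> \<le> Q n \<omega>" using Qmono[OF that] \<open>m \<le> n\<close> by (rule monoD)
    ultimately show "\<rho> m \<omega> \<le> \<rho> n \<omega>"
      unfolding \<rho>_def by (cases "\<omega> \<in> ?N") (simp_all only: if_True if_False ennreal_leI min.mono order_refl)
  qed
  have \<rho>B: "(\<omega>, t) \<in> B \<longleftrightarrow> 0 \<le> t \<and> (\<exists>n\<ge>1. ennreal t \<le> \<rho> n \<omega>)" if \<omega>: "\<omega> \<in> space P" for \<omega> t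
  proof (cases "\<omega> \<in> ?N")
    case True
    have "(\<exists>n. t \<le> Q n \<omega>) \<longleftrightarrow> (\<exists>n\<ge>1. t \<le> Q n \<omega>)"
    proof
      assume "\<exists>n. t \<le> Q n \<omega>"
      then obtain n where "t \<le> Q n \<omega>" ..
      also have "\<dots> \<le> Q (Suc n) \<omega>" using Qmono[OF \<omega>] by (rule monoD) simp
      finally show "\<exists>n\<ge>1. t \<le> Q n \<omega>" by (intro exI[of _ "Suc n"]) simp
    qed blast
    then show ?thesis using QB[OF \<omega>, of t] True Q0 unfolding \<rho>_def by (simp cong: conj_cong)
  next
    case False
    then obtain N where N1: "\<And>n. N \<le> n \<Longrightarrow> \<omega> \<notin> ?E1 n" and N2: "\<And>n. N \<le> n \<Longrightarrow> \<omega> \<notin> ?E2 n"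
      using \<omega> by blast
    have \<sigma>Q: "ennreal (Q n \<omega>) \<le> \<sigma> n \<omega>" if "N \<le> n" for n
      using N1[OF that] \<omega> by auto
    have \<rho>: "\<rho> n \<omega> = min (INF j\<in>{n..}. \<sigma> j \<omega>) (T \<omega>)" for n
      using False unfolding \<rho>_def by (simp only: if_False)
    show ?thesis
    proof (intro iffI conjI)
      assume tB: "(\<omega>, t) \<in> B"
      then show "0 \<le> t" using b_ge[OF \<omega>] by blast
      obtain n where n: "t \<le> Q n \<omega>" using QB[OF \<omega>] tB by blast
      \<comment> \<open>Past \<open>n\<close>, so that \<open>Q j\<close> exceeds \<open>t\<close>;
        past \<open>N\<close>, so that \<open>Q j\<close> bounds \<open>\<sigma> j\<close> from
        below; and at least 1, where the sequence starts.\<close>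
      let ?m = "max (max n N) 1"
      have "ennreal t \<le> \<sigma> j \<omega>" if "?m \<le> j" for j
      proof -
        have "t \<le> Q j \<omega>" using n monoD[OF Qmono[OF \<omega>], of n j] that by simp
        then have "ennreal t \<le> ennreal (Q j \<omega>)" by (rule ennreal_leI)
        also have "\<dots> \<le> \<sigma> j \<omega>" using that by (intro \<sigma>Q) simp
        finally show ?thesis .
      qed
      then have "ennreal t \<le> \<rho> ?m \<omega>"
        unfolding \<rho> using b_ge[OF \<omega> tB] by (auto intro!: INF_greatest)
      then show "\<exists>n\<ge>1. ennreal t \<le> \<rho> n \<omega>" by (intro exI[of _ ?m]) simp
    next
      assume "0 \<le> t \<and> (\<exists>n\<ge>1. ennreal t \<le> \<rho> n \<omega>)"
      then obtain n where t: "0 \<le> t" and "ennreal t \<le> \<rho> n \<omega>" by blast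
      then have tT: "ennreal t \<le> T \<omega>" and tI: "ennreal t \<le> (INF j\<in>{n..}. \<sigma> j \<omega>)" unfolding \<rho> by auto
      show "(\<omega>, t) \<in> B"
      proof (cases "ennreal t < T \<omega>")
        case True
        then show ?thesis by (rule b_lt[OF \<omega> t])
      next
        case False
        then have Teq: "T \<omega> = ennreal t" using tT by simp
        then have \<tau>t: "\<tau> \<omega> = t" using t unfolding \<tau>_def by simp
        show ?thesis
        proof (rule ccontr)
          \<comment> \<open>Here \<open>t\<close> is a missing end point. For an index
            \<open>?j\<close> beyond \<open>N\<close> the process vanishes at \<open>t\<close>, so
            by continuity it lies below its level at some earlier time, which exists because
            \<open>t\<close> is positive. Then \<open>\<sigma> ?j\<close> is less than
            \<open>t\<close>, against the infimum.\<close>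
          assume nB: "(\<omega>, t) \<notin> B"
          let ?j = "max n N"
          have t0: "0 < t" using out[OF \<omega>] nB \<tau>t t unfolding \<tau>_def[symmetric] Teq by simp
          have "X ?j \<omega> t = 0" using N2[of ?j] \<omega> nB \<tau>t by simp
          have "continuous (at t within {0..}) (X ?j \<omega>)"
            using test_processD(1)[OF Xt \<omega>, of ?j] t by (simp add: continuous_on_eq_continuous_within)
          then have "(X ?j \<omega> \<longlongrightarrow> 0) (at t within {0..})"
            using \<open>X ?j \<omega> t = 0\<close> by (simp add: continuous_within)
          moreover have "at t within {0..<t} \<le> at t within {0..}" by (rule at_le) auto
          ultimately have "(X ?j \<omega> \<longlongrightarrow> 0) (at t within {0..<t})" by (rule tendsto_mono[rotated])
          then have ev: "eventually (\<lambda>u. X ?j \<omega> u < e ?j) (at t within {0..<t})"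
            using e by (intro order_tendstoD(2)) auto
          have "eventually (\<lambda>u. u \<in> {0..<t}) (at t within {0..<t})"
            by (simp add: eventually_at_topological) blast
          with ev have "eventually (\<lambda>u. X ?j \<omega> u < e ?j \<and> u \<in> {0..<t}) (at t within {0..<t})"
            by (rule eventually_conj)
          moreover have "at t within {0..<t} \<noteq> bot"
            using t0 by (simp add: trivial_limit_within)
          ultimately obtain u where "X ?j \<omega> u < e ?j" "0 \<le> u" "u < t"
            using eventually_happens by (metis (no_types, lifting) atLeastLessThan_iff)
          then have "\<sigma> ?j \<omega> < ennreal t" unfolding \<sigma>_def hitting_less_iff by blast
          moreover have "ennreal t \<le> \<sigma> ?j \<omega>" using tI by (rule order_trans) (auto intro: INF_lower)
          ultimately show False by simp
        qed
      qed
    qed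
  qed
  have "B = (\<Union>n\<in>{1..}. sint_cc P (\<lambda>_. 0) (\<rho> n))"
  proof (intro set_eqI, clarify)
    fix \<omega> t
    show "(\<omega>, t) \<in> B \<longleftrightarrow> (\<omega>, t) \<in> (\<Union>n\<in>{1..}. sint_cc P (\<lambda>_. 0) (\<rho> n))"
    proof (cases "\<omega> \<in> space P")
      case True
      then show ?thesis unfolding \<rho>B[OF True] sint_cc_def by auto
    next
      case False
      then show ?thesis using predictable_subset[OF Bp] unfolding sint_cc_def by auto
    qed
  qed
  with st mono have "fundamental_seq P F B \<rho>"
    unfolding fundamental_seq_def by blast
  then show thesis by (rule that)
qed

end

section \<open>The integral on a predictable set of interval type\<close>

lemma stopped_eq:
  assumes "\<omega> \<in> space P" "0 \<le> t"
  shows "stopped P X \<tau> (\<omega>, t) = X (\<omega>, if ennreal t \<le> \<tau> \<omega> then t else enn2real (\<tau> \<omega>))"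
  using assms by (auto simp: stopped_def cut_def sint_cc_def sint_oo_def)

text \<open>A time outside \<open>B\<close> exceeds every member of the sequence, and a time beyond
  the supremum is outside \<open>B\<close>. The shift by \<open>Suc\<close> skips the index 0, whose
  value is arbitrary.\<close>

lemma fundamental_seq_tendsto_debut:
  assumes \<tau>: "fundamental_seq P F B \<tau>" and \<omega>: "\<omega> \<in> space P"
  shows "(\<lambda>n. \<tau> n \<omega>) \<longlonglongrightarrow> debut_compl B \<omega>"
proof -
  have B: "(\<omega>, t) \<in> B \<longleftrightarrow> (\<exists>n. ennreal t \<le> \<tau> (Suc n) \<omega>)" if "0 \<le> t" for t
  proof -
    have "B = (\<Union>n\<in>{1..}. sint_cc P (\<lambda>_. 0) (\<tau> n))" using \<tau> unfolding fundamental_seq_def by simp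
    then have "(\<omega>, t) \<in> B \<longleftrightarrow> (\<exists>n\<ge>1. ennreal t \<le> \<tau> n \<omega>)"
      using \<omega> that by (auto simp: sint_cc_def)
    also have "\<dots> \<longleftrightarrow> (\<exists>n. ennreal t \<le> \<tau> (Suc n) \<omega>)"
      by (metis One_nat_def Suc_le_D Suc_le_mono zero_le)
    finally show ?thesis .
  qed
  have inc: "incseq (\<lambda>n. \<tau> (Suc n) \<omega>)"
  proof (rule incseq_SucI)
    fix n
    have "mono_on {1..} (\<lambda>n. \<tau> n \<omega>)" using \<tau> \<omega> unfolding fundamental_seq_def by blast
    then show "\<tau> (Suc n) \<omega> \<le> \<tau> (Suc (Suc n)) \<omega>" by (rule mono_onD) auto
  qed
  have "(SUP n. \<tau> (Suc n) \<omega>) = debut_compl B \<omega>"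
  proof (rule antisym)
    show "(SUP n. \<tau> (Suc n) \<omega>) \<le> debut_compl B \<omega>"
      unfolding debut_compl_def
    proof (rule INF_greatest)
      fix t assume t: "t \<in> {t. 0 \<le> t \<and> (\<omega>, t) \<notin> B}"
      then have "\<not> ennreal t \<le> \<tau> (Suc n) \<omega>" for n using B[of t] by blast
      then show "(SUP n. \<tau> (Suc n) \<omega>) \<le> ennreal t" by (intro SUP_least) (simp add: not_le less_imp_le)
    qed
    show "debut_compl B \<omega> \<le> (SUP n. \<tau> (Suc n) \<omega>)"
    proof (rule ccontr)
      assume "\<not> ?thesis"
      then obtain x where x: "(SUP n. \<tau> (Suc n) \<omega>) < x" "x < debut_compl B \<omega>"
        using dense[of "SUP n. \<tau> (Suc n) \<omega>" "debut_compl B \<omega>"] by (auto simp: not_le)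
      then have "x \<noteq> \<top>" using top_greatest[of "debut_compl B \<omega>"] by auto
      then obtain t where t: "x = ennreal t" "0 \<le> t" by (cases x) auto
      have "(\<omega>, t) \<notin> B"
      proof
        assume "(\<omega>, t) \<in> B"
        then obtain n where "ennreal t \<le> \<tau> (Suc n) \<omega>" using B t by blast
        also have "\<dots> \<le> (SUP n. \<tau> (Suc n) \<omega>)" by (rule SUP_upper) simp
        finally show False using x(1) t(1) by simp
      qed
      then have "debut_compl B \<omega> \<le> ennreal t"
        unfolding debut_compl_def using t by (intro INF_lower) simp
      then show False using x(2) t(1) by simp
    qed
  qed
  then have "(\<lambda>n. \<tau> (Suc n) \<omega>) \<longlonglongrightarrow> debut_compl B \<omega>"
    using LIMSEQ_SUP[OF inc] by simp
  then show ?thesis by (rule LIMSEQ_imp_Suc)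
qed

text \<open>For \<open>t > 0\<close> exactly one left-open interval contains \<open>t\<close>, the
  one ending at the first \<open>T N\<close> that reaches \<open>t\<close>; if \<open>N\<close> is 1
  its left end is 0 by convention. At \<open>t = 0\<close> all of them miss and the initial term
  remains.\<close>

lemma pasted_eqI:
  assumes tB: "\<omega> \<in> space P" "0 \<le> t" "(\<omega>, t) \<in> B"
    and mono: "mono_on {1..} (\<lambda>n. T n \<omega>)"
    and cover: "\<exists>n\<ge>1. ennreal t \<le> T n \<omega>"
    and Xs: "\<And>n. 1 \<le> n \<Longrightarrow> ennreal t \<le> T n \<omega> \<Longrightarrow> Xs n (\<omega>, t) = c"
    and zero: "t = 0 \<Longrightarrow> H (\<omega>, 0) * A (\<omega>, 0) = c"
  shows "pasted P B H A T Xs (\<omega>, t) = c"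
proof -
  let ?T = "T(0 := \<lambda>_. 0)"
  let ?X = "\<lambda>n. cut (Xs (Suc n)) (sint_oc P (?T n) (?T (Suc n))) (\<omega>, t)"
  have eq: "pasted P B H A T Xs (\<omega>, t) =
    cut (\<lambda>(\<omega>, _). H (\<omega>, 0) * A (\<omega>, 0)) (sint_cc P (\<lambda>_. 0) (\<lambda>_. 0)) (\<omega>, t) + (\<Sum>n. ?X n)"
    using tB(3) unfolding pasted_def Let_def by simp
  show ?thesis
  proof (cases "t = 0")
    case True
    then have "?X n = 0" for n by (simp add: cut_def sint_oc_def)
    then show ?thesis
      unfolding eq using True tB zero by (simp add: cut_def sint_cc_def)
  next
    case False
    define N where "N = (LEAST n. 1 \<le> n \<and> ennreal t \<le> T n \<omega>)"
    have N: "1 \<le> N \<and> ennreal t \<le> T N \<omega>"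
      unfolding N_def using cover by (rule LeastI_ex)
    have less: "T n \<omega> < ennreal t" if "1 \<le> n" "n < N" for n
      using not_less_Least[of n "\<lambda>n. 1 \<le> n \<and> ennreal t \<le> T n \<omega>"] that unfolding N_def by (simp add: not_le)
    have ge: "ennreal t \<le> T n \<omega>" if "N \<le> n" for n
      using mono_onD[OF mono, of N n] N that by (auto intro: order_trans)
    obtain m where m: "N = Suc m" using N by (cases N) auto
    have "?X n = (if n = m then c else 0)" for n
    proof -
      have "(\<omega>, t) \<in> sint_oc P (?T n) (?T (Suc n)) \<longleftrightarrow> n = m"
      proof
        assume *: "(\<omega>, t) \<in> sint_oc P (?T n) (?T (Suc n))"
        then have "ennreal t \<le> T (Suc n) \<omega>" by (simp add: sint_oc_def)
        then have "m \<le> n" using less[of "Suc n"] m by (force simp: not_less)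
        moreover have "n \<le> m"
        proof (rule ccontr)
          assume "\<not> n \<le> m"
          then have "ennreal t \<le> T n \<omega>" "n \<noteq> 0" using ge[of n] m by auto
          moreover from this(2) have "T n \<omega> < ennreal t" using * by (simp add: sint_oc_def)
          ultimately show False by simp
        qed
        ultimately show "n = m" by simp
      next
        assume "n = m"
        moreover have "?T m \<omega> < ennreal t"
          using less[of m] m False tB(2) by (cases "m = 0") auto
        ultimately show "(\<omega>, t) \<in> sint_oc P (?T n) (?T (Suc n))"
          using N m tB by (simp add: sint_oc_def)
      qed
      then show ?thesis using Xs[of "Suc m"] N m by (simp add: cut_def)
    qed
    then have "(\<Sum>n. ?X n) = c"
      using sums_unique[OF sums_single[of m "\<lambda>_. c"]] by simp
    moreover have "(\<omega>, t) \<notin> sint_cc P (\<lambda>_. 0) (\<lambda>_. 0)"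
      using False tB(2) by (simp add: sint_cc_def)
    ultimately show ?thesis unfolding eq by (simp add: cut_def)
  qed
qed

lemma path_integrable_zero:
  assumes "fv_path a t" "\<And>s. 0 \<le> s \<Longrightarrow> s \<le> t \<Longrightarrow> h s = 0"
  shows "path_integrable h a t"
proof -
  have "(\<lambda>s. indicator {0..t} s *\<^sub>R h s) = (\<lambda>_. 0)"
    using assms(2) by (auto simp: fun_eq_iff indicator_def)
  then show ?thesis using assms(1) unfolding path_integrable_def set_integrable_def by simp
qed

lemma stieltjes_fv_processes:
  assumes H: "H \<in> measurable_processes P" and A: "A \<in> fv_processes P" and HA: "integrable_wrt P H A"
  shows "stieltjes H A \<in> fv_processes P"
  unfolding fv_processes_def process_def
proof (intro CollectI conjI allI impI ballI)
  fix t :: real assume t: "0 \<le> t"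
  show "(\<lambda>\<omega>. stieltjes H A (\<omega>, t)) \<in> borel_measurable P"
    unfolding stieltjes_def
    using borel_measurable_path_integral[OF H A t] HA t by (simp add: integrable_wrt_def)
  show "fv_path (\<lambda>s. stieltjes H A (\<omega>, s)) t" if "\<omega> \<in> space P" for \<omega>
    unfolding stieltjes_def using HA that t fv_path_path_integral by (simp add: integrable_wrt_def)
qed

context usual_filtered_prob_space
begin

lemma borel_measurable_AE_eq:
  fixes f g :: "'a \<Rightarrow> real"
  assumes f: "f \<in> borel_measurable P" and ae: "AE \<omega> in P. f \<omega> = g \<omega>"
  shows "g \<in> borel_measurable P"
proof (rule measurableI)
  fix S :: "real set" assume S: "S \<in> sets borel"
  show "g -` S \<inter> space P \<in> sets P"
  proof (rule in_sets_AE)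
    show "AE \<omega> in P. \<omega> \<in> f -` S \<inter> space P \<longleftrightarrow> \<omega> \<in> g -` S \<inter> space P"
      using ae by eventually_elim simp
    show "f -` S \<inter> space P \<in> sets P" using f S by (rule measurable_sets)
  qed simp
qed simp

section \<open>Coupled sequences on a fixed predictable set of interval type\<close>

context
  fixes B
  assumes B: "psit P F B"
begin

lemma psit_predictable: "B \<in> sets (predictable_sigma P F)"
  using B[unfolded psit_def] by (rule conjunct1)

lemma psit_down:
  assumes "(\<omega>, t) \<in> B"
  shows "\<omega> \<in> space P" "0 \<le> t" "0 \<le> s \<Longrightarrow> s \<le> t \<Longrightarrow> (\<omega>, s) \<in> B"
proof -
  have "(\<omega>, t) \<in> space P \<times> {0..}" using predictable_subset[OF psit_predictable] assms by blast
  then show \<omega>: "\<omega> \<in> space P" and "0 \<le> t" by auto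
  obtain \<tau> where "fundamental_seq P F B \<tau>" by (rule psit_fundamental_seq[OF B])
  then have eq: "B = (\<Union>n\<in>{1..}. sint_cc P (\<lambda>_. 0) (\<tau> n))" unfolding fundamental_seq_def by simp
  show "(\<omega>, s) \<in> B" if "0 \<le> s" "s \<le> t"
  proof -
    obtain n where n: "1 \<le> n" "ennreal t \<le> \<tau> n \<omega>"
      using assms unfolding eq by (auto simp: sint_cc_def)
    have "ennreal s \<le> \<tau> n \<omega>" using ennreal_leI[OF that(2)] n(2) by (rule order_trans)
    then show ?thesis unfolding eq using n(1) \<omega> that(1) by (auto simp: sint_cc_def)
  qed
qed

lemma psit_section_measurable: "0 \<le> t \<Longrightarrow> {\<omega>\<in>space P. (\<omega>, t) \<in> B} \<in> sets P"
  using predictable_section[OF psit_predictable] sets_F_real_P by blast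

lemma psit_measurable: "Measurable.pred (P \<Otimes>\<^sub>M restrict_space borel {0..}) (\<lambda>z. z \<in> B)"
proof -
  have i: "(\<lambda>s. s) \<in> restrict_space borel {0::real..} \<rightarrow>\<^sub>M borel"
    by (rule measurable_restrict_space1) simp
  have "(\<lambda>z. (fst z, snd z)) \<in> P \<Otimes>\<^sub>M restrict_space borel {0::real..} \<rightarrow>\<^sub>M P \<Otimes>\<^sub>M borel"
    by (intro measurable_Pair measurable_fst measurable_compose[OF measurable_snd i])
  from measurable_sets[OF this predictable_product_measurable[OF psit_predictable]]
  show ?thesis unfolding pred_def by (simp add: vimage_def Int_def conj_commute)
qed

text \<open>Each index comes with its own null set; countably many of them merge into one that
  serves all indices and times.\<close>

lemma coupled_seq_agree:
  assumes X: "coupled_seq P F B X T Xs"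
  shows "AE \<omega> in P. \<forall>n\<ge>1. \<forall>t. (\<omega>, t) \<in> B \<longrightarrow> ennreal t \<le> T n \<omega> \<longrightarrow> X (\<omega>, t) = Xs n (\<omega>, t)"
proof -
  have "AE \<omega> in P. \<forall>t\<ge>0. cut X (B \<inter> sint_cc P (\<lambda>_. 0) (T n)) (\<omega>, t) =
      cut (Xs n) (B \<inter> sint_cc P (\<lambda>_. 0) (T n)) (\<omega>, t)" if "1 \<le> n" for n
    using X that unfolding coupled_seq_def indist_def by blast
  then have "AE \<omega> in P. \<forall>n. 1 \<le> n \<longrightarrow> (\<forall>t\<ge>0. cut X (B \<inter> sint_cc P (\<lambda>_. 0) (T n)) (\<omega>, t) =
      cut (Xs n) (B \<inter> sint_cc P (\<lambda>_. 0) (T n)) (\<omega>, t))"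
    unfolding AE_all_countable by (auto intro: AE_impI)
  then show ?thesis
  proof eventually_elim
    case (elim \<omega>)
    show ?case
    proof (intro allI impI)
      fix n t assume n: "1 \<le> n" and t: "(\<omega>, t) \<in> B" "ennreal t \<le> T n \<omega>"
      then have "(\<omega>, t) \<in> B \<inter> sint_cc P (\<lambda>_. 0) (T n)"
        using psit_down(1,2)[OF t(1)] by (simp add: sint_cc_def)
      then show "X (\<omega>, t) = Xs n (\<omega>, t)"
        using elim[rule_format, OF n psit_down(2)[OF t(1)]] by (simp add: cut_def)
    qed
  qed
qed

lemma coupled_seqD:
  assumes X: "coupled_seq P F B X T Xs"
  shows "1 \<le> n \<Longrightarrow> stopping P F (T n)" "\<omega> \<in> space P \<Longrightarrow> mono_on {1..} (\<lambda>n. T n \<omega>)"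
    "\<omega> \<in> space P \<Longrightarrow> (\<lambda>n. T n \<omega>) \<longlonglongrightarrow> debut_compl B \<omega>"
    "(\<omega>, t) \<in> B \<Longrightarrow> \<exists>n\<ge>1. ennreal t \<le> T n \<omega>" "1 \<le> n \<Longrightarrow> process P (Xs n)"
proof -
  show "\<exists>n\<ge>1. ennreal t \<le> T n \<omega>" if "(\<omega>, t) \<in> B"
  proof -
    have "(\<omega>, t) \<in> (\<Union>n\<in>{1..}. sint_cc P (\<lambda>_. 0) (T n))"
      using X that unfolding coupled_seq_def by blast
    then show ?thesis by (auto simp: sint_cc_def)
  qed
qed (use X[unfolded coupled_seq_def] in blast)+

lemma coupled_seqI:
  assumes "\<And>n. 1 \<le> n \<Longrightarrow> stopping P F (T n)" "\<And>\<omega>. \<omega> \<in> space P \<Longrightarrow> mono_on {1..} (\<lambda>n. T n \<omega>)"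
    "\<And>\<omega>. \<omega> \<in> space P \<Longrightarrow> (\<lambda>n. T n \<omega>) \<longlonglongrightarrow> debut_compl B \<omega>"
    "\<And>\<omega> t. (\<omega>, t) \<in> B \<Longrightarrow> \<exists>n\<ge>1. ennreal t \<le> T n \<omega>" "\<And>n. 1 \<le> n \<Longrightarrow> process P (Xs n)"
    and ae: "AE \<omega> in P. \<forall>n\<ge>1. \<forall>t. (\<omega>, t) \<in> B \<longrightarrow> ennreal t \<le> T n \<omega> \<longrightarrow> X (\<omega>, t) = Xs n (\<omega>, t)"
  shows "coupled_seq P F B X T Xs"
  unfolding coupled_seq_def
proof (intro conjI allI impI ballI)
  show "B \<subseteq> (\<Union>n\<in>{1..}. sint_cc P (\<lambda>_. 0) (T n))"
  proof (intro subsetI)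
    fix z assume z: "z \<in> B"
    obtain \<omega> t where zz: "z = (\<omega>, t)" by (cases z)
    obtain n where "1 \<le> n" "ennreal t \<le> T n \<omega>" using assms(4) z zz by blast
    then show "z \<in> (\<Union>n\<in>{1..}. sint_cc P (\<lambda>_. 0) (T n))"
      using psit_down(1,2)[of \<omega> t] z zz by (auto simp: sint_cc_def)
  qed
  show "indist P (cut X (B \<inter> sint_cc P (\<lambda>_. 0) (T n))) (cut (Xs n) (B \<inter> sint_cc P (\<lambda>_. 0) (T n)))"
    if "1 \<le> n" for n
    unfolding indist_def using ae
  proof eventually_elim
    case (elim \<omega>)
    then show ?case using that by (auto simp: cut_def sint_cc_def)
  qed
qed (use assms(1-3,5) in blast)+

lemma coupled_seq_process_on:
  assumes X: "coupled_seq P F B X T Xs"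
  shows "process_on P B X"
  unfolding process_on_def process_def
proof (intro allI impI)
  fix t :: real assume t: "0 \<le> t"
  define N where "N \<omega> = (LEAST n. 1 \<le> n \<and> ennreal t \<le> T n \<omega>)" for \<omega>
  have le_T: "Measurable.pred P (\<lambda>\<omega>. 1 \<le> n \<and> ennreal t \<le> T n \<omega>)" for n
  proof (cases "1 \<le> n")
    case True
    then have [measurable]: "T n \<in> borel_measurable P"
      by (intro stopping_measurable coupled_seqD(1)[OF X])
    show ?thesis by measurable
  qed simp
  have Nm: "N \<in> P \<rightarrow>\<^sub>M count_space UNIV" unfolding N_def[abs_def] by (rule measurable_Least[OF le_T])
  have "(\<lambda>\<omega>. Xs (Suc n) (\<omega>, t)) \<in> borel_measurable P" for n
    using coupled_seqD(5)[OF X, of "Suc n"] t by (simp add: process_def)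
  \<comment> \<open>Off \<open>B\<close> the least index is unspecified and may be 0, where
    \<open>Xs\<close> is arbitrary; \<open>max n 1\<close> avoids this.\<close>
  then have Xm: "(\<lambda>\<omega>. Xs (max n 1) (\<omega>, t)) \<in> borel_measurable P" for n
    by (cases n) simp_all
  have [measurable]: "(\<lambda>\<omega>. Xs (max (N \<omega>) 1) (\<omega>, t)) \<in> borel_measurable P"
    by (rule measurable_compose_countable[OF Xm Nm])
  have [measurable]: "Measurable.pred P (\<lambda>\<omega>. (\<omega>, t) \<in> B)"
    using psit_section_measurable[OF t] unfolding pred_def .
  show "(\<lambda>\<omega>. cut X B (\<omega>, t)) \<in> borel_measurable P"
  proof (rule borel_measurable_AE_eq)
    show "(\<lambda>\<omega>. if (\<omega>, t) \<in> B then Xs (max (N \<omega>) 1) (\<omega>, t) else 0) \<in> borel_measurable P"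
      by measurable
    show "AE \<omega> in P. (if (\<omega>, t) \<in> B then Xs (max (N \<omega>) 1) (\<omega>, t) else 0) = cut X B (\<omega>, t)"
      using coupled_seq_agree[OF X]
    proof eventually_elim
      case (elim \<omega>)
      have "1 \<le> N \<omega> \<and> ennreal t \<le> T (N \<omega>) \<omega>" if "(\<omega>, t) \<in> B"
        unfolding N_def using coupled_seqD(4)[OF X that] by (rule LeastI_ex)
      then have "X (\<omega>, t) = Xs (N \<omega>) (\<omega>, t) \<and> max (N \<omega>) 1 = N \<omega>" if "(\<omega>, t) \<in> B"
        using elim that by (simp add: max_absorb1)
      then show ?case by (simp add: cut_def)
    qed
  qed
qed

lemma fcsI: "coupled_seq P F B X T Xs \<Longrightarrow> (\<And>n. 1 \<le> n \<Longrightarrow> Xs n \<in> D) \<Longrightarrow> fcs P F B D X T Xs"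
  unfolding fcs_def class_on_def using coupled_seq_process_on by blast

text \<open>The members of a coupled sequence are pasted jointly measurably by the first index whose
  time reaches \<open>t\<close>. Taking the value 0 on \<open>N\<close> keeps the modification
  integrable there against every path of finite variation.\<close>

lemma class_on_measurable_modification:
  assumes X: "X \<in> class_on P F B (measurable_processes P)"
  obtains K N where "K \<in> measurable_processes P" "N \<in> null_sets P"
    "\<And>\<omega> t. \<omega> \<in> space P - N \<Longrightarrow> (\<omega>, t) \<in> B \<Longrightarrow> K (\<omega>, t) = X (\<omega>, t)"
    "\<And>\<omega> t. \<omega> \<in> N \<Longrightarrow> K (\<omega>, t) = 0"
proof -
  let ?M = "P \<Otimes>\<^sub>M restrict_space borel {0::real..}"
  obtain T Xs where X: "coupled_seq P F B X T Xs" and Xs: "\<And>n. 1 \<le> n \<Longrightarrow> Xs n \<in> borel_measurable ?M"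
    using X unfolding class_on_def measurable_processes_def by blast
  have null: "{\<omega>\<in>space P. \<not> (\<forall>n\<ge>1. \<forall>t. (\<omega>, t) \<in> B \<longrightarrow> ennreal t \<le> T n \<omega> \<longrightarrow> X (\<omega>, t) = Xs n (\<omega>, t))} \<in> null_sets P"
    (is "?N \<in> _") using coupled_seq_agree[OF X] unfolding AE_iff_null_sets .
  define L where "L z = (LEAST n. 1 \<le> n \<and> ennreal (snd z) \<le> T n (fst z))" for z :: "'a \<times> real"
  have i: "(\<lambda>s. s) \<in> restrict_space borel {0::real..} \<rightarrow>\<^sub>M borel"
    by (rule measurable_restrict_space1) simp
  have [measurable]: "(\<lambda>z. snd z) \<in> ?M \<rightarrow>\<^sub>M borel"
    by (rule measurable_compose[OF measurable_snd i])
  have le_T: "Measurable.pred ?M (\<lambda>z. 1 \<le> n \<and> ennreal (snd z) \<le> T n (fst z))" for n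
  proof (cases "1 \<le> n")
    case True
    then have [measurable]: "T n \<in> borel_measurable P"
      by (intro stopping_measurable coupled_seqD(1)[OF X])
    show ?thesis by measurable
  qed simp
  have Lm: "L \<in> ?M \<rightarrow>\<^sub>M count_space UNIV" unfolding L_def[abs_def] by (rule measurable_Least[OF le_T])
  have "Xs (max n 1) \<in> borel_measurable ?M" for n by (rule Xs) simp
  then have [measurable]: "(\<lambda>z. Xs (max (L z) 1) z) \<in> borel_measurable ?M"
    by (rule measurable_compose_countable[OF _ Lm])
  note [measurable] = psit_measurable
  define N where "N = ?N"
  have N: "N \<in> null_sets P" using null unfolding N_def .
  then have [measurable]: "N \<in> sets P" by (rule null_setsD2)
  define K where "K z = (if z \<in> B \<and> fst z \<notin> N then Xs (max (L z) 1) z else 0)" for z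
  show thesis
  proof
    show "K \<in> measurable_processes P"
      unfolding measurable_processes_def K_def[abs_def] by measurable
    show "N \<in> null_sets P" by (rule N)
    show "K (\<omega>, t) = 0" if "\<omega> \<in> N" for \<omega> t
      unfolding K_def using that by simp
    fix \<omega> t assume \<omega>: "\<omega> \<in> space P - N" and t: "(\<omega>, t) \<in> B"
    have L: "1 \<le> L (\<omega>, t) \<and> ennreal t \<le> T (L (\<omega>, t)) \<omega>"
      unfolding L_def fst_conv snd_conv using coupled_seqD(4)[OF X t] by (rule LeastI_ex)
    then have "X (\<omega>, t) = Xs (L (\<omega>, t)) (\<omega>, t)" using \<omega> t unfolding N_def by blast
    moreover have "max (L (\<omega>, t)) 1 = L (\<omega>, t)" using L by simp
    ultimately show "K (\<omega>, t) = X (\<omega>, t)" unfolding K_def using \<omega> t by simp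
  qed
qed

text \<open>Compose a modification on \<open>B\<close> with the measurable time change
  \<open>?s\<close>, the smaller of the current time and \<open>\<tau>\<close>. Its values stay in
  the interval up to \<open>\<tau>\<close>, hence in \<open>B\<close>, where the modification is
  controlled.\<close>

lemma stopped_measurable_modification:
  assumes X: "X \<in> class_on P F B (measurable_processes P)"
    and \<tau>: "\<tau> \<in> borel_measurable P" "sint_cc P (\<lambda>_. 0) \<tau> \<subseteq> B"
  obtains K N where "K \<in> measurable_processes P" "N \<in> null_sets P"
    "\<And>\<omega> t. \<omega> \<in> space P - N \<Longrightarrow> 0 \<le> t \<Longrightarrow> K (\<omega>, t) = stopped P X \<tau> (\<omega>, t)"
    "\<And>\<omega> t. \<omega> \<in> N \<Longrightarrow> K (\<omega>, t) = 0"
proof -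
  let ?M = "P \<Otimes>\<^sub>M restrict_space borel {0::real..}"
  obtain K N where K: "K \<in> measurable_processes P" and N: "N \<in> null_sets P"
    and KX: "\<And>\<omega> t. \<omega> \<in> space P - N \<Longrightarrow> (\<omega>, t) \<in> B \<Longrightarrow> K (\<omega>, t) = X (\<omega>, t)"
    and K0: "\<And>\<omega> t. \<omega> \<in> N \<Longrightarrow> K (\<omega>, t) = 0"
    by (fact class_on_measurable_modification[OF X])
  let ?s = "\<lambda>z. if ennreal (snd z) \<le> \<tau> (fst z) then snd z else enn2real (\<tau> (fst z))"
  have i: "(\<lambda>s. s) \<in> restrict_space borel {0::real..} \<rightarrow>\<^sub>M borel"
    by (rule measurable_restrict_space1) simp
  note [measurable] = measurable_compose[OF measurable_snd i, of P] \<tau>(1)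
  have "?s \<in> ?M \<rightarrow>\<^sub>M restrict_space borel {0..}"
    by (rule measurable_restrict_space2) (auto simp: space_pair_measure space_restrict_space)
  then have "(\<lambda>z. (fst z, ?s z)) \<in> ?M \<rightarrow>\<^sub>M ?M" by (intro measurable_Pair measurable_fst)
  moreover have "K \<in> borel_measurable ?M" using K unfolding measurable_processes_def .
  ultimately have Km: "(\<lambda>z. K (fst z, ?s z)) \<in> measurable_processes P"
    unfolding measurable_processes_def by (rule measurable_compose)
  show thesis
  proof (rule that[OF Km N])
    fix \<omega> t assume \<omega>: "\<omega> \<in> space P - N" and t: "0 \<le> (t::real)"
    have "ennreal (enn2real (\<tau> \<omega>)) \<le> \<tau> \<omega>" by (cases "\<tau> \<omega>") auto
    then have "(\<omega>, ?s (\<omega>, t)) \<in> sint_cc P (\<lambda>_. 0) \<tau>"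
      using \<omega> t by (auto simp: sint_cc_def)
    then have "K (\<omega>, ?s (\<omega>, t)) = X (\<omega>, ?s (\<omega>, t))" using \<omega> \<tau>(2) by (intro KX) auto
    then show "K (fst (\<omega>, t), ?s (\<omega>, t)) = stopped P X \<tau> (\<omega>, t)"
      using \<omega> t by (simp add: stopped_eq)
  qed (simp add: K0)
qed

lemma class_on_mono: "D \<subseteq> E \<Longrightarrow> class_on P F B D \<subseteq> class_on P F B E"
  unfolding class_on_def by blast

section \<open>The integral on \<open>B\<close>, by coupled sequences and by stopping\<close>

context
  fixes H A
  assumes H: "H \<in> class_on P F B (measurable_processes P)"
    and A: "A \<in> class_on P F B (fv_processes P)"
    and HA: "integrable_on_wrt B H A"
begin

lemma path_integrable_on: "(\<omega>, t) \<in> B \<Longrightarrow> path_integrable (\<lambda>s. H (\<omega>, s)) (\<lambda>s. A (\<omega>, s)) t"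
  using HA unfolding integrable_on_wrt_def by auto

lemma stieltjes_on_eq:
  assumes "(\<omega>, t) \<in> B" "\<And>s. 0 \<le> s \<Longrightarrow> s \<le> t \<Longrightarrow> H (\<omega>, s) = H' (\<omega>, s)"
    "\<And>s. 0 \<le> s \<Longrightarrow> s \<le> t \<Longrightarrow> A (\<omega>, s) = A' (\<omega>, s)"
  shows "stieltjes_on B H A (\<omega>, t) = stieltjes H' A' (\<omega>, t)"
  using path_integral_cong(1)[of t "\<lambda>s. A (\<omega>, s)" "\<lambda>s. A' (\<omega>, s)" "\<lambda>s. H (\<omega>, s)" "\<lambda>s. H' (\<omega>, s)"]
    assms psit_down(2)[OF assms(1)] by (simp add: stieltjes_on_def stieltjes_def)

lemma eq_on_pasted:
  assumes mono: "\<And>\<omega>. \<omega> \<in> space P \<Longrightarrow> mono_on {1..} (\<lambda>n. T n \<omega>)"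
    and cover: "\<And>\<omega> t. (\<omega>, t) \<in> B \<Longrightarrow> \<exists>n\<ge>1. ennreal t \<le> T n \<omega>"
    and ae: "AE \<omega> in P. \<forall>n\<ge>1. \<forall>t. (\<omega>, t) \<in> B \<longrightarrow> ennreal t \<le> T n \<omega> \<longrightarrow>
      stieltjes_on B H A (\<omega>, t) = Xs n (\<omega>, t)"
  shows "eq_on P B (stieltjes_on B H A) (pasted P B H A T Xs)"
  unfolding eq_on_def indist_def using ae
proof eventually_elim
  case (elim \<omega>)
  have "pasted P B H A T Xs (\<omega>, t) = stieltjes_on B H A (\<omega>, t)" if t: "(\<omega>, t) \<in> B" for t
  proof (rule pasted_eqI[where T=T and Xs=Xs, OF psit_down(1,2)[OF t] t mono[OF psit_down(1)[OF t]] cover[OF t]])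
    show "Xs n (\<omega>, t) = stieltjes_on B H A (\<omega>, t)" if "1 \<le> n" "ennreal t \<le> T n \<omega>" for n
      using elim t that by simp
    show "H (\<omega>, 0) * A (\<omega>, 0) = stieltjes_on B H A (\<omega>, t)" if "t = 0"
      using path_integral_0[OF path_integrable_on] t that by (simp add: stieltjes_on_def)
  qed
  then show ?case by (simp add: cut_def)
qed

text \<open>The integral at \<open>t\<close> looks at both paths on the whole of
  \<open>{0..t}\<close>: these times all lie in \<open>B\<close> and below both localizing times.
  The minimum covers a common sequence as well as two different ones.\<close>

lemma coupled_agree:
  assumes H': "coupled_seq P F B H S Hs" and A': "coupled_seq P F B A S' As"
  shows "AE \<omega> in P. \<forall>n\<ge>1. \<forall>t. (\<omega>, t) \<in> B \<longrightarrow> ennreal t \<le> min (S n \<omega>) (S' n \<omega>) \<longrightarrow>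
      stieltjes_on B H A (\<omega>, t) = stieltjes (Hs n) (As n) (\<omega>, t)"
  using coupled_seq_agree[OF H'] coupled_seq_agree[OF A']
proof eventually_elim
  case (elim \<omega>)
  show ?case
  proof (intro allI impI)
    fix n t assume n: "1 \<le> n" and t: "(\<omega>, t) \<in> B" "ennreal t \<le> min (S n \<omega>) (S' n \<omega>)"
    have "(\<omega>, s) \<in> B \<and> ennreal s \<le> S n \<omega> \<and> ennreal s \<le> S' n \<omega>" if "0 \<le> s" "s \<le> t" for s
      using psit_down(3)[OF t(1) that] t(2) ennreal_leI[OF that(2)] by (auto intro: order_trans)
    then show "stieltjes_on B H A (\<omega>, t) = stieltjes (Hs n) (As n) (\<omega>, t)"
      using elim n by (intro stieltjes_on_eq[OF t(1)]) blast+
  qed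
qed

lemma fcs_stieltjes:
  assumes "fcs P F B (measurable_processes P) H T Hs" "fcs P F B (fv_processes P) A T As"
    and int: "\<And>n. 1 \<le> n \<Longrightarrow> integrable_wrt P (Hs n) (As n)"
  shows "fcs P F B (fv_processes P) (stieltjes_on B H A) T (\<lambda>n. stieltjes (Hs n) (As n))"
    and "eq_on P B (stieltjes_on B H A) (pasted P B H A T (\<lambda>n. stieltjes (Hs n) (As n)))"
proof -
  have H': "coupled_seq P F B H T Hs" and A': "coupled_seq P F B A T As"
    using assms(1,2) unfolding fcs_def by blast+
  have fv: "stieltjes (Hs n) (As n) \<in> fv_processes P" if "1 \<le> n" for n
    using assms(1,2) int[OF that] that unfolding fcs_def by (intro stieltjes_fv_processes) blast+
  note ae = coupled_agree[OF H' A', unfolded min.idem]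
  show "fcs P F B (fv_processes P) (stieltjes_on B H A) T (\<lambda>n. stieltjes (Hs n) (As n))"
  proof (rule fcsI[OF coupled_seqI])
    show "process P (stieltjes (Hs n) (As n))" if "1 \<le> n" for n
      using fv[OF that] unfolding fv_processes_def by blast
  qed (fact coupled_seqD[OF H'] ae fv)+
  show "eq_on P B (stieltjes_on B H A) (pasted P B H A T (\<lambda>n. stieltjes (Hs n) (As n)))"
    by (rule eq_on_pasted) (fact coupled_seqD[OF H'] ae)+
qed

lemma eq_on_pasted_min:
  assumes "fcs P F B (measurable_processes P) H S Hs" "fcs P F B (fv_processes P) A S' As"
  shows "eq_on P B (stieltjes_on B H A)
    (pasted P B H A (\<lambda>n \<omega>. min (S n \<omega>) (S' n \<omega>)) (\<lambda>n. stieltjes (Hs n) (As n)))"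
proof -
  have H': "coupled_seq P F B H S Hs" and A': "coupled_seq P F B A S' As"
    using assms unfolding fcs_def by blast+
  show ?thesis
  proof (rule eq_on_pasted)
    show "mono_on {1..} (\<lambda>n. min (S n \<omega>) (S' n \<omega>))" if "\<omega> \<in> space P" for \<omega>
    proof (rule mono_onI)
      fix m n :: nat assume "m \<in> {1..}" "n \<in> {1..}" "m \<le> n"
      then show "min (S m \<omega>) (S' m \<omega>) \<le> min (S n \<omega>) (S' n \<omega>)"
        using mono_onD[OF coupled_seqD(2)[OF H' that]] mono_onD[OF coupled_seqD(2)[OF A' that]]
        by (intro min.mono) auto
    qed
    show "\<exists>n\<ge>1. ennreal t \<le> min (S n \<omega>) (S' n \<omega>)" if t: "(\<omega>, t) \<in> B" for \<omega> t
    proof -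
      obtain m n where mn: "1 \<le> m" "ennreal t \<le> S m \<omega>" "1 \<le> n" "ennreal t \<le> S' n \<omega>"
        using coupled_seqD(4)[OF H' t] coupled_seqD(4)[OF A' t] by blast
      have "S m \<omega> \<le> S (max m n) \<omega>"
        using mn by (intro mono_onD[OF coupled_seqD(2)[OF H' psit_down(1)[OF t]]]) auto
      moreover have "S' n \<omega> \<le> S' (max m n) \<omega>"
        using mn by (intro mono_onD[OF coupled_seqD(2)[OF A' psit_down(1)[OF t]]]) auto
      ultimately show ?thesis using mn by (intro exI[of _ "max m n"]) (auto intro: order_trans)
    qed
  qed (fact coupled_agree[OF H' A'])
qed

text \<open>Since the interval up to \<open>\<tau>\<close> lies in \<open>B\<close>, the stopped
  paths are integrable at every sample point and every time. Only the measurability of the integral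
  takes a detour through a modification \<open>K\<close> of the stopped integrand.\<close>

lemma stopped_stieltjes:
  assumes \<tau>: "stopping P F \<tau>" "sint_cc P (\<lambda>_. 0) \<tau> \<subseteq> B"
  shows "\<exists>K\<in>measurable_processes P. indist P K (stopped P H \<tau>)"
    and "stopped P A \<tau> \<in> fv_processes P"
    and "integrable_wrt P (stopped P H \<tau>) (stopped P A \<tau>)"
    and "stieltjes (stopped P H \<tau>) (stopped P A \<tau>) \<in> fv_processes P"
    and "(\<omega>, t) \<in> B \<Longrightarrow> ennreal t \<le> \<tau> \<omega> \<Longrightarrow>
      stieltjes_on B H A (\<omega>, t) = stieltjes (stopped P H \<tau>) (stopped P A \<tau>) (\<omega>, t)"
proof -
  let ?H = "stopped P H \<tau>" and ?A = "stopped P A \<tau>"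
  have \<tau>m: "\<tau> \<in> borel_measurable P" by (rule stopping_measurable[OF \<tau>(1)])
  have \<tau>B: "(\<omega>, t) \<in> B" if "\<omega> \<in> space P" "0 \<le> t" "ennreal t \<le> \<tau> \<omega>" for \<omega> t
    using \<tau>(2) that by (auto simp: sint_cc_def)
  have int: "path_integrable (\<lambda>s. ?H (\<omega>, s)) (\<lambda>s. ?A (\<omega>, s)) t" if \<omega>: "\<omega> \<in> space P" and t: "0 \<le> t" for \<omega> t
  proof (cases "ennreal t \<le> \<tau> \<omega>")
    case True
    have "?H (\<omega>, s) = H (\<omega>, s) \<and> ?A (\<omega>, s) = A (\<omega>, s)" if "0 \<le> s" "s \<le> t" for s
      using that \<omega> ennreal_leI[OF that(2)] order_trans[OF _ True] by (simp add: stopped_eq)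
    then show ?thesis
      using path_integral_cong(2)[of t "\<lambda>s. ?A (\<omega>, s)" "\<lambda>s. A (\<omega>, s)" "\<lambda>s. ?H (\<omega>, s)" "\<lambda>s. H (\<omega>, s)"]
        path_integrable_on[OF \<tau>B[OF \<omega> t True]] t by simp
  next
    \<comment> \<open>Here \<open>\<tau> \<omega>\<close> is a finite time \<open>u\<close> before
      \<open>t\<close>, after which both stopped paths are constant; integrability up to
      \<open>u\<close>, inside \<open>B\<close>, therefore suffices.\<close>
    case False
    define u where "u = enn2real (\<tau> \<omega>)"
    have "\<tau> \<omega> < ennreal t" using False by simp
    then have "\<tau> \<omega> < \<top>" using ennreal_less_top by (rule less_trans)
    then have u: "\<tau> \<omega> = ennreal u" "0 \<le> u" unfolding u_def by simp_all
    have ut: "u \<le> t" using False u t by simp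
    have "stopped P X \<tau> (\<omega>, s) = X (\<omega>, min s u)" if "0 \<le> s" for s X
      using that u \<omega> by (auto simp: stopped_eq min_def)
    then show ?thesis
      using path_integral_cong(2)[of t "\<lambda>s. ?A (\<omega>, s)" "\<lambda>s. A (\<omega>, min s u)" "\<lambda>s. ?H (\<omega>, s)" "\<lambda>s. H (\<omega>, min s u)"]
        path_stopped(1)[OF path_integrable_on[OF \<tau>B[OF \<omega> u(2)]] u(2) ut] t u by simp
  qed
  then show intw: "integrable_wrt P ?H ?A" unfolding integrable_wrt_def by blast
  obtain K N where K: "K \<in> measurable_processes P" and N: "N \<in> null_sets P"
    and KH: "\<And>\<omega> t. \<omega> \<in> space P - N \<Longrightarrow> 0 \<le> t \<Longrightarrow> K (\<omega>, t) = ?H (\<omega>, t)"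
    and K0: "\<And>\<omega> t. \<omega> \<in> N \<Longrightarrow> K (\<omega>, t) = 0"
    by (fact stopped_measurable_modification[OF H \<tau>m \<tau>(2)])
  have aeN: "AE \<omega> in P. \<omega> \<in> space P - N"
    using AE_not_in[OF N] AE_space by eventually_elim simp
  show "\<exists>K\<in>measurable_processes P. indist P K ?H"
  proof (rule bexI[OF _ K])
    show "indist P K ?H" unfolding indist_def using aeN by eventually_elim (simp add: KH)
  qed
  \<comment> \<open>Paths of finite variation are right continuous, so \<open>A\<close> also has a
    jointly measurable modification. It is used to evaluate \<open>A\<close> measurably at the
    random time \<open>\<tau>\<close>.\<close>
  have A': "A \<in> class_on P F B (measurable_processes P)"
    using A class_on_mono[OF fv_processes_subset_measurable] by blast
  obtain L M where L: "L \<in> measurable_processes P" and M: "M \<in> null_sets P"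
    and LA: "\<And>\<omega> t. \<omega> \<in> space P - M \<Longrightarrow> 0 \<le> t \<Longrightarrow> L (\<omega>, t) = ?A (\<omega>, t)"
    and L0: "\<And>\<omega> t. \<omega> \<in> M \<Longrightarrow> L (\<omega>, t) = 0"
    by (fact stopped_measurable_modification[OF A' \<tau>m \<tau>(2)])
  have aeM: "AE \<omega> in P. \<omega> \<in> space P - M"
    using AE_not_in[OF M] AE_space by eventually_elim simp
  show Afv: "?A \<in> fv_processes P"
    unfolding fv_processes_def process_def
  proof (intro CollectI conjI allI impI ballI)
    fix t :: real assume t: "0 \<le> t"
    have "(\<lambda>\<omega>. (\<omega>, t)) \<in> P \<rightarrow>\<^sub>M P \<Otimes>\<^sub>M restrict_space borel {0..}"
      using t by (intro measurable_Pair measurable_ident_sets refl measurable_const) (simp add: space_restrict_space)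
    from measurable_compose[OF this L[unfolded measurable_processes_def]]
    show "(\<lambda>\<omega>. ?A (\<omega>, t)) \<in> borel_measurable P"
    proof (rule borel_measurable_AE_eq)
      show "AE \<omega> in P. L (\<omega>, t) = ?A (\<omega>, t)" using aeM by eventually_elim (simp add: LA t)
    qed
    show "fv_path (\<lambda>s. ?A (\<omega>, s)) t" if "\<omega> \<in> space P" for \<omega>
      using int[OF that t] unfolding path_integrable_def by (rule conjunct1)
  qed
  \<comment> \<open>Off \<open>N\<close> the integrand is the stopped \<open>H\<close>; on
    \<open>N\<close> it is 0, which is integrable whatever the path of the integrator.\<close>
  have KA: "integrable_wrt P K ?A"
    unfolding integrable_wrt_def
  proof (intro ballI allI impI)
    fix \<omega> and t :: real assume \<omega>: "\<omega> \<in> space P" and t: "0 \<le> t"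
    show "path_integrable (\<lambda>s. K (\<omega>, s)) (\<lambda>s. ?A (\<omega>, s)) t"
    proof (cases "\<omega> \<in> N")
      case True
      then show ?thesis using fv_processesD(2)[OF Afv \<omega> t] by (intro path_integrable_zero K0)
    next
      case False
      then show ?thesis
        using path_integral_cong(2)[of t "\<lambda>s. ?A (\<omega>, s)" "\<lambda>s. ?A (\<omega>, s)" "\<lambda>s. K (\<omega>, s)" "\<lambda>s. ?H (\<omega>, s)"]
          int[OF \<omega> t] KH \<omega> t by simp
    qed
  qed
  show "stieltjes ?H ?A \<in> fv_processes P"
    unfolding fv_processes_def process_def
  proof (intro CollectI conjI allI impI ballI)
    fix t :: real assume t: "0 \<le> t"
    show "(\<lambda>\<omega>. stieltjes ?H ?A (\<omega>, t)) \<in> borel_measurable P"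
    proof (rule borel_measurable_AE_eq)
      show "(\<lambda>\<omega>. stieltjes K ?A (\<omega>, t)) \<in> borel_measurable P"
        by (rule fv_processesD(1)[OF stieltjes_fv_processes[OF K Afv KA] t])
      show "AE \<omega> in P. stieltjes K ?A (\<omega>, t) = stieltjes ?H ?A (\<omega>, t)"
        using aeN
      proof eventually_elim
        case (elim \<omega>)
        then show ?case
          using path_integral_cong(1)[of t "\<lambda>s. ?A (\<omega>, s)" "\<lambda>s. ?A (\<omega>, s)" "\<lambda>s. K (\<omega>, s)" "\<lambda>s. ?H (\<omega>, s)"]
            KH t by (simp add: stieltjes_def)
      qed
    qed
    show "fv_path (\<lambda>s. stieltjes ?H ?A (\<omega>, s)) t" if "\<omega> \<in> space P" for \<omega>
      using fv_path_path_integral[OF int[OF that t] t] by (simp add: stieltjes_def)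
  qed
  show "stieltjes_on B H A (\<omega>, t) = stieltjes ?H ?A (\<omega>, t)" if t: "(\<omega>, t) \<in> B" "ennreal t \<le> \<tau> \<omega>" for \<omega> t
  proof (rule stieltjes_on_eq[OF t(1)])
    fix s assume s: "0 \<le> s" "s \<le> t"
    have "ennreal s \<le> \<tau> \<omega>" using ennreal_leI[OF s(2)] t(2) by (rule order_trans)
    then show "H (\<omega>, s) = ?H (\<omega>, s)" "A (\<omega>, s) = ?A (\<omega>, s)"
      using psit_down(1)[OF t(1)] s by (simp_all add: stopped_eq)
  qed
qed

lemma fundamental_seq_stopped:
  assumes \<tau>: "fundamental_seq P F B \<tau>" and n: "1 \<le> n"
  shows "stopping P F (\<tau> n)" "sint_cc P (\<lambda>_. 0) (\<tau> n) \<subseteq> B"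
  using assms unfolding fundamental_seq_def by auto

lemma fcs_stopped:
  assumes \<tau>: "fundamental_seq P F B \<tau>"
  shows "fcs P F B (fv_processes P) (stieltjes_on B H A) \<tau>
      (\<lambda>n. stieltjes (stopped P H (\<tau> n)) (stopped P A (\<tau> n)))" (is "fcs _ _ _ _ _ _ ?X")
    and "eq_on P B (stieltjes_on B H A)
      (pasted P B H A \<tau> (\<lambda>n. stieltjes (stopped P H (\<tau> n)) (stopped P A (\<tau> n))))"
proof -
  have mono: "mono_on {1..} (\<lambda>n. \<tau> n \<omega>)" if "\<omega> \<in> space P" for \<omega>
    using \<tau> that unfolding fundamental_seq_def by blast
  have cover: "\<exists>n\<ge>1. ennreal t \<le> \<tau> n \<omega>" if "(\<omega>, t) \<in> B" for \<omega> t
  proof -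
    have "(\<omega>, t) \<in> (\<Union>n\<in>{1..}. sint_cc P (\<lambda>_. 0) (\<tau> n))" using \<tau> that unfolding fundamental_seq_def by blast
    then show ?thesis by (auto simp: sint_cc_def)
  qed
  have ae: "AE \<omega> in P. \<forall>n\<ge>1. \<forall>t. (\<omega>, t) \<in> B \<longrightarrow> ennreal t \<le> \<tau> n \<omega> \<longrightarrow>
      stieltjes_on B H A (\<omega>, t) = ?X n (\<omega>, t)"
    using stopped_stieltjes(5)[OF fundamental_seq_stopped[OF \<tau>]] by (intro AE_I2) blast
  have fv: "?X n \<in> fv_processes P" if "1 \<le> n" for n
    by (rule stopped_stieltjes(4)[OF fundamental_seq_stopped[OF \<tau> that]])
  show "fcs P F B (fv_processes P) (stieltjes_on B H A) \<tau> ?X"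
  proof (rule fcsI[OF coupled_seqI])
    show "process P (?X n)" if "1 \<le> n" for n
      using fv[OF that] unfolding fv_processes_def by blast
  qed (fact fundamental_seq_stopped(1)[OF \<tau>] mono cover ae fv fundamental_seq_tendsto_debut[OF \<tau>])+
  show "eq_on P B (stieltjes_on B H A) (pasted P B H A \<tau> ?X)"
    by (rule eq_on_pasted) (fact mono cover ae)+
qed

lemma stieltjes_on_class: "stieltjes_on B H A \<in> class_on P F B (fv_processes P)"
proof -
  obtain \<tau> where "fundamental_seq P F B \<tau>" by (rule psit_fundamental_seq[OF B])
  from fcs_stopped(1)[OF this] show ?thesis unfolding fcs_def by (rule conjunct1)
qed

end

end

end

text \<open>The stopped integrals in the second part presuppose that the stopped processes are
  measurable, of finite variation and integrable, so these facts appear in the conclusion. For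
  \<open>H\<close> the measurability is up to indistinguishability, because its coupled sequence
  determines it only up to a null set.\<close>

theorem theorem3p4:
  fixes P :: "'a measure" and F :: "real \<Rightarrow> 'a measure"
    and B :: "('a \<times> real) set" and H A :: "'a \<times> real \<Rightarrow> real"
  assumes "usual_filtered_prob_space P F"
    and "psit P F B"
    and "H \<in> class_on P F B (measurable_processes P)"
    and "A \<in> class_on P F B (fv_processes P)"
    and "integrable_on_wrt B H A"
  shows "stieltjes_on B H A \<in> class_on P F B (fv_processes P) \<and>
    (\<forall>T Hs As.
       fcs P F B (measurable_processes P) H T Hs \<and>
       fcs P F B (fv_processes P) A T As \<and>
       (\<forall>n\<ge>1. integrable_wrt P (Hs n) (As n)) \<longrightarrow>
         fcs P F B (fv_processes P) (stieltjes_on B H A) T (\<lambda>n. stieltjes (Hs n) (As n)) \<and>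
         eq_on P B (stieltjes_on B H A) (pasted P B H A T (\<lambda>n. stieltjes (Hs n) (As n)))) \<and>
    (\<forall>S S' Hs As.
       fcs P F B (measurable_processes P) H S Hs \<and>
       fcs P F B (fv_processes P) A S' As \<and>
       (\<forall>n\<ge>1. integrable_wrt P (Hs n) (As n)) \<longrightarrow>
         eq_on P B (stieltjes_on B H A)
           (pasted P B H A (\<lambda>n \<omega>. min (S n \<omega>) (S' n \<omega>)) (\<lambda>n. stieltjes (Hs n) (As n)))) \<and>
    (\<forall>\<tau>. fundamental_seq P F B \<tau> \<longrightarrow>
       (\<forall>n\<ge>1. (\<exists>K\<in>measurable_processes P. indist P K (stopped P H (\<tau> n))) \<and>
              stopped P A (\<tau> n) \<in> fv_processes P \<and>
              integrable_wrt P (stopped P H (\<tau> n)) (stopped P A (\<tau> n))) \<and>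
       fcs P F B (fv_processes P) (stieltjes_on B H A) \<tau>
         (\<lambda>n. stieltjes (stopped P H (\<tau> n)) (stopped P A (\<tau> n))) \<and>
       eq_on P B (stieltjes_on B H A)
         (pasted P B H A \<tau> (\<lambda>n. stieltjes (stopped P H (\<tau> n)) (stopped P A (\<tau> n))))) \<and>
    (\<forall>\<tau> \<tau>'. fundamental_seq P F B \<tau> \<and> fundamental_seq P F B \<tau>' \<longrightarrow>
       eq_on P B (stieltjes_on B H A)
         (pasted P B H A \<tau>' (\<lambda>n. stieltjes (stopped P H (\<tau>' n)) (stopped P A (\<tau>' n)))))"
proof -
  interpret usual_filtered_prob_space P F by fact
  note hyps = assms(2-5)
  have stopped: "(\<exists>K\<in>measurable_processes P. indist P K (stopped P H (\<tau> n))) \<and>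
      stopped P A (\<tau> n) \<in> fv_processes P \<and> integrable_wrt P (stopped P H (\<tau> n)) (stopped P A (\<tau> n))"
    if "fundamental_seq P F B \<tau>" "1 \<le> n" for \<tau> n
    using stopped_stieltjes(1-3)[OF hyps fundamental_seq_stopped[OF hyps that]] by blast
  show ?thesis
    using stieltjes_on_class[OF hyps] fcs_stieltjes[OF hyps] eq_on_pasted_min[OF hyps] stopped fcs_stopped[OF hyps]
    by (intro conjI allI impI) blast+
qed

end
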